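(* The resolution set $Re(d_\infty)$ is a topological invariant of a pseudo DP diagram $d_\infty$: if $d_\infty$ and $d'_\infty$ are pseudo DP diagrams of pseudo DP equivalent pseudo DP tangles, then $Re(d_\infty)=Re(d'_\infty)$, where the elements of resolution sets (classical DP tangles) are considered up to DP isotopy. Furthermore, applying any invariant of classical DP tangles to the elements of $Re(d_\infty)$ also induces an invariant of $d_\infty$: for every DP isotopy invariant $f$ of classical DP tangles, the set $\{f(t): t\in Re(d_\infty)\}$ is the same for any two such $d_\infty$ and $d'_\infty$.
   Context: **Pseudo diagrams.** $I=[0,1]$, $T^2$ is the torus, $\mathbb{E}^2$ the Euclidean plane. A pseudo link diagram in $T^2$ is a regular link diagram (finitely many transverse double points) in which each double point is either a classical crossing (with over/under information) or a precrossing (over/under information missing, i.e. unknown). Pseudo Reidemeister equivalence is generated by surface isotopy, the classical Reidemeister moves R1, R2, R3, and all versions of the pseudo Reidemeister moves: PR1 (creation or removal of a kink whose only double point is a precrossing); PR2 (in a two-strand twist consisting of one classical crossing and one precrossing, the order of the two is interchanged, keeping the type of the classical crossing); PR3, PR3$'$ (an arc passing entirely over, respectively entirely under, the two arcs of a precrossing is slid across the precrossing). **Pseudo DP diagrams.** Let $(u,v)$ be a basis of $\mathbb{E}^2$ and $\rho:\mathbb{E}^2\to T^2$ the universal covering map assigning a longitude $l$ to $u$ and a meridian $m$ to $v$. For a pseudo link diagram $d$ in $T^2$, the lifting $d_\infty$ of $d$ under $\rho$ is a pseudo DP diagram and $d$ is a pseudo motif of $d_\infty$ (a flat pseudo motif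 when viewed in the parallelogram obtained by cutting $T^2$ along $(l,m)$). The set $\Lambda=\{xu+yv:x,y\in\mathbb{Z}\}$ is a supporting lattice and $d=d_\infty/\Lambda$. **Homologous precrossings.** Two precrossings of $d_\infty$ (or of a finite cover of $d$) are homologous if they lie in the preimage of the same precrossing of $d$; they bear the same missing information. The set of precrossings of $d_\infty$ is thus partitioned into classes of homologous precrossings, and this marking is part of the data of $d_\infty$ and of finite covers of $d$. **Classical DP tangles.** A classical DP tangle is the lift to $\mathbb{E}^2\times I$, under the universal covering map $\mathbb{E}^2\times I\to T^2\times I$, of a link in $T^2\times I$. Two DP tangles are DP isotopic if they are related via an ambient isotopy of $\mathbb{E}^2\times I$ that preserves double periodicity; this includes orientation-preserving invertible affine transformations of the plane carrying the tangles along. **Pseudo DP tangles and their equivalence.** A toroidal pseudo link diagram lifts to a spatial pseudo link in $T^2\times I$: classical crossings are placed in small 3-balls with the over arc in the upper boundary and the under arc in the lower boundary, precrossings are supported by small rigid embedded discs, and the remaining arcs are embedded. A pseudo DP tangle is the lifting of such a spatial pseudo link under $\tilde\rho:\mathbb{E}^2\times I\to T^2\times I$ (the trivial extension of $\rho$); equivalently it is the spatial lift of a pseudo DP diagram, with the same missing information on homologous precrossings. Two pseudo DP tangles are pseudo DP equivalent (pseudo DP isotopic) if they are related via an ambient isotopy of the thickened plane, respecting arc and disc isotopies, that preserves double periodicity. As a convention recalled from the theory of toroidal pseudo links, isotopy of spatial pseudo links in $T^2\times I$ corresponds to pseudo Reidemeister equivalence of their diagrams in $T^2$ (so it includes PR1).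 On the level of motifs, pseudo DP equivalence is generated by: pseudo Reidemeister equivalence in $T^2$ (surface isotopies and classical and pseudo Reidemeister moves); shifts of the longitude-meridian pair; re-scalings of the torus (inflations and deflations); Dehn twists; and pseudo cover equivalence, i.e. replacing $d_\infty/\Lambda_1$ by $d_\infty/\Lambda_2$ for lattices $\Lambda_1,\Lambda_2$ of $d_\infty$ both contained in a lattice $\Lambda_0$ of $d_\infty$, the lattices being compatible with the marking of homologous precrossings. **Resolution set.** A resolution of a pseudo DP diagram $d_\infty$ is a classical DP tangle obtained by assigning to every precrossing belonging to the same class of homologous precrossings the same type of crossing (positive or negative). The set of all resolutions of $d_\infty$ is its resolution set $Re(d_\infty)$. *)

theory Defs
  imports "HOL-Analysis.Analysis"
begin

section \<open>The torus and its universal cover\<close>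

type_synonym plane = "real ^ 2"
type_synonym torus_pt = "complex \<times> complex"
type_synonym slab_pt = "plane \<times> real"

definition torus :: "torus_pt set" where
  "torus = sphere 0 1 \<times> sphere 0 1"

definition plane_basis :: "plane \<Rightarrow> plane \<Rightarrow> bool" where
  "plane_basis u v \<longleftrightarrow> independent {u, v} \<and> u \<noteq> v"

text \<open>For a basis, this is \<open>x u + y v \<mapsto> (exp (2 \<pi> i x), exp (2 \<pi> i y))\<close>: the direction \<open>u\<close>
  covers the longitude and \<open>v\<close> the meridian.\<close>

definition univ_cover :: "plane \<Rightarrow> plane \<Rightarrow> plane \<Rightarrow> torus_pt" where
  "univ_cover u v q =
     (cis (2 * pi * representation {u, v} q u), cis (2 * pi * representation {u, v} q v))"

definition lattice :: "plane \<Rightarrow> plane \<Rightarrow> plane set" where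
  "lattice u v = {of_int x *\<^sub>R u + of_int y *\<^sub>R v | x y :: int. True}"

definition circles :: "nat \<Rightarrow> (nat \<times> complex) set" where
  "circles n = {..<n} \<times> sphere 0 1"

definition orientation_preserving_linear :: "(plane \<Rightarrow> plane) \<Rightarrow> bool" where
  "orientation_preserving_linear A \<longleftrightarrow> linear A \<and> det (matrix A) > 0"

section \<open>Classical DP tangles and DP isotopy\<close>

text \<open>The last conjunct is local flatness, i.e. the link is tame.\<close>

definition thick_torus_link :: "(torus_pt \<times> real) set \<Rightarrow> bool" where
  "thick_torus_link L \<longleftrightarrow>
     L \<subseteq> torus \<times> {0<..<1} \<and>
     (\<exists>n k. continuous_on (circles n) k \<and> inj_on k (circles n) \<and> k ` circles n = L) \<and>
     (\<forall>x\<in>L. \<exists>U f g. openin (top_of_set (torus \<times> {0<..<1})) U \<and> x \<in> U \<and>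
        homeomorphism U (ball (0 :: complex \<times> real) 1) f g \<and>
        f ` (L \<inter> U) = {w \<in> ball 0 1. fst w = 0})"

definition tangle_lift :: "plane \<Rightarrow> plane \<Rightarrow> (torus_pt \<times> real) set \<Rightarrow> slab_pt set" where
  "tangle_lift u v L = {(q, z). (univ_cover u v q, z) \<in> L}"

definition DP_tangle_over :: "plane \<Rightarrow> plane \<Rightarrow> slab_pt set \<Rightarrow> bool" where
  "DP_tangle_over u v t \<longleftrightarrow> plane_basis u v \<and> (\<exists>L. thick_torus_link L \<and> t = tangle_lift u v L)"

definition classical_DP_tangle :: "slab_pt set \<Rightarrow> bool" where
  "classical_DP_tangle t \<longleftrightarrow> (\<exists>u v. DP_tangle_over u v t)"

definition slab :: "slab_pt set" where
  "slab = UNIV \<times> {0..1}"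

text \<open>Preservation of double periodicity: at each time \<open>s\<close> the homeomorphism \<open>H s\<close> conjugates the
  translations by a lattice of the initial tangle to the translations by a (possibly moving)
  lattice, so that \<open>H s ` t\<close> is a DP tangle throughout.\<close>

definition DP_ambient_isotopy :: "slab_pt set \<Rightarrow> slab_pt set \<Rightarrow> bool" where
  "DP_ambient_isotopy t t' \<longleftrightarrow>
     (\<exists>(H :: real \<Rightarrow> slab_pt \<Rightarrow> slab_pt) u v.
        continuous_on ({0..1} \<times> slab) (\<lambda>(s, w). H s w) \<and>
        (\<forall>s\<in>{0..1}. \<exists>g. homeomorphism slab slab (H s) g) \<and>
        (\<forall>w\<in>slab. H 0 w = w) \<and>
        DP_tangle_over (u 0) (v 0) t \<and> H 1 ` t = t' \<and>
        (\<forall>s\<in>{0..1}. plane_basis (u s) (v s) \<and>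
           (\<forall>q. \<forall>z\<in>{0..1}.
              H s (q + u 0, z) = H s (q, z) + (u s, 0) \<and>
              H s (q + v 0, z) = H s (q, z) + (v s, 0))))"

definition affine_move :: "slab_pt set \<Rightarrow> slab_pt set \<Rightarrow> bool" where
  "affine_move t t' \<longleftrightarrow>
     (\<exists>A c. orientation_preserving_linear A \<and> t' = (\<lambda>(q, z). (A q + c, z)) ` t)"

definition DP_isotopic :: "slab_pt set \<Rightarrow> slab_pt set \<Rightarrow> bool" where
  "DP_isotopic = equivclp (\<lambda>t t'. classical_DP_tangle t \<and> classical_DP_tangle t' \<and>
                                  (DP_ambient_isotopy t t' \<or> affine_move t t'))"

definition DP_isotopy_class :: "slab_pt set \<Rightarrow> slab_pt set set" where
  "DP_isotopy_class t = {t'. classical_DP_tangle t' \<and> DP_isotopic t t'}"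

definition DP_isotopy_invariant :: "(slab_pt set \<Rightarrow> 'z) \<Rightarrow> bool" where
  "DP_isotopy_invariant f \<longleftrightarrow>
     (\<forall>t t'. classical_DP_tangle t \<and> classical_DP_tangle t' \<and> DP_isotopic t t' \<longrightarrow> f t = f t')"

section \<open>Pseudo diagrams\<close>

text \<open>
  A diagram on a surface is a parametrised curve. \<open>params\<close> is the source 1-manifold (circles for a
  diagram on the torus, its pullback covering for a diagram in the plane) and \<open>curve\<close> the immersion.
  A double point has two preimages, its strands. \<open>over\<close> contains the upper strand of each classical
  crossing and no strand of a precrossing. \<open>homol\<close> is the marking: it relates strands of homologous
  precrossings that correspond to each other, so that giving two homologous precrossings the same
  type of crossing means putting corresponding strands on top. (Recording the correspondence of
  strands avoids having to choose an orientation of the link.)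
\<close>

record ('p, 's) pseudo_diagram =
  params :: "'p set"
  curve  :: "'p \<Rightarrow> 's"
  over   :: "'p set"
  homol  :: "('p \<times> 'p) set"

definition partner_strands :: "('p, 's) pseudo_diagram \<Rightarrow> 'p \<Rightarrow> 'p \<Rightarrow> bool" where
  "partner_strands d p q \<longleftrightarrow>
     p \<in> params d \<and> q \<in> params d \<and> p \<noteq> q \<and> curve d p = curve d q"

definition double_strands :: "('p, 's) pseudo_diagram \<Rightarrow> 'p set" where
  "double_strands d = {p. \<exists>q. partner_strands d p q}"

definition pre_strands :: "('p, 's) pseudo_diagram \<Rightarrow> 'p set" where
  "pre_strands d = {p. p \<notin> over d \<and> (\<exists>q. partner_strands d p q \<and> q \<notin> over d)}"

definition transverse_at ::
  "(nat \<times> complex, torus_pt) pseudo_diagram \<Rightarrow> nat \<times> complex \<Rightarrow> nat \<times> complex \<Rightarrow> bool" where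
  "transverse_at d p q \<longleftrightarrow>
     (\<exists>U f g N N'. openin (top_of_set torus) U \<and> curve d p \<in> U \<and>
        homeomorphism U (ball (0 :: complex) 1) f g \<and> f (curve d p) = 0 \<and>
        openin (top_of_set (params d)) N \<and> p \<in> N \<and>
        openin (top_of_set (params d)) N' \<and> q \<in> N' \<and>
        (\<forall>r\<in>N. curve d r \<in> U \<and> Im (f (curve d r)) = 0) \<and>
        (\<forall>r\<in>N'. curve d r \<in> U \<and> Re (f (curve d r)) = 0))"

text \<open>Marked pseudo link diagrams on the torus. Finiteness of \<open>double_strands\<close> makes the curve
  locally injective. A diagram without a chosen marking has \<open>homol d = Id_on (pre_strands d)\<close>; other
  markings occur on finite covers.\<close>

type_synonym motif = "(nat \<times> complex, torus_pt) pseudo_diagram"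

definition valid_marking :: "('p, 's) pseudo_diagram \<Rightarrow> bool" where
  "valid_marking d \<longleftrightarrow>
     homol d \<subseteq> pre_strands d \<times> pre_strands d \<and> equiv (pre_strands d) (homol d) \<and>
     (\<forall>p q p' q'. (p, p') \<in> homol d \<and> partner_strands d p q \<and> partner_strands d p' q'
        \<longrightarrow> (q, q') \<in> homol d) \<and>
     (\<forall>p q. partner_strands d p q \<longrightarrow> (p, q) \<notin> homol d)"

definition pseudo_motif :: "motif \<Rightarrow> bool" where
  "pseudo_motif d \<longleftrightarrow>
     (\<exists>n. params d = circles n) \<and>
     continuous_on (params d) (curve d) \<and> curve d ` params d \<subseteq> torus \<and>
     finite (double_strands d) \<and>
     (\<forall>p q r. partner_strands d p q \<and> partner_strands d p r \<longrightarrow> q = r) \<and>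
     (\<forall>p q. partner_strands d p q \<longrightarrow> transverse_at d p q) \<and>
     over d \<subseteq> double_strands d \<and>
     (\<forall>p q. partner_strands d p q \<longrightarrow> \<not> (p \<in> over d \<and> q \<in> over d)) \<and>
     valid_marking d"

text \<open>The pseudo DP diagram of a motif. Two precrossings are homologous if they lie over the same
  precrossing of the motif, or over homologous ones when the motif is itself marked.\<close>

definition diagram_lift ::
  "plane \<Rightarrow> plane \<Rightarrow> ('p, torus_pt) pseudo_diagram \<Rightarrow> (plane \<times> 'p, plane) pseudo_diagram" where
  "diagram_lift u v d =
    (let P = {(q, p). p \<in> params d \<and> univ_cover u v q = curve d p} in
     \<lparr> params = P,
       curve = fst,
       over = {w \<in> P. snd w \<in> over d},
       homol = {(w, w'). w \<in> P \<and> w' \<in> P \<and> (snd w, snd w') \<in> homol d} \<rparr>)"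

text \<open>Diagrams that differ only in the parametrisation are the same diagram.\<close>

definition same_diagram ::
  "('p :: topological_space, 's) pseudo_diagram \<Rightarrow> ('q :: topological_space, 's) pseudo_diagram
    \<Rightarrow> bool" where
  "same_diagram d d' \<longleftrightarrow>
     (\<exists>b g. homeomorphism (params d) (params d') b g \<and>
        (\<forall>p\<in>params d. curve d' (b p) = curve d p) \<and>
        b ` over d = over d' \<and> map_prod b b ` homol d = homol d')"

section \<open>Resolution sets\<close>

text \<open>\<open>Ov\<close> is the set of upper strands after the resolution of all precrossings.\<close>

definition resolution_choice :: "('p, 's) pseudo_diagram \<Rightarrow> 'p set \<Rightarrow> bool" where
  "resolution_choice D Ov \<longleftrightarrow>
     over D \<subseteq> Ov \<and> Ov \<subseteq> double_strands D \<and>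
     (\<forall>p q. partner_strands D p q \<longrightarrow> (p \<in> Ov \<longleftrightarrow> q \<notin> Ov)) \<and>
     (\<forall>(p, q) \<in> homol D. p \<in> Ov \<longleftrightarrow> q \<in> Ov)"

definition spatial_lift ::
  "('p :: topological_space, plane) pseudo_diagram \<Rightarrow> 'p set \<Rightarrow> slab_pt set \<Rightarrow> bool" where
  "spatial_lift D Ov t \<longleftrightarrow>
     (\<exists>h :: 'p \<Rightarrow> real. continuous_on (params D) h \<and>
        (\<forall>p\<in>params D. 0 < h p \<and> h p < 1) \<and>
        (\<forall>p q. partner_strands D p q \<and> p \<in> Ov \<and> q \<notin> Ov \<longrightarrow> h q < h p) \<and>
        t = (\<lambda>p. (curve D p, h p)) ` params D)"

definition resolution_set ::
  "plane \<Rightarrow> plane \<Rightarrow> ('p :: topological_space, plane) pseudo_diagram \<Rightarrow> slab_pt set set" where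
  "resolution_set u v D =
     {t. DP_tangle_over u v t \<and> (\<exists>Ov. resolution_choice D Ov \<and> spatial_lift D Ov t)}"

section \<open>Pseudo Reidemeister moves\<close>

text \<open>
  A local picture consists of \<open>k\<close> arcs in the square, parametrised by \<open>{-1..1}\<close>, and a set of upper
  strands; a strand of a picture is a pair of an arc index and a parameter.
\<close>

type_synonym arcs = "nat \<Rightarrow> real \<Rightarrow> real \<times> real"
type_synonym local_strand = "nat \<times> real"

definition square :: "(real \<times> real) set" where
  "square = {-1..1} \<times> {-1..1}"

definition straight_pic :: arcs where
  "straight_pic j t = (t, 0)"

text \<open>The kink crosses itself at the parameters \<open>1/2\<close> and \<open>-1/2\<close>.\<close>

definition kink_pic :: arcs where
  "kink_pic j t = ((4 * t ^ 3 - t) / 3, (1 - t\<^sup>2) / 2)"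

text \<open>The two arcs of the clasp cross at the parameters \<open>-1/2\<close> and \<open>1/2\<close> (of either arc).\<close>

definition clasp_pic :: arcs where
  "clasp_pic j t = (if j = 0 then (t, 0) else (t, t\<^sup>2 - 1/4))"

definition parallel_pic :: arcs where
  "parallel_pic j t = (if j = 0 then (t, 0) else (t, 3/4))"

text \<open>Arcs \<open>0\<close> and \<open>1\<close> cross at the origin; arc \<open>2\<close> passes to the left (\<open>\<epsilon> = -1\<close>) or to the right
  (\<open>\<epsilon> = 1\<close>) of that crossing.\<close>

definition triangle_pic :: "real \<Rightarrow> arcs" where
  "triangle_pic \<epsilon> j t =
     (if j = 0 then (t, t / 2) else if j = 1 then (t, - t / 2) else (\<epsilon> * (1 - t\<^sup>2) / 2, t))"

text \<open>Upper strands when arc \<open>j\<close> lies at level \<open>l j\<close>; crossings of arcs at the same level are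
  precrossings.\<close>

definition layered :: "nat \<Rightarrow> arcs \<Rightarrow> (nat \<Rightarrow> nat) \<Rightarrow> local_strand set" where
  "layered k a l = {(j, s). j < k \<and> s \<in> {-1..1} \<and>
     (\<exists>i<k. \<exists>t\<in>{-1..1}. a i t = a j s \<and> l i < l j)}"

text \<open>
  \<open>std_move k a O a' O' \<tau>\<close>: the picture \<open>(a, O)\<close> may be replaced by \<open>(a', O')\<close>, and \<open>\<tau>\<close> says which
  precrossing strands of the two pictures correspond. In \<open>PR2\<close> the curves do not change, but the
  crossing information at the two double points is interchanged; since a clasp with two crossings
  of the same type alternates, the arc that is upper at one double point becomes the lower one at
  the other. Mirror images arise from orientation-reversing charts in \<open>local_move\<close>.
\<close>

inductive std_move ::
  "nat \<Rightarrow> arcs \<Rightarrow> local_strand set \<Rightarrow> arcs \<Rightarrow> local_strand set \<Rightarrow>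
    (local_strand \<times> local_strand) set \<Rightarrow> bool" where
  R1: "s = 1/2 \<or> s = -1/2 \<Longrightarrow> std_move 1 kink_pic {(0, s)} straight_pic {} {}"
| R2: "l 0 \<noteq> l 1 \<Longrightarrow> std_move 2 clasp_pic (layered 2 clasp_pic l) parallel_pic {} {}"
| R3: "inj_on l {..<3} \<Longrightarrow>
    std_move 3 (triangle_pic (-1)) (layered 3 (triangle_pic (-1)) l)
               (triangle_pic 1) (layered 3 (triangle_pic 1) l) {}"
| PR1: "std_move 1 kink_pic {} straight_pic {} {}"
| PR2: "i = 0 \<and> j = 1 \<or> i = 1 \<and> j = 0 \<Longrightarrow>
    std_move 2 clasp_pic {(i, -1/2)} clasp_pic {(j, 1/2)}
      {((i, 1/2), (j, -1/2)), ((j, 1/2), (i, -1/2))}"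
| PR3: "l 0 = l 1 \<and> l 0 < l 2 \<Longrightarrow>
    std_move 3 (triangle_pic (-1)) (layered 3 (triangle_pic (-1)) l)
               (triangle_pic 1) (layered 3 (triangle_pic 1) l) Id"
| PR3': "l 0 = l 1 \<and> l 2 < l 0 \<Longrightarrow>
    std_move 3 (triangle_pic (-1)) (layered 3 (triangle_pic (-1)) l)
               (triangle_pic 1) (layered 3 (triangle_pic 1) l) Id"

text \<open>The chart \<open>\<phi>\<close> embeds the square in the torus; the map \<open>e j\<close> identifies arc \<open>j\<close> of the picture
  with an interval of the link. The last conjunct says that the marking is carried along.\<close>

definition local_move :: "motif \<Rightarrow> motif \<Rightarrow> bool" where
  "local_move d d' \<longleftrightarrow>
     (\<exists>k a Ov a' Ov' \<tau> (\<phi> :: real \<times> real \<Rightarrow> torus_pt) (e :: nat \<Rightarrow> real \<Rightarrow> nat \<times> complex).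
        std_move k a Ov a' Ov' \<tau> \<and>
        continuous_on square \<phi> \<and> inj_on \<phi> square \<and> \<phi> ` square \<subseteq> torus \<and>
        (\<forall>j<k. continuous_on {-1..1} (e j)) \<and>
        inj_on (\<lambda>(j, t). e j t) ({..<k} \<times> {-1..1}) \<and>
        (let J = (\<lambda>(j, t). e j t) ` ({..<k} \<times> {-1..1});
             M = {(p, p) | p. p \<in> params d - J} \<union>
                 {(e j t, e j' t') | j t j' t'. j < k \<and> j' < k \<and> t \<in> {-1..1} \<and> t' \<in> {-1..1} \<and>
                    ((j, t), (j', t')) \<in> \<tau>}
         in {p \<in> params d. curve d p \<in> \<phi> ` square} = J \<and>
            params d' = params d \<and>
            (\<forall>p \<in> params d - J. curve d' p = curve d p \<and> (p \<in> over d' \<longleftrightarrow> p \<in> over d)) \<and>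
            (\<forall>j<k. \<forall>t\<in>{-1..1}.
               curve d (e j t) = \<phi> (a j t) \<and> curve d' (e j t) = \<phi> (a' j t) \<and>
               (e j t \<in> over d \<longleftrightarrow> (j, t) \<in> Ov) \<and> (e j t \<in> over d' \<longleftrightarrow> (j, t) \<in> Ov')) \<and>
            (\<forall>p q p' q'. (p, p') \<in> M \<and> (q, q') \<in> M \<and>
               p \<in> pre_strands d \<and> q \<in> pre_strands d \<and>
               p' \<in> pre_strands d' \<and> q' \<in> pre_strands d' \<longrightarrow>
               ((p, q) \<in> homol d \<longleftrightarrow> (p', q') \<in> homol d'))))"

definition push_diagram :: "(torus_pt \<Rightarrow> torus_pt) \<Rightarrow> motif \<Rightarrow> motif" where
  "push_diagram F d = d\<lparr>curve := F \<circ> curve d\<rparr>"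

definition surface_isotopy :: "motif \<Rightarrow> motif \<Rightarrow> bool" where
  "surface_isotopy d d' \<longleftrightarrow>
     (\<exists>F :: real \<Rightarrow> torus_pt \<Rightarrow> torus_pt.
        continuous_on ({0..1} \<times> torus) (\<lambda>(s, x). F s x) \<and>
        (\<forall>s\<in>{0..1}. \<exists>g. homeomorphism torus torus (F s) g) \<and>
        (\<forall>x\<in>torus. F 0 x = x) \<and> same_diagram (push_diagram (F 1) d) d')"

definition pseudo_reidemeister_step :: "motif \<Rightarrow> motif \<Rightarrow> bool" where
  "pseudo_reidemeister_step d d' \<longleftrightarrow> surface_isotopy d d' \<or> local_move d d'"

section \<open>Pseudo DP equivalence\<close>

text \<open>
  A triple \<open>(u, v, d)\<close> stands for the pseudo DP diagram \<open>diagram_lift u v d\<close>, and for the pseudo DP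
  tangle it represents. Re-scalings of the torus comprise, as in DP isotopy, all changes of the
  basis by an orientation-preserving linear map. In \<open>cover\<close>, both motifs are quotients of one
  marked pseudo DP diagram, which also has a motif for a lattice containing both lattices.
\<close>

inductive motif_step ::
  "plane \<times> plane \<times> motif \<Rightarrow> plane \<times> plane \<times> motif \<Rightarrow> bool" where
  reidemeister: "\<lbrakk>plane_basis u v; pseudo_motif d; pseudo_motif d'; pseudo_reidemeister_step d d'\<rbrakk>
    \<Longrightarrow> motif_step (u, v, d) (u, v, d')"
| shift: "\<lbrakk>plane_basis u v; pseudo_motif d; pseudo_motif d'; cmod \<alpha> = 1; cmod \<beta> = 1;
      same_diagram (push_diagram (\<lambda>(x, y). (\<alpha> * x, \<beta> * y)) d) d'\<rbrakk>
    \<Longrightarrow> motif_step (u, v, d) (u, v, d')"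
| rescale: "\<lbrakk>plane_basis u v; pseudo_motif d; orientation_preserving_linear A\<rbrakk>
    \<Longrightarrow> motif_step (u, v, d) (A u, A v, d)"
| dehn_longitude: "\<lbrakk>plane_basis u v; pseudo_motif d; pseudo_motif d';
      same_diagram (push_diagram (\<lambda>(x, y). (x * y, y)) d) d'\<rbrakk>
    \<Longrightarrow> motif_step (u, v, d) (u, v, d')"
| dehn_meridian: "\<lbrakk>plane_basis u v; pseudo_motif d; pseudo_motif d';
      same_diagram (push_diagram (\<lambda>(x, y). (x, x * y)) d) d'\<rbrakk>
    \<Longrightarrow> motif_step (u, v, d) (u, v, d')"
| cover: "\<lbrakk>plane_basis u\<^sub>0 v\<^sub>0; plane_basis u v; plane_basis u' v';
      pseudo_motif d\<^sub>0; pseudo_motif d; pseudo_motif d';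
      lattice u v \<subseteq> lattice u\<^sub>0 v\<^sub>0; lattice u' v' \<subseteq> lattice u\<^sub>0 v\<^sub>0;
      same_diagram (diagram_lift u v d) (diagram_lift u\<^sub>0 v\<^sub>0 d\<^sub>0);
      same_diagram (diagram_lift u' v' d') (diagram_lift u\<^sub>0 v\<^sub>0 d\<^sub>0)\<rbrakk>
    \<Longrightarrow> motif_step (u, v, d) (u', v', d')"

definition pseudo_DP_equivalent ::
  "plane \<times> plane \<times> motif \<Rightarrow> plane \<times> plane \<times> motif \<Rightarrow> bool" where
  "pseudo_DP_equivalent = equivclp motif_step"

end

theory Submission
  imports Defs
begin

text \<open>
  A resolution of a lifted diagram is periodic, because the over-under information distinguishes the two
  strands of a double point and is itself periodic. So it is the lift of a link in the thickened torus,
  namely of the graph of a height function on the motif, and all height functions inducing the same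
  crossings give isotopic links: the problem of moving one graph to the other by increasing maps of the
  vertical intervals is solved locally and glued by a partition of unity. For a local move it
  therefore suffices to match the resolution choices of the two diagrams and, for one convenient choice of
  heights, to slide the arcs inside the chart. Isotopies of the thickened torus lift to the thickened plane.
  In a change of the lattice the heights are first made periodic under the finer lattice.
\<close>

section \<open>The universal cover of the torus\<close>

text \<open>Curves and heights are only continuous, so no smooth isotopy extension is available: the
  isotopies for local moves and for changes of height are written down explicitly, as increasing
  maps of vertical intervals or as slides in a chart that may depend on the height. Local flatness
  belongs to the definition of a link but is never derived from a diagram. It is carried from a
  given resolution to the constructed one, along an isotopy or through the plane when the lattice
  changes, so every comparison starts from a resolution already known to be a link. An isotopy may
  also pass through pictures that are not regular diagrams, such as a kink flattened onto a segment
  whose points are kept apart by their heights; hence isotopies are stated for graphs over arbitrary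
  curves, not for motifs. For precrossings the delicate point is the marking. The choice at a newly
  created kink may be dictated by homologous precrossings elsewhere; otherwise it is free, and it is
  consistent because a valid marking never relates a strand to its partner.\<close>

lemma cis_2pi_eq_iff: "cis (2 * pi * a) = cis (2 * pi * b) \<longleftrightarrow> a - b \<in> \<int>"
proof
  assume "cis (2 * pi * a) = cis (2 * pi * b)"
  then obtain n :: int where n: "\<i> * complex_of_real (2 * pi * a) = \<i> * complex_of_real (2 * pi * b) + complex_of_real (2 * of_int n * pi) * \<i>"
    by (auto simp: cis_conv_exp exp_eq)
  then have "2 * pi * a = 2 * pi * b + 2 * of_int n * pi"
    by (auto simp: complex_eq_iff)
  then have "(2 * pi) * a = (2 * pi) * (b + of_int n)"
    by (simp add: algebra_simps)
  then have "a = b + of_int n"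
    by (subst (asm) mult_cancel_left) simp
  then show "a - b \<in> \<int>" by simp
next
  assume "a - b \<in> \<int>"
  then obtain n :: int where "a = b + of_int n" by (metis Ints_cases add.commute diff_add_cancel)
  then have "2 * pi * a = 2 * pi * b + 2 * pi * of_int n" by (simp add: algebra_simps)
  then show "cis (2 * pi * a) = cis (2 * pi * b)"
    by (metis cis_mult cis_multiple_2pi Ints_of_int mult.right_neutral)
qed

text \<open>A convex set is contractible, so \<open>f\<close> has a continuous logarithm on it; unit
  modulus makes the logarithm purely imaginary, and dividing its imaginary part by 2 pi gives the
  lift.\<close>

lemma circle_lift_exists:
  fixes f :: "'a::real_normed_vector \<Rightarrow> complex"
  assumes "convex S" "continuous_on S f" "f ` S \<subseteq> sphere 0 1"
  obtains g :: "'a \<Rightarrow> real" where "continuous_on S g" "\<And>x. x \<in> S \<Longrightarrow> f x = cis (2 * pi * g x)"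
proof -
  have norm1: "norm (f x) = 1" if "x \<in> S" for x
    using assms(3) that by auto
  obtain l where l: "continuous_on S l" "\<And>x. x \<in> S \<Longrightarrow> f x = exp (l x)"
    using continuous_logarithm_on_contractible[OF assms(2) convex_imp_contractible[OF assms(1)]] norm1
    by (metis norm_zero zero_neq_one)
  show thesis
  proof
    show "continuous_on S (\<lambda>x. Im (l x) / (2 * pi))"
      by (intro continuous_intros l) auto
    fix x assume x: "x \<in> S"
    have "exp (Re (l x)) = 1" using norm1[OF x] l(2)[OF x] by simp
    then have "Re (l x) = 0" by simp
    then have "l x = \<i> * of_real (Im (l x))" by (simp add: complex_eq_iff)
    then show "f x = cis (2 * pi * (Im (l x) / (2 * pi)))"
      using l(2)[OF x] by (simp add: cis_conv_exp)
  qed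
qed

text \<open>Two lifts of one map differ by a continuous integer-valued function, which is constant
  on a connected set because distinct integers are at distance at least 1.\<close>

lemma circle_lift_unique:
  fixes f g :: "'a::topological_space \<Rightarrow> real"
  assumes "connected S" "continuous_on S f" "continuous_on S g"
    and "\<And>x. x \<in> S \<Longrightarrow> cis (2 * pi * f x) = cis (2 * pi * g x)"
    and "x0 \<in> S" "f x0 = g x0" "x \<in> S"
  shows "f x = g x"
proof -
  have "(\<lambda>x. f x - g x) constant_on S"
  proof (rule continuous_discrete_range_constant)
    show "continuous_on S (\<lambda>x. f x - g x)" by (intro continuous_intros assms)
    fix x assume x: "x \<in> S"
    show "\<exists>e>0. \<forall>y. y \<in> S \<and> f y - g y \<noteq> f x - g x \<longrightarrow> e \<le> norm (f y - g y - (f x - g x))"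
    proof (intro exI[of _ 1] conjI allI impI)
      fix y assume y: "y \<in> S \<and> f y - g y \<noteq> f x - g x"
      have "f y - g y - (f x - g x) \<in> \<int>"
        using assms(4) x y cis_2pi_eq_iff Ints_diff by blast
      then show "1 \<le> norm (f y - g y - (f x - g x))"
        using y by (simp add: Ints_nonzero_abs_ge1)
    qed auto
  qed (rule assms)
  then show ?thesis using assms(5-7) by (metis (no_types, lifting) constant_on_def eq_iff_diff_eq_0)
qed

text \<open>Names the two coordinate functionals once, so that later proofs argue with linear maps
  instead of \<open>representation\<close>.\<close>

lemma plane_basis_coords:
  assumes "plane_basis u v"
  obtains x y :: "plane \<Rightarrow> real" where "linear x" "linear y" "\<And>q. q = x q *\<^sub>R u + y q *\<^sub>R v"
    "\<And>a b. x (a *\<^sub>R u + b *\<^sub>R v) = a" "\<And>a b. y (a *\<^sub>R u + b *\<^sub>R v) = b"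
    "\<And>q. univ_cover u v q = (cis (2 * pi * x q), cis (2 * pi * y q))"
proof -
  have ind: "independent {u, v}" and ne: "u \<noteq> v" using assms by (auto simp: plane_basis_def)
  have span: "span {u, v} = UNIV"
  proof -
    have "UNIV \<subseteq> span {u, v}"
      by (rule card_ge_dim_independent) (use ind ne in auto)
    then show ?thesis by auto
  qed
  define x where "x q = representation {u, v} q u" for q
  define y where "y q = representation {u, v} q v" for q
  have lx: "linear x" "linear y"
    by (auto intro!: linearI simp: x_def y_def span representation_add[OF ind] representation_scale[OF ind])
  have xu: "x u = 1" "x v = 0" "y u = 0" "y v = 1"
    using ne by (auto simp: x_def y_def representation_basis[OF ind])
  have "q = x q *\<^sub>R u + y q *\<^sub>R v" for q
  proof -
    have "(\<Sum>b\<in>{u, v}. representation {u, v} q b *\<^sub>R b) = q"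
      by (rule sum_representation_eq[OF ind]) (auto simp: span)
    then show ?thesis using ne by (simp add: x_def y_def)
  qed
  moreover have "x (a *\<^sub>R u + b *\<^sub>R v) = a" "y (a *\<^sub>R u + b *\<^sub>R v) = b" for a b
    using xu by (simp_all add: lx linear_add linear_scale)
  ultimately show thesis
    using that lx by (simp add: x_def[symmetric] y_def[symmetric] univ_cover_def)
qed

lemma plane_basis_univ_cover:
  assumes "plane_basis u v"
  shows "univ_cover u v (a *\<^sub>R u + b *\<^sub>R v) = (cis (2 * pi * a), cis (2 * pi * b))"
  using plane_basis_coords[OF assms] by metis

lemma continuous_on_univ_cover:
  assumes "plane_basis u v"
  shows "continuous_on S (univ_cover u v)"
proof -
  obtain x y where xy: "linear x" "linear y" "\<And>q. univ_cover u v q = (cis (2 * pi * x q), cis (2 * pi * y q))"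
    using plane_basis_coords[OF assms] by metis
  have "continuous_on S x" "continuous_on S y"
    using xy(1,2) by (auto simp: linear_continuous_on linear_conv_bounded_linear)
  then show ?thesis unfolding xy(3)[abs_def] cis_conv_exp by (intro continuous_intros)
qed

lemma univ_cover_in_torus: "univ_cover u v q \<in> torus"
  by (simp add: univ_cover_def torus_def)

lemma univ_cover_surj:
  assumes "plane_basis u v" "w \<in> torus"
  obtains q where "univ_cover u v q = w"
proof -
  have "\<exists>a. z = cis (2 * pi * a)" if "z \<in> sphere 0 1" for z :: complex
  proof -
    have "z = cis (Arg z)" using that by (metis Arg_eq mem_sphere_0 cis_conv_exp mult_1 of_real_1 norm_zero zero_neq_one)
    then show ?thesis by (intro exI[of _ "Arg z / (2 * pi)"]) simp
  qed
  then obtain a b where "fst w = cis (2 * pi * a)" "snd w = cis (2 * pi * b)"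
    using assms(2) unfolding torus_def by (metis mem_Times_iff)
  then show thesis using that plane_basis_univ_cover[OF assms(1)] by (metis prod.collapse)
qed

lemma lattice_iff:
  assumes "plane_basis u v"
  shows "q - q' \<in> lattice u v \<longleftrightarrow> univ_cover u v q = univ_cover u v q'"
proof -
  obtain x y where xy: "linear x" "linear y" "\<And>q. q = x q *\<^sub>R u + y q *\<^sub>R v"
    "\<And>a b. x (a *\<^sub>R u + b *\<^sub>R v) = a" "\<And>a b. y (a *\<^sub>R u + b *\<^sub>R v) = b"
    "\<And>q. univ_cover u v q = (cis (2 * pi * x q), cis (2 * pi * y q))"
    using plane_basis_coords[OF assms] by metis
  have "q - q' \<in> lattice u v \<longleftrightarrow> x (q - q') \<in> \<int> \<and> y (q - q') \<in> \<int>"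
    unfolding lattice_def Ints_def using xy(3)[of "q - q'"] xy(4,5)
    by (smt (verit, ccfv_threshold) mem_Collect_eq rangeE rangeI)
  then show ?thesis using xy(1,2,6) by (simp add: linear_diff cis_2pi_eq_iff)
qed

lemma univ_cover_lattice:
  assumes "plane_basis u v" "k \<in> lattice u v"
  shows "univ_cover u v (q + k) = univ_cover u v q"
  using lattice_iff[OF assms(1), of "q + k" q] assms(2) by simp

lemma basis_in_lattice: "u \<in> lattice u v" "v \<in> lattice u v"
  unfolding lattice_def by (rule CollectI, rule exI[of _ 1], rule exI[of _ 0], simp, 
    rule CollectI, rule exI[of _ 0], rule exI[of _ 1], simp)

text \<open>The two circle coordinates are lifted separately; the result is then translated by the
  lattice vector that corrects its value at \<open>x0\<close>.\<close>

lemma univ_cover_lift_exists: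
  fixes f :: "'a::real_normed_vector \<Rightarrow> torus_pt"
  assumes "plane_basis u v" "convex S" "continuous_on S f" "f ` S \<subseteq> torus"
    and "x0 \<in> S" "univ_cover u v q0 = f x0"
  obtains g where "continuous_on S g" "\<And>x. x \<in> S \<Longrightarrow> univ_cover u v (g x) = f x" "g x0 = q0"
proof -
  obtain a where a: "continuous_on S a" "\<And>x. x \<in> S \<Longrightarrow> fst (f x) = cis (2 * pi * a x)"
    by (rule circle_lift_exists[OF assms(2), of "\<lambda>x. fst (f x)"])
      (use assms in \<open>auto simp: torus_def image_subset_iff mem_Times_iff intro!: continuous_intros\<close>)
  obtain b where b: "continuous_on S b" "\<And>x. x \<in> S \<Longrightarrow> snd (f x) = cis (2 * pi * b x)"
    by (rule circle_lift_exists[OF assms(2), of "\<lambda>x. snd (f x)"])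
      (use assms in \<open>auto simp: torus_def image_subset_iff mem_Times_iff intro!: continuous_intros\<close>)
  define g where "g x = a x *\<^sub>R u + b x *\<^sub>R v" for x
  have g: "univ_cover u v (g x) = f x" if "x \<in> S" for x
    using a(2)[OF that] b(2)[OF that] by (simp add: g_def plane_basis_univ_cover[OF assms(1)] prod_eq_iff)
  have "q0 - g x0 \<in> lattice u v"
    using assms(5,6) g by (simp add: lattice_iff[OF assms(1)])
  then have "univ_cover u v (g x + (q0 - g x0)) = f x" if "x \<in> S" for x
    using univ_cover_lattice[OF assms(1)] g that by simp
  moreover have "continuous_on S (\<lambda>x. g x + (q0 - g x0))"
    unfolding g_def by (intro continuous_intros a b)
  ultimately show thesis using that[of "\<lambda>x. g x + (q0 - g x0)"] by simp
qed

lemma univ_cover_lift_unique: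
  fixes f g :: "'a::topological_space \<Rightarrow> plane"
  assumes "plane_basis u v" "connected S" "continuous_on S f" "continuous_on S g"
    and "\<And>x. x \<in> S \<Longrightarrow> univ_cover u v (f x) = univ_cover u v (g x)"
    and "x0 \<in> S" "f x0 = g x0" "x \<in> S"
  shows "f x = g x"
proof -
  obtain a b where ab: "linear a" "linear b" "\<And>q. q = a q *\<^sub>R u + b q *\<^sub>R v"
    "\<And>q. univ_cover u v q = (cis (2 * pi * a q), cis (2 * pi * b q))"
    using plane_basis_coords[OF assms(1)] by metis
  have c: "continuous_on S (\<lambda>x. a (f x))" "continuous_on S (\<lambda>x. a (g x))"
     "continuous_on S (\<lambda>x. b (f x))" "continuous_on S (\<lambda>x. b (g x))"
    using assms(3,4) ab(1,2) by (auto intro: bounded_linear.continuous_on simp: linear_conv_bounded_linear)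
  have "a (f x) = a (g x)"
    by (rule circle_lift_unique[OF assms(2) c(1,2) _ assms(6) _ assms(8)]) (use assms(5,7) ab(4) in auto)
  moreover have "b (f x) = b (g x)"
    by (rule circle_lift_unique[OF assms(2) c(3,4) _ assms(6) _ assms(8)]) (use assms(5,7) ab(4) in auto)
  ultimately show ?thesis using ab(3) by metis
qed

text \<open>Multiplying the two coordinates by positive reals turns an injective map of a surface into the
  torus into one of an open set of \<open>\<real>\<^sup>4\<close> into \<open>\<complex>\<^sup>2\<close>.\<close>

lemma torus_invariance_of_domain:
  fixes f :: "'a::euclidean_space \<Rightarrow> torus_pt"
  assumes "open S" "continuous_on S f" "inj_on f S" "f ` S \<subseteq> torus" "DIM('a) = 2"
  shows "openin (top_of_set torus) (f ` S)"
proof -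
  define F :: "'a \<times> (real \<times> real) \<Rightarrow> complex \<times> complex"
    where "F w = (of_real (exp (fst (snd w))) * fst (f (fst w)), of_real (exp (snd (snd w))) * snd (f (fst w)))" for w
  have norm1: "norm (fst (f p)) = 1" "norm (snd (f p)) = 1" if "p \<in> S" for p
    using assms(4) that by (auto simp: torus_def image_subset_iff mem_Times_iff)
  have "open (F ` (S \<times> UNIV))"
  proof (rule invariance_of_domain_gen)
    have *: "continuous_on (S \<times> UNIV) (\<lambda>w. f (fst w))" 
      by (rule continuous_on_compose2[OF assms(2)]) (auto intro!: continuous_intros)
    show "continuous_on (S \<times> UNIV) F"
      unfolding F_def by (intro continuous_intros *)
    show "inj_on F (S \<times> UNIV)"
    proof (rule inj_onI)
      fix w w' assume w: "w \<in> S \<times> UNIV" "w' \<in> S \<times> UNIV" and eq: "F w = F w'"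
      have "norm (fst (F w)) = exp (fst (snd w))" "norm (snd (F w)) = exp (snd (snd w))"
        "norm (fst (F w')) = exp (fst (snd w'))" "norm (snd (F w')) = exp (snd (snd w'))"
        using w norm1 by (auto simp: F_def norm_mult)
      then have "snd w = snd w'" using eq by (simp add: prod_eq_iff)
      then have "f (fst w) = f (fst w')" using eq by (auto simp: F_def prod_eq_iff)
      then have "fst w = fst w'" using w assms(3) by (auto dest: inj_onD)
      with \<open>snd w = snd w'\<close> show "w = w'" by (simp add: prod_eq_iff)
    qed
  qed (use assms in \<open>auto simp: open_Times\<close>)
  moreover have "f ` S = torus \<inter> F ` (S \<times> UNIV)"
  proof (intro equalityI subsetI)
    fix z assume z: "z \<in> f ` S"
    then obtain p where p: "p \<in> S" "z = f p" by auto
    then have "z = F (p, 0, 0)" by (simp add: F_def)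
    then show "z \<in> torus \<inter> F ` (S \<times> UNIV)" using z assms(4) p by auto
  next
    fix z assume z: "z \<in> torus \<inter> F ` (S \<times> UNIV)"
    then obtain w where w: "fst w \<in> S" "z = F w" by auto
    have "norm (fst z) = 1" "norm (snd z) = 1" using z by (auto simp: torus_def mem_Times_iff)
    then have "snd w = 0" using norm1[OF w(1)] unfolding w(2) F_def by (simp add: norm_mult prod_eq_iff)
    then show "z \<in> f ` S" using w by (auto simp: F_def)
  qed
  ultimately show ?thesis by (simp add: openin_open_Int)
qed

lemma univ_cover_local_homeomorphism:
  assumes "plane_basis u v"
  obtains B g where "open B" "q0 \<in> B" "openin (top_of_set torus) (univ_cover u v ` B)"
    "homeomorphism B (univ_cover u v ` B) (univ_cover u v) g"
proof -
  let ?\<rho> = "univ_cover u v"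
  obtain x y where xy: "linear x" "linear y" "\<And>q. q = x q *\<^sub>R u + y q *\<^sub>R v"
    "\<And>q. ?\<rho> q = (cis (2 * pi * x q), cis (2 * pi * y q))"
    using plane_basis_coords[OF assms] by metis
  have cxy: "continuous_on UNIV x" "continuous_on UNIV y"
    using xy(1,2) by (auto simp: linear_continuous_on linear_conv_bounded_linear)
  \<comment> \<open>Half-width 1/2 in both coordinates: two points of the open box differ by less
    than 1 in each coordinate, so lattice-equivalent points coincide.\<close>
  define B where "B = {q. \<bar>x q - x q0\<bar> < 1/2} \<inter> {q. \<bar>y q - y q0\<bar> < 1/2}"
  have B: "open B" unfolding B_def
    by (intro open_Int open_Collect_less continuous_intros cxy)
  have inj: "inj_on ?\<rho> B"
  proof (rule inj_onI)
    fix q q' assume q: "q \<in> B" "q' \<in> B" and eq: "?\<rho> q = ?\<rho> q'"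
    have "x q - x q' \<in> \<int>" "y q - y q' \<in> \<int>" using eq xy(4) by (auto simp: cis_2pi_eq_iff)
    moreover have "\<bar>x q - x q'\<bar> < 1" "\<bar>y q - y q'\<bar> < 1" using q unfolding B_def Int_iff mem_Collect_eq by linarith+
    ultimately have "x q = x q'" "y q = y q'" using Ints_nonzero_abs_ge1 by (force, force)
    then show "q = q'" using xy(3) by metis
  qed
  have op: "openin (top_of_set torus) (?\<rho> ` T)" if "open T" "T \<subseteq> B" for T
    by (rule torus_invariance_of_domain)
      (use that inj continuous_on_univ_cover[OF assms] in \<open>auto intro: inj_on_subset simp: univ_cover_in_torus\<close>)
  have op': "openin (top_of_set (?\<rho> ` B)) (?\<rho> ` T)" if "openin (top_of_set B) T" for T
  proof -
    have T: "open T" "T \<subseteq> B" using that B by (auto simp: openin_open_eq)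
    then show ?thesis using op[OF T] by (metis image_mono openin_subset_trans openin_imp_subset op B order_refl)
  qed
  obtain g where "homeomorphism B (?\<rho> ` B) ?\<rho> g"
    using homeomorphism_injective_open_map[OF continuous_on_univ_cover[OF assms] refl inj op'] by blast
  then show thesis using that[OF B _ op[OF B order_refl]] by (auto simp: B_def)
qed

section \<open>Isotopies of the thickened torus and their lifts\<close>

lemma compact_torus: "compact torus"
  unfolding torus_def by (intro compact_Times compact_sphere)

text \<open>Bijectivity at each time is enough because the thickened torus is compact. Preservation
  of the open slab is recorded separately: the links and their flat charts live there.\<close>

definition torus_isotopic :: "(torus_pt \<times> real) set \<Rightarrow> (torus_pt \<times> real) set \<Rightarrow> bool" where
  "torus_isotopic L L' \<longleftrightarrow>
     (\<exists>H :: real \<Rightarrow> torus_pt \<times> real \<Rightarrow> torus_pt \<times> real.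
        continuous_on ({0..1} \<times> (torus \<times> {0..1})) (\<lambda>(s, w). H s w) \<and>
        (\<forall>s\<in>{0..1}. bij_betw (H s) (torus \<times> {0..1}) (torus \<times> {0..1}) \<and>
                   H s ` (torus \<times> {0<..<1}) = torus \<times> {0<..<1}) \<and>
        (\<forall>w\<in>torus \<times> {0..1}. H 0 w = w) \<and> H 1 ` L = L')"

lemma continuous_on_slice:
  assumes "continuous_on (I \<times> W) (\<lambda>(s, w). H s w)" "s \<in> I"
  shows "continuous_on W (H s)"
proof -
  have "continuous_on W (\<lambda>w. (s, w))" by (intro continuous_intros)
  then have "continuous_on W (\<lambda>w. case (s, w) of (s, w) \<Rightarrow> H s w)"
    by (rule continuous_on_compose2[OF assms(1)]) (use assms(2) in auto)
  then show ?thesis by simp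
qed

text \<open>Undo the final map, then run the isotopy backwards: time \<open>s\<close> of the reverse
  is \<open>H (1 - s)\<close> after the inverse of \<open>H 1\<close>, which is continuous by
  compactness.\<close>

lemma torus_isotopic_sym:
  assumes "torus_isotopic L L'" "L \<subseteq> torus \<times> {0..1}"
  shows "torus_isotopic L' L"
proof -
  let ?W = "torus \<times> {0..1::real}" and ?X = "torus \<times> {0<..<1::real}"
  obtain H where H: "continuous_on ({0..1::real} \<times> ?W) (\<lambda>(s, w). H s w)"
    "\<And>s. s \<in> {0..1} \<Longrightarrow> bij_betw (H s) ?W ?W" "\<And>s. s \<in> {0..1} \<Longrightarrow> H s ` ?X = ?X"
    "\<And>w. w \<in> ?W \<Longrightarrow> H 0 w = w" "H 1 ` L = L'"
    using assms unfolding torus_isotopic_def by metis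
  define K where "K = inv_into ?W (H 1)"
  have bij1: "bij_betw (H 1) ?W ?W" using H(2) by simp
  have K: "bij_betw K ?W ?W" unfolding K_def using bij1 by (rule bij_betw_inv_into)
  have KH: "K (H 1 w) = w" if "w \<in> ?W" for w
    using bij1 that by (simp add: K_def bij_betw_def)
  have HK: "H 1 (K w) = w" if "w \<in> ?W" for w
    using bij1 that by (simp add: K_def bij_betw_inv_into_right)
  have Kc: "continuous_on ?W K"
  proof -
    have "continuous_on (H 1 ` ?W) K"
      by (rule continuous_on_inv)
        (use continuous_on_slice[OF H(1), of 1] KH compact_torus in \<open>auto intro: compact_Times\<close>)
    then show ?thesis using bij1 by (simp add: bij_betw_def)
  qed
  have KX: "K ` ?X = ?X"
  proof -
    have "K ` ?X = K ` (H 1 ` ?X)" using H(3)[of 1] by simp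
    also have "\<dots> = (\<lambda>w. w) ` ?X" unfolding image_image by (rule image_cong) (use KH in auto)
    finally show ?thesis by simp
  qed
  show ?thesis
    unfolding torus_isotopic_def
  proof (intro exI[of _ "\<lambda>s w. H (1 - s) (K w)"] conjI ballI)
    have "continuous_on ({0..1} \<times> ?W) (\<lambda>x. case (1 - fst x, K (snd x)) of (s, w) \<Rightarrow> H s w)"
    proof (rule continuous_on_compose2[OF H(1)])
      have "K w \<in> ?W" if "w \<in> ?W" for w using K that by (auto simp: bij_betw_def)
      then show "(\<lambda>x. (1 - fst x, K (snd x))) ` ({0..1::real} \<times> ?W) \<subseteq> {0..1} \<times> ?W"
        by (intro image_subsetI) (auto simp: mem_Times_iff)
    qed (auto intro!: continuous_intros continuous_on_compose2[OF Kc])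
    then show "continuous_on ({0..1} \<times> ?W) (\<lambda>(s, w). H (1 - s) (K w))"
      by (simp add: case_prod_unfold)
    fix s :: real assume s: "s \<in> {0..1}"
    show "bij_betw (\<lambda>w. H (1 - s) (K w)) ?W ?W"
      using bij_betw_trans[OF K H(2)[of "1 - s"]] s by (simp add: comp_def)
    show "(\<lambda>w. H (1 - s) (K w)) ` ?X = ?X"
      using H(3)[of "1 - s"] s unfolding image_image[of "H (1 - s)" K, symmetric] KX by simp
  next
    fix w assume "w \<in> ?W" then show "H (1 - 0) (K w) = w" using HK by simp
  next
    have "(\<lambda>w. H (1 - 1) (K w)) ` L' = (\<lambda>w. H 0 (K (H 1 w))) ` L" using H(5) by (auto simp: image_image)
    also have "\<dots> = (\<lambda>w. w) ` L"
      by (rule image_cong) (use H(4) KH assms(2) in auto)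
    finally show "(\<lambda>w. H (1 - 1) (K w)) ` L' = L" by simp
  qed
qed

section \<open>Lifting isotopies to the thickened plane\<close>

definition thick_cover :: "plane \<Rightarrow> plane \<Rightarrow> slab_pt \<Rightarrow> torus_pt \<times> real" where
  "thick_cover u v w = (univ_cover u v (fst w), snd w)"

lemma mem_tangle_lift: "w \<in> tangle_lift u v L \<longleftrightarrow> thick_cover u v w \<in> L"
  by (simp add: tangle_lift_def thick_cover_def case_prod_unfold)

lemma thick_cover_slab: "w \<in> slab \<Longrightarrow> thick_cover u v w \<in> torus \<times> {0..1}"
  by (auto simp: thick_cover_def slab_def univ_cover_in_torus)

lemma continuous_on_thick_cover:
  "plane_basis u v \<Longrightarrow> continuous_on S (thick_cover u v)"
  unfolding thick_cover_def
  by (intro continuous_intros continuous_on_compose2[OF continuous_on_univ_cover, where t = UNIV]) auto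

lemma convex_slab: "convex slab" unfolding slab_def by (intro convex_Times) auto

text \<open>The time interval times the slab is connected, so lifts that agree at time 0 agree
  throughout. This one principle makes lifted isotopies invertible and equivariant under the
  lattice.\<close>

lemma isotopy_lift_unique:
  assumes uv: "plane_basis u v"
    and "continuous_on ({0..1::real} \<times> slab) f" "continuous_on ({0..1} \<times> slab) g"
    and "\<And>x. x \<in> {0..1} \<times> slab \<Longrightarrow> univ_cover u v (f x) = univ_cover u v (g x)"
    and "\<And>w. w \<in> slab \<Longrightarrow> f (0, w) = g (0, w)" and "x \<in> {0..1} \<times> slab"
  shows "f x = g x"
  by (rule univ_cover_lift_unique[OF uv convex_connected assms(2,3), of "(0, snd x)"])
    (use assms(4-6) in \<open>auto intro!: convex_Times convex_slab\<close>)

text \<open>The time interval times the slab is convex, so the whole family lifts at once. The lift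
  is normalised at a single point of time 0; uniqueness of lifts then makes it the identity on the
  whole slab at time 0.\<close>

lemma isotopy_lift_exists:
  assumes uv: "plane_basis u v"
    and cont: "continuous_on ({0..1::real} \<times> (torus \<times> {0..1})) (\<lambda>(s, w). H s w)"
    and im: "\<And>s w. s \<in> {0..1} \<Longrightarrow> w \<in> torus \<times> {0..1} \<Longrightarrow> H s w \<in> torus \<times> {0..1}"
    and H0: "\<And>w. w \<in> torus \<times> {0..1} \<Longrightarrow> H 0 w = w"
  shows "\<exists>G. continuous_on ({0..1} \<times> slab) (\<lambda>(s, w). G s w) \<and>
    (\<forall>s\<in>{0..1}. \<forall>w\<in>slab. G s w \<in> slab \<and> thick_cover u v (G s w) = H s (thick_cover u v w)) \<and>
    (\<forall>w\<in>slab. G 0 w = w)"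
proof -
  let ?S = "{0..1::real} \<times> slab"
  define F where "F = (\<lambda>x. H (fst x) (thick_cover u v (snd x)))"
  have cF: "continuous_on ?S F"
  proof -
    have "continuous_on ?S (\<lambda>x. case (fst x, thick_cover u v (snd x)) of (s, w) \<Rightarrow> H s w)"
    proof (rule continuous_on_compose2[OF cont])
      show "(\<lambda>x. (fst x, thick_cover u v (snd x))) ` ?S \<subseteq> {0..1} \<times> (torus \<times> {0..1})"
        using thick_cover_slab by (intro image_subsetI) (simp add: mem_Times_iff)
    qed (auto intro!: continuous_intros continuous_on_compose2[OF continuous_on_thick_cover[OF uv, of UNIV]])
    then show ?thesis by (simp add: F_def)
  qed
  have F: "F x \<in> torus \<times> {0..1}" if "x \<in> ?S" for x
    unfolding F_def by (rule im) (use that thick_cover_slab in auto)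
  have F0: "F (0, w) = thick_cover u v w" if "w \<in> slab" for w
    unfolding F_def using H0 thick_cover_slab[OF that] by simp
  have z: "(0::real, (0::plane, 0::real)) \<in> ?S" by (simp add: slab_def)
  obtain g where g: "continuous_on ?S g" "\<And>x. x \<in> ?S \<Longrightarrow> univ_cover u v (g x) = fst (F x)"
    "g (0, (0, 0)) = 0"
    by (rule univ_cover_lift_exists[OF uv, of ?S "\<lambda>x. fst (F x)" "(0, (0, 0))" 0])
      (use cF F F0 z in \<open>auto intro!: continuous_intros convex_Times convex_slab simp: mem_Times_iff image_subset_iff thick_cover_def slab_def\<close>)
  have g0: "g (0, w) = fst w" if "w \<in> slab" for w
  proof (rule univ_cover_lift_unique[OF uv convex_connected[OF convex_slab], of "\<lambda>w. g (0, w)" fst "(0, 0)"])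
    show "continuous_on slab (\<lambda>w. g (0, w))"
      by (rule continuous_on_compose2[OF g(1)]) (auto intro!: continuous_intros)
    show "univ_cover u v (g (0, x)) = univ_cover u v (fst x)" if "x \<in> slab" for x
      using g(2)[of "(0, x)"] F0[OF that] that by (simp add: thick_cover_def)
  qed (use g(3) that in \<open>auto simp: slab_def intro!: continuous_intros\<close>)
  show ?thesis
  proof (intro exI[of _ "\<lambda>s w. (g (s, w), snd (F (s, w)))"] conjI ballI)
    show "continuous_on ?S (\<lambda>(s, w). (g (s, w), snd (F (s, w))))"
      unfolding case_prod_unfold prod.collapse by (intro continuous_intros g cF)
    fix s :: real and w assume sw: "s \<in> {0..1}" "w \<in> slab"
    show "(g (s, w), snd (F (s, w))) \<in> slab"
      using F[of "(s, w)"] sw by (auto simp: slab_def mem_Times_iff)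
    show "thick_cover u v (g (s, w), snd (F (s, w))) = H s (thick_cover u v w)"
      using g(2)[of "(s, w)"] sw by (simp add: thick_cover_def prod_eq_iff F_def)
  next
    fix w assume w: "w \<in> slab"
    show "(g (0, w), snd (F (0, w))) = w"
      using g0[OF w] F0[OF w] by (simp add: thick_cover_def)
  qed
qed

text \<open>Joint continuity of the inverses in time and space: the level-preserving map
  \<open>E\<close> is a continuous bijection of a compact space, so its inverse is
  continuous.\<close>

lemma isotopy_inverse:
  fixes H :: "real \<Rightarrow> torus_pt \<times> real \<Rightarrow> torus_pt \<times> real"
  assumes cont: "continuous_on ({0..1::real} \<times> (torus \<times> {0..1::real})) (\<lambda>(s, w). H s w)"
    and bij: "\<And>s. s \<in> {0..1} \<Longrightarrow> bij_betw (H s) (torus \<times> {0..1}) (torus \<times> {0..1})"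
  shows "\<exists>K. continuous_on ({0..1} \<times> (torus \<times> {0..1})) (\<lambda>(s, w). K s w) \<and>
    (\<forall>s\<in>{0..1}. \<forall>w\<in>torus \<times> {0..1}. K s w \<in> torus \<times> {0..1} \<and> K s (H s w) = w \<and> H s (K s w) = w)"
proof -
  let ?W = "torus \<times> {0..1::real}"
  let ?S = "{0..1::real} \<times> ?W"
  define K where "K s = inv_into ?W (H s)" for s
  have KH: "K s (H s w) = w" if "s \<in> {0..1}" "w \<in> ?W" for s w
    using bij[OF that(1)] that(2) by (simp add: K_def bij_betw_def)
  have HK: "H s (K s w) = w" "K s w \<in> ?W" if "s \<in> {0..1}" "w \<in> ?W" for s w
    using bij[OF that(1)] that(2) bij_betw_inv_into[OF bij[OF that(1)]]
    by (auto simp: K_def bij_betw_inv_into_right bij_betw_def)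
  have Him: "H s w \<in> ?W" if "s \<in> {0..1}" "w \<in> ?W" for s w
    using bij[OF that(1)] that(2) by (auto simp: bij_betw_def)
  define E where "E x = (fst x, H (fst x) (snd x))" for x
  have "continuous_on (E ` ?S) (\<lambda>x. (fst x, K (fst x) (snd x)))"
  proof (rule continuous_on_inv)
    show "continuous_on ?S E"
      unfolding E_def using cont by (auto simp: case_prod_unfold intro!: continuous_intros)
    show "compact ?S" by (intro compact_Times compact_torus) auto
    show "\<forall>x\<in>?S. (fst (E x), K (fst (E x)) (snd (E x))) = x"
      unfolding E_def using KH by (metis SigmaE fst_conv snd_conv)
  qed
  moreover have "E ` ?S = ?S"
  proof (intro equalityI subsetI)
    fix x assume "x \<in> ?S"
    then have "x = E (fst x, K (fst x) (snd x))" "(fst x, K (fst x) (snd x)) \<in> ?S"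
      using HK[of "fst x" "snd x"] by (auto simp: E_def)
    then show "x \<in> E ` ?S" by (rule image_eqI)
  next
    fix x assume "x \<in> E ` ?S" then show "x \<in> ?S"
      unfolding E_def using Him by (elim imageE) (simp add: mem_Times_iff)
  qed
  ultimately have "continuous_on ?S (\<lambda>x. snd (fst x, K (fst x) (snd x)))"
    by (intro continuous_on_snd) simp
  then show ?thesis
    by (intro exI[of _ K] conjI ballI KH HK) (simp_all add: case_prod_unfold)
qed

text \<open>The slab is not compact, so invertibility of the lift cannot be read off from
  bijectivity and continuity. Instead the inverse isotopy is lifted as well; each composite of the
  two lifts covers the identity and starts at the identity, hence is the identity.\<close>

lemma torus_isotopic_lift:
  assumes uv: "plane_basis u v" and L: "thick_torus_link L" and LL': "torus_isotopic L L'"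
  shows "DP_ambient_isotopy (tangle_lift u v L) (tangle_lift u v L')"
proof -
  let ?W = "torus \<times> {0..1::real}"
  let ?S = "{0..1::real} \<times> slab"
  obtain H where H: "continuous_on ({0..1::real} \<times> ?W) (\<lambda>(s, w). H s w)"
    "\<And>s. s \<in> {0..1} \<Longrightarrow> bij_betw (H s) ?W ?W"
    "\<And>w. w \<in> ?W \<Longrightarrow> H 0 w = w" "H 1 ` L = L'"
    using LL' unfolding torus_isotopic_def by metis
  have Him: "H s w \<in> ?W" if "s \<in> {0..1}" "w \<in> ?W" for s w
    using H(2)[OF that(1)] that(2) by (auto simp: bij_betw_def)
  have "\<exists>K. continuous_on ({0..1} \<times> ?W) (\<lambda>(s, w). K s w) \<and>
    (\<forall>s\<in>{0..1}. \<forall>w\<in>?W. K s w \<in> ?W \<and> K s (H s w) = w \<and> H s (K s w) = w)"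
    by (rule isotopy_inverse) (use H in auto)
  then obtain K where K1: "continuous_on ({0..1} \<times> ?W) (\<lambda>(s, w). K s w)"
    and K2: "\<forall>s\<in>{0..1}. \<forall>w\<in>?W. K s w \<in> ?W \<and> K s (H s w) = w \<and> H s (K s w) = w"
    by (elim exE conjE)
  have K: "K s w \<in> ?W" "K s (H s w) = w" "H s (K s w) = w" if "s \<in> {0..1}" "w \<in> ?W" for s w
    using K2[rule_format, OF that] by auto
  have K0: "K 0 w = w" if "w \<in> ?W" for w using K(2)[of 0 w] H(3) that by simp
  have "\<exists>G. continuous_on ?S (\<lambda>(s, w). G s w) \<and>
    (\<forall>s\<in>{0..1}. \<forall>w\<in>slab. G s w \<in> slab \<and> thick_cover u v (G s w) = H s (thick_cover u v w)) \<and>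
    (\<forall>w\<in>slab. G 0 w = w)"
    by (rule isotopy_lift_exists[OF uv]) (use H(1) Him H(3) in auto)
  then obtain G where G1: "continuous_on ?S (\<lambda>(s, w). G s w)"
    and G2: "\<forall>s\<in>{0..1}. \<forall>w\<in>slab. G s w \<in> slab \<and> thick_cover u v (G s w) = H s (thick_cover u v w)"
    and G3: "\<forall>w\<in>slab. G 0 w = w"
    by (elim exE conjE)
  have G: "continuous_on ?S (\<lambda>(s, w). G s w)"
    "\<And>s w. s \<in> {0..1} \<Longrightarrow> w \<in> slab \<Longrightarrow> G s w \<in> slab"
    "\<And>s w. s \<in> {0..1} \<Longrightarrow> w \<in> slab \<Longrightarrow> thick_cover u v (G s w) = H s (thick_cover u v w)"
    "\<And>w. w \<in> slab \<Longrightarrow> G 0 w = w"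
    using G1 G2 G3 by blast+
  have "\<exists>G. continuous_on ?S (\<lambda>(s, w). G s w) \<and>
    (\<forall>s\<in>{0..1}. \<forall>w\<in>slab. G s w \<in> slab \<and> thick_cover u v (G s w) = K s (thick_cover u v w)) \<and>
    (\<forall>w\<in>slab. G 0 w = w)"
    by (rule isotopy_lift_exists[OF uv]) (use K1 K(1) K0 in auto)
  then obtain G' where G'1: "continuous_on ?S (\<lambda>(s, w). G' s w)"
    and G'2: "\<forall>s\<in>{0..1}. \<forall>w\<in>slab. G' s w \<in> slab \<and> thick_cover u v (G' s w) = K s (thick_cover u v w)"
    and G'3: "\<forall>w\<in>slab. G' 0 w = w"
    by (elim exE conjE)
  have G': "continuous_on ?S (\<lambda>(s, w). G' s w)"
    "\<And>s w. s \<in> {0..1} \<Longrightarrow> w \<in> slab \<Longrightarrow> G' s w \<in> slab"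
    "\<And>s w. s \<in> {0..1} \<Longrightarrow> w \<in> slab \<Longrightarrow> thick_cover u v (G' s w) = K s (thick_cover u v w)"
    "\<And>w. w \<in> slab \<Longrightarrow> G' 0 w = w"
    using G'1 G'2 G'3 by blast+
  \<comment> \<open>Stated for arbitrary \<open>A\<close> and \<open>B\<close>, since it is applied
    to both orders of composition.\<close>
  have inverse: "B s (A s w) = w"
    if A: "continuous_on ?S (\<lambda>(s, w). A s w)" "\<And>s w. s \<in> {0..1} \<Longrightarrow> w \<in> slab \<Longrightarrow> A s w \<in> slab"
      "\<And>w. w \<in> slab \<Longrightarrow> A 0 w = w"
    and B: "continuous_on ?S (\<lambda>(s, w). B s w)" "\<And>w. w \<in> slab \<Longrightarrow> B 0 w = w"
    and BA: "\<And>s w. s \<in> {0..1} \<Longrightarrow> w \<in> slab \<Longrightarrow> thick_cover u v (B s (A s w)) = thick_cover u v w"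
    and sw: "s \<in> {0..1}" "w \<in> slab" for A B :: "real \<Rightarrow> slab_pt \<Rightarrow> slab_pt" and s w
  proof -
    have cA: "continuous_on ?S (\<lambda>x. (fst x, A (fst x) (snd x)))"
      using A(1) by (auto simp: case_prod_unfold intro!: continuous_intros)
    have "continuous_on ?S (\<lambda>x. case (fst x, A (fst x) (snd x)) of (s, w) \<Rightarrow> B s w)"
      by (rule continuous_on_compose2[OF B(1) cA]) (use A(2) in auto)
    then have cB: "continuous_on ?S (\<lambda>x. fst (B (fst x) (A (fst x) (snd x))))"
      by (auto intro: continuous_on_fst)
    have "fst (B (fst x) (A (fst x) (snd x))) = fst (snd x)" if "x \<in> ?S" for x
    proof (rule isotopy_lift_unique[OF uv cB _ _ _ that])
      show "univ_cover u v (fst (B (fst x) (A (fst x) (snd x)))) = univ_cover u v (fst (snd x))" if "x \<in> ?S" for x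
        using BA[of "fst x" "snd x"] that by (auto simp: thick_cover_def)
      show "fst (B (fst (0, w)) (A (fst (0, w)) (snd (0, w)))) = fst (snd (0::real, w))" if "w \<in> slab" for w
        using A(3)[OF that] B(2)[OF that] by simp
    qed (intro continuous_intros)
    from this[of "(s, w)"] have "fst (B s (A s w)) = fst w" using sw by simp
    then show ?thesis using BA[OF sw] by (simp add: thick_cover_def prod_eq_iff)
  qed
  have G'G: "G' s (G s w) = w" if "s \<in> {0..1}" "w \<in> slab" for s w
    by (rule inverse[of G G']) (use that G G' K(2) thick_cover_slab in auto)
  have GG': "G s (G' s w) = w" if "s \<in> {0..1}" "w \<in> slab" for s w
    by (rule inverse[of G' G]) (use that G G' K(3) thick_cover_slab in auto)
  have cs: "continuous_on slab (G s)" "continuous_on slab (G' s)" if "s \<in> {0..1}" for s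
    using continuous_on_slice[OF G(1) that] continuous_on_slice[OF G'(1) that] by auto
  \<comment> \<open>Translating by \<open>k\<close> before or after the lifted isotopy gives two
    lifts of the same map with the same value at time 0.\<close>
  have equivariant: "G s (q + k, z) = G s (q, z) + (k, 0)"
    if sz: "s \<in> {0..1}" "z \<in> {0..1}" and k: "k \<in> lattice u v" for s q z k
  proof -
    have tc: "thick_cover u v (q + k, z) = thick_cover u v (q, z)" for q z
      using univ_cover_lattice[OF uv k] by (simp add: thick_cover_def)
    have c: "continuous_on ?S (\<lambda>x. fst (G (fst x) (fst (snd x) + k, snd (snd x))))"
    proof -
      have "continuous_on ?S (\<lambda>x. case (fst x, (fst (snd x) + k, snd (snd x))) of (s, w) \<Rightarrow> G s w)"
        by (rule continuous_on_compose2[OF G(1)]) (auto simp: slab_def intro!: continuous_intros)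
      then show ?thesis by (auto intro!: continuous_intros)
    qed
    have c': "continuous_on ?S (\<lambda>x. fst (G (fst x) (snd x)) + k)"
      using G(1) by (auto simp: case_prod_unfold intro!: continuous_intros)
    have "fst (G (fst x) (fst (snd x) + k, snd (snd x))) = fst (G (fst x) (snd x)) + k"
      if "x \<in> ?S" for x
    proof (rule isotopy_lift_unique[OF uv c c' _ _ that])
      show "univ_cover u v (fst (G (fst x) (fst (snd x) + k, snd (snd x)))) =
        univ_cover u v (fst (G (fst x) (snd x)) + k)" if "x \<in> ?S" for x
      proof -
        have "(fst (snd x) + k, snd (snd x)) \<in> slab" "fst x \<in> {0..1}" "snd x \<in> slab"
          using that by (auto simp: slab_def)
        then show ?thesis
          using G(3)[of "fst x" "(fst (snd x) + k, snd (snd x))"] G(3)[of "fst x" "snd x"] tc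
            univ_cover_lattice[OF uv k]
          by (metis fst_conv prod.collapse thick_cover_def)
      qed
      show "fst (G (fst (0, w)) (fst (snd (0, w)) + k, snd (snd (0, w)))) = fst (G (fst (0, w)) (snd (0, w))) + k"
        if "w \<in> slab" for w using G(4)[OF that] G(4)[of "(fst w + k, snd w)"] that by (auto simp: slab_def)
    qed
    from this[of "(s, (q, z))"] have 1: "fst (G s (q + k, z)) = fst (G s (q, z)) + k"
      using sz by (simp add: slab_def)
    have "thick_cover u v (G s (q + k, z)) = thick_cover u v (G s (q, z))"
      using G(3)[of s "(q + k, z)"] G(3)[of s "(q, z)"] sz tc by (simp add: slab_def)
    with 1 show ?thesis by (simp add: thick_cover_def prod_eq_iff)
  qed
  have image: "G 1 ` tangle_lift u v L = tangle_lift u v L'"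
  proof -
    have X: "L \<subseteq> torus \<times> {0<..<1}" using L by (simp add: thick_torus_link_def)
    then have LW: "L \<subseteq> ?W" by force
    have L'W: "L' \<subseteq> ?W" unfolding H(4)[symmetric] by (intro image_subsetI Him subsetD[OF LW]) auto
    have slabI: "w \<in> slab" if "thick_cover u v w \<in> ?W" for w
      using that by (auto simp: thick_cover_def slab_def mem_Times_iff)
    show ?thesis
    proof (intro equalityI subsetI)
      fix w assume "w \<in> G 1 ` tangle_lift u v L"
      then obtain w0 where w0: "thick_cover u v w0 \<in> L" "w = G 1 w0" by (auto simp: mem_tangle_lift)
      then have "w0 \<in> slab" using slabI LW by blast
      then have "thick_cover u v w = H 1 (thick_cover u v w0)" using G(3)[of 1 w0] w0(2) by simp
      then show "w \<in> tangle_lift u v L'" using w0(1) unfolding mem_tangle_lift H(4)[symmetric] by blast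
    next
      fix w assume "w \<in> tangle_lift u v L'"
      then have w: "thick_cover u v w \<in> L'" by (simp add: mem_tangle_lift)
      then have ws: "w \<in> slab" using slabI L'W by blast
      obtain l where l: "l \<in> L" "thick_cover u v w = H 1 l" using w H(4) by auto
      have "thick_cover u v (G' 1 w) = l" using G'(3)[of 1 w] ws l K(2)[of 1 l] LW by auto
      then have "G' 1 w \<in> tangle_lift u v L" using l by (simp add: mem_tangle_lift)
      then show "w \<in> G 1 ` tangle_lift u v L" using GG'[of 1 w] ws by (intro image_eqI[of _ _ "G' 1 w"]) auto
    qed
  qed
  show ?thesis
    unfolding DP_ambient_isotopy_def
  proof (intro exI conjI ballI allI)
    show "continuous_on ?S (\<lambda>(s, w). G s w)" by fact
    show "homeomorphism slab slab (G s) (G' s)" if "s \<in> {0..1}" for s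
      by (rule homeomorphismI) (use that cs GG' G'G G(2) G'(2) in auto)
    show "G 0 w = w" if "w \<in> slab" for w using G(4) that .
    \<comment> \<open>The lattice stays fixed during the isotopy, so the moving bases are constant
      functions of time.\<close>
    show "DP_tangle_over ((\<lambda>_. u) (0::real)) ((\<lambda>_. v) (0::real)) (tangle_lift u v L)"
      using uv L by (auto simp: DP_tangle_over_def)
    show "G 1 ` tangle_lift u v L = tangle_lift u v L'" by fact
    show "plane_basis ((\<lambda>_. u) s) ((\<lambda>_. v) s)" for s :: real using uv .
    show "G s (q + (\<lambda>_. u) (0::real), z) = G s (q, z) + ((\<lambda>_. u) s, 0)"
      "G s (q + (\<lambda>_. v) (0::real), z) = G s (q, z) + ((\<lambda>_. v) s, 0)"
      if "s \<in> {0..1}" "z \<in> {0..1}" for s q z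
      using equivariant[OF that] basis_in_lattice by auto
  qed
qed

section \<open>Local flatness\<close>

text \<open>The local clause of \<open>thick_torus_link\<close> with the ambient space as a
  parameter, so that it can be moved along homeomorphisms between open subsets.\<close>

definition flat_at :: "'a::topological_space set \<Rightarrow> 'a set \<Rightarrow> 'a \<Rightarrow> bool" where
  "flat_at X L x \<longleftrightarrow> (\<exists>U f g. openin (top_of_set X) U \<and> x \<in> U \<and>
     homeomorphism U (ball (0 :: complex \<times> real) 1) f g \<and> f ` (L \<inter> U) = {w \<in> ball 0 1. fst w = 0})"

lemma thick_torus_link_iff:
  "thick_torus_link L \<longleftrightarrow> L \<subseteq> torus \<times> {0<..<1} \<and>
     (\<exists>n k. continuous_on (circles n) k \<and> inj_on k (circles n) \<and> k ` circles n = L) \<and>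
     (\<forall>x\<in>L. flat_at (torus \<times> {0<..<1}) L x)"
  by (simp add: thick_torus_link_def flat_at_def)

text \<open>The given flat chart may leave \<open>V\<close>, so it is restricted to a small ball
  around \<open>f x\<close> whose preimage lies in \<open>V\<close>, and this ball is rescaled to
  the unit ball. Since \<open>f x\<close> lies on the axis \<open>fst w = 0\<close>, translation by
  it and scaling preserve the axis.\<close>

lemma flat_at_transfer:
  fixes x :: "'a::topological_space" and \<psi> :: "'a \<Rightarrow> 'b::topological_space"
  assumes flat: "flat_at X L x" and x: "x \<in> L" "x \<in> V" and V: "openin (top_of_set X) V"
    and hom: "homeomorphism V V' \<psi> \<psi>'" and V': "openin (top_of_set X') V'"
    and LV: "\<psi> ` (L \<inter> V) = L' \<inter> V'"
  shows "flat_at X' L' (\<psi> x)"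
proof -
  let ?B = "ball (0 :: complex \<times> real) 1"
  obtain U f g where U: "openin (top_of_set X) U" "x \<in> U" "homeomorphism U ?B f g"
    "f ` (L \<inter> U) = {w \<in> ?B. fst w = 0}"
    using flat unfolding flat_at_def by metis
  have UV: "openin (top_of_set U) (U \<inter> V)"
    using U(1) V by (meson inf_le1 openin_Int openin_imp_subset openin_subset_trans)
  have "openin (top_of_set ?B) (f ` (U \<inter> V))"
    using homeomorphism_imp_open_map[OF U(3) UV] .
  then have "open (f ` (U \<inter> V))" by (simp add: openin_open_eq)
  moreover have "f x \<in> f ` (U \<inter> V)" using U(2) x by auto
  ultimately obtain \<epsilon> where \<epsilon>: "\<epsilon> > 0" "ball (f x) \<epsilon> \<subseteq> f ` (U \<inter> V)"
    using openE by blast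
  have fg: "\<And>w. w \<in> U \<Longrightarrow> g (f w) = w" "\<And>b. b \<in> ?B \<Longrightarrow> f (g b) = b" "f ` U = ?B" "g ` ?B = U"
    and cfg: "continuous_on U f" "continuous_on ?B g"
    using U(3) by (auto simp: homeomorphism_def)
  have subB: "ball (f x) \<epsilon> \<subseteq> ?B" using \<epsilon>(2) fg(3) by blast
  have fx: "fst (f x) = 0" using U(4) x(1) U(2) by auto
  define U1 where "U1 = g ` ball (f x) \<epsilon>"
  have U1: "U1 \<subseteq> U \<inter> V"
  proof
    fix y assume "y \<in> U1"
    then obtain b where b: "b \<in> ball (f x) \<epsilon>" "y = g b" by (auto simp: U1_def)
    then obtain a where "a \<in> U \<inter> V" "b = f a" using \<epsilon>(2) by blast
    then show "y \<in> U \<inter> V" using b(2) fg(1) by auto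
  qed
  have "openin (top_of_set U) U1"
    unfolding U1_def by (rule homeomorphism_imp_open_map[OF homeomorphism_symD[OF U(3)]])
      (use subB in \<open>simp add: openin_open_eq\<close>)
  then have "openin (top_of_set X) U1" using U(1) by (rule openin_trans)
  then have "openin (top_of_set V) U1"
    by (meson U1 V le_infE openin_imp_subset openin_subset_trans)
  then have "openin (top_of_set V') (\<psi> ` U1)"
    by (rule homeomorphism_imp_open_map[OF hom])
  then have o: "openin (top_of_set X') (\<psi> ` U1)" using V' by (rule openin_trans)
  have \<psi>: "\<And>w. w \<in> V \<Longrightarrow> \<psi>' (\<psi> w) = w" and c\<psi>: "continuous_on V \<psi>" "continuous_on V' \<psi>'"
    and \<psi>V: "\<psi> ` V = V'" using hom by (auto simp: homeomorphism_def)
  define F where "F y = (f (\<psi>' y) - f x) /\<^sub>R \<epsilon>" for y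
  define G where "G b = \<psi> (g (f x + \<epsilon> *\<^sub>R b))" for b
  have in_ball: "f x + \<epsilon> *\<^sub>R b \<in> ball (f x) \<epsilon>" if "b \<in> ?B" for b
    using that \<epsilon>(1) by (simp add: dist_norm)
  have FG: "F (\<psi> (g b)) = (b - f x) /\<^sub>R \<epsilon>" if "b \<in> ball (f x) \<epsilon>" for b
  proof -
    have "g b \<in> V" using that U1 by (auto simp: U1_def)
    then show ?thesis using fg(2)[OF subsetD[OF subB that]] \<psi> by (simp add: F_def)
  qed
  have FB: "(b - f x) /\<^sub>R \<epsilon> \<in> ?B" if "b \<in> ball (f x) \<epsilon>" for b
    using that \<epsilon>(1) by (simp add: dist_norm norm_minus_commute inverse_eq_divide divide_less_eq)
  have hom': "homeomorphism (\<psi> ` U1) ?B F G"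
  proof (rule homeomorphismI)
    have "\<psi>' ` \<psi> ` U1 \<subseteq> U" using U1 \<psi> by force
    then show "continuous_on (\<psi> ` U1) F"
      unfolding F_def using \<psi>V U1
      by (intro continuous_intros continuous_on_compose2[OF cfg(1)] continuous_on_subset[OF c\<psi>(2)]) auto
    have "g ` ball (f x) \<epsilon> \<subseteq> V" using U1 by (auto simp: U1_def)
    then show "continuous_on ?B G"
      unfolding G_def using in_ball subB
      by (intro continuous_on_compose2[OF c\<psi>(1)] continuous_on_compose2[OF cfg(2)] continuous_intros) blast+
    show "F ` \<psi> ` U1 \<subseteq> ?B" using FG FB by (auto simp: U1_def)
    show "G ` ?B \<subseteq> \<psi> ` U1" using in_ball by (auto simp: G_def U1_def)
    show "G (F y) = y" if y: "y \<in> \<psi> ` U1" for y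
    proof -
      obtain b where b: "b \<in> ball (f x) \<epsilon>" "y = \<psi> (g b)" using y unfolding U1_def by blast
      then show ?thesis using FG[OF b(1)] \<epsilon>(1) by (simp add: G_def)
    qed
    show "F (G b) = b" if "b \<in> ?B" for b
      using FG[OF in_ball[OF that]] \<epsilon>(1) by (simp add: G_def)
  qed
  have "F ` (L' \<inter> \<psi> ` U1) = {w \<in> ?B. fst w = 0}"
  proof (intro equalityI subsetI)
    fix w assume "w \<in> F ` (L' \<inter> \<psi> ` U1)"
    then obtain y b where y: "y \<in> L'" "y = \<psi> (g b)" "b \<in> ball (f x) \<epsilon>" "w = F y" by (auto simp: U1_def)
    have gb: "g b \<in> U \<inter> V" using y(3) U1 by (auto simp: U1_def)
    then have "y \<in> L' \<inter> V'" using y \<psi>V by auto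
    then obtain l where "l \<in> L \<inter> V" "y = \<psi> l" using LV by blast
    then have "g b = l" using \<psi> y(2) gb by (metis IntE)
    then have "f (g b) \<in> {w \<in> ?B. fst w = 0}" using U(4) gb \<open>l \<in> L \<inter> V\<close> by blast
    then have "fst b = 0" using fg(2)[OF subsetD[OF subB y(3)]] by simp
    then show "w \<in> {w \<in> ?B. fst w = 0}" using y FG[OF y(3)] FB[OF y(3)] fx by simp
  next
    fix w assume w: "w \<in> {w \<in> ?B. fst w = 0}"
    define b where "b = f x + \<epsilon> *\<^sub>R w"
    have b: "b \<in> ball (f x) \<epsilon>" "fst b = 0" using in_ball w fx by (auto simp: b_def)
    then have "b \<in> {w \<in> ?B. fst w = 0}" using subB by auto
    then have "b \<in> f ` (L \<inter> U)" unfolding U(4) .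
    then obtain l where l: "l \<in> L \<inter> U" "b = f l" by (rule imageE) auto
    then have gl: "g b = l" using fg(1) by auto
    have "g b \<in> U1" using b(1) by (simp add: U1_def)
    then have gb: "g b \<in> L \<inter> V" "g b \<in> U1" using l U1 gl by auto
    then have "\<psi> (g b) \<in> L'" using LV by blast
    moreover have "F (\<psi> (g b)) = w" using FG[OF b(1)] \<epsilon>(1) by (simp add: b_def)
    ultimately show "w \<in> F ` (L' \<inter> \<psi> ` U1)" using gb by force
  qed
  moreover have "\<psi> x \<in> \<psi> ` U1"
    using \<epsilon>(1) fg(1) U(2) by (auto simp: U1_def intro!: imageI image_eqI[where x = "f x"])
  ultimately show ?thesis using o hom' unfolding flat_at_def by blast
qed

lemma thick_torus_link_homeomorphic:
  assumes L: "thick_torus_link L" and hom: "homeomorphism (torus \<times> {0<..<1}) (torus \<times> {0<..<1}) F G"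
  shows "thick_torus_link (F ` L)"
  unfolding thick_torus_link_iff
proof (intro conjI ballI)
  let ?X = "torus \<times> {0<..<1::real}"
  have X: "L \<subseteq> ?X" using L by (simp add: thick_torus_link_iff)
  have F: "F ` ?X = ?X" "continuous_on ?X F" "inj_on F ?X"
    using hom by (auto simp: homeomorphism_def intro: inj_on_inverseI)
  show "F ` L \<subseteq> ?X" using X F by blast
  obtain n k where k: "continuous_on (circles n) k" "inj_on k (circles n)" "k ` circles n = L"
    using L by (auto simp: thick_torus_link_iff)
  show "\<exists>n k. continuous_on (circles n) k \<and> inj_on k (circles n) \<and> k ` circles n = F ` L"
  proof (intro exI conjI)
    show "continuous_on (circles n) (F \<circ> k)"
      using k X by (intro continuous_on_compose continuous_on_subset[OF F(2)]) auto
    show "inj_on (F \<circ> k) (circles n)"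
      using k X by (intro comp_inj_on inj_on_subset[OF F(3)]) auto
  qed (use k in auto)
  fix y assume "y \<in> F ` L"
  then obtain x where x: "x \<in> L" "y = F x" by auto
  show "flat_at ?X (F ` L) y"
    unfolding x(2)
    by (rule flat_at_transfer[OF _ x(1) _ _ hom])
      (use L x X F in \<open>auto simp: thick_torus_link_iff\<close>)
qed

text \<open>The time-one map restricts to a homeomorphism of the open slab. This is how a link built
  by an isotopy inherits local flatness.\<close>

lemma torus_isotopic_thick:
  assumes L: "thick_torus_link L" and LL': "torus_isotopic L L'"
  shows "thick_torus_link L'"
proof -
  let ?W = "torus \<times> {0..1::real}" and ?X = "torus \<times> {0<..<1::real}"
  obtain H where H: "continuous_on ({0..1::real} \<times> ?W) (\<lambda>(s, w). H s w)"
    "\<And>s. s \<in> {0..1} \<Longrightarrow> bij_betw (H s) ?W ?W" "H 1 ` ?X = ?X" "H 1 ` L = L'"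
    using LL' unfolding torus_isotopic_def by (metis atLeastAtMost_iff order_refl zero_le_one)
  have "\<exists>g. homeomorphism ?W ?W (H 1) g"
    by (rule homeomorphism_compact)
      (use H(2)[of 1] continuous_on_slice[OF H(1), of 1] compact_torus in \<open>auto simp: bij_betw_def intro: compact_Times\<close>)
  then obtain g where "homeomorphism ?W ?W (H 1) g" by blast
  then have "homeomorphism ?X ?X (H 1) g"
    by (rule homeomorphism_of_subsets) (use H(3) in auto)
  then show ?thesis using thick_torus_link_homeomorphic[OF L] H(4) by blast
qed

section \<open>Vertical isotopies\<close>

lemma bij_betw_fibrewise:
  assumes "\<And>z. z \<in> Z \<Longrightarrow> bij_betw (T z) X X"
  shows "bij_betw (\<lambda>w. (T (snd w) (fst w), snd w)) (X \<times> Z) (X \<times> Z)"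
  unfolding bij_betw_def
proof (intro conjI inj_onI equalityI subsetI)
  fix w w' assume w: "w \<in> X \<times> Z" "w' \<in> X \<times> Z" "(T (snd w) (fst w), snd w) = (T (snd w') (fst w'), snd w')"
  then have "snd w = snd w'" "T (snd w) (fst w) = T (snd w) (fst w')" "fst w \<in> X" "fst w' \<in> X" "snd w \<in> Z"
    by (auto simp: mem_Times_iff)
  then show "w = w'" using bij_betw_imp_inj_on[OF assms] by (auto simp: prod_eq_iff dest: inj_onD)
next
  fix w assume "w \<in> (\<lambda>w. (T (snd w) (fst w), snd w)) ` (X \<times> Z)"
  then obtain w0 where "w0 \<in> X \<times> Z" "w = (T (snd w0) (fst w0), snd w0)" by blast
  then show "w \<in> X \<times> Z" using bij_betwE[OF assms, of "snd w0"] by (auto simp: mem_Times_iff)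
next
  fix w assume w: "w \<in> X \<times> Z"
  then have "fst w \<in> T (snd w) ` X" using bij_betw_imp_surj_on[OF assms, of "snd w"] by (simp add: mem_Times_iff)
  then obtain x where x: "x \<in> X" "fst w = T (snd w) x" by blast
  then show "w \<in> (\<lambda>w. (T (snd w) (fst w), snd w)) ` (X \<times> Z)"
    using w by (intro image_eqI[of _ _ "(x, snd w)"]) (auto simp: prod_eq_iff mem_Times_iff)
qed

definition height_graph :: "'p set \<Rightarrow> ('p \<Rightarrow> 's) \<Rightarrow> ('p \<Rightarrow> real) \<Rightarrow> ('s \<times> real) set" where
  "height_graph K c h = (\<lambda>p. (c p, h p)) ` K"

text \<open>The piecewise linear map of the unit interval with \<open>a \<mapsto> a'\<close> and \<open>b \<mapsto> b'\<close>.\<close>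

definition pl_map :: "real \<Rightarrow> real \<Rightarrow> real \<Rightarrow> real \<Rightarrow> real \<Rightarrow> real" where
  "pl_map a b a' b' z = a' * min 1 (z / a) + (b' - a') * max 0 (min 1 ((z - a) / (b - a)))
     + (1 - b') * max 0 ((z - b) / (1 - b))"

lemma pl_map_values:
  assumes "0 < a" "a < b" "b < 1"
  shows "pl_map a b a' b' 0 = 0" "pl_map a b a' b' a = a'" "pl_map a b a' b' b = b'" "pl_map a b a' b' 1 = 1"
proof -
  have 1: "(a - b) / (1 - b) \<le> 0" "(0 - a) / (b - a) \<le> 0" "(0 - b) / (1 - b) \<le> 0"
    using assms by (auto intro!: divide_nonpos_pos)
  have 2: "1 \<le> b / a" "1 \<le> 1 / a" "1 \<le> (1 - a) / (b - a)"
    using assms by (auto simp: le_divide_eq)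
  have 3: "0 / a = 0" "a / a = 1" "(a - a) / (b - a) = 0" "(b - a) / (b - a) = 1" "(b - b) / (1 - b) = 0" "(1 - b) / (1 - b) = 1"
    using assms by auto
  show "pl_map a b a' b' 0 = 0" "pl_map a b a' b' a = a'" "pl_map a b a' b' b = b'" "pl_map a b a' b' 1 = 1"
    unfolding pl_map_def 3 using 1 2 by (simp_all only: max_absorb1 max_absorb2 min_absorb1 min_absorb2
      min.absorb1 min.absorb2 order_refl zero_le_one min_le_iff_disj disj_absorb mult_1_right mult_zero_right)
qed

lemma pl_map_id:
  assumes "0 < a" "a < b" "b < 1"
  shows "pl_map a b a b z = z"
proof -
  have "a * min 1 (z / a) = min a z" "(1 - b) * max 0 ((z - b) / (1 - b)) = max 0 (z - b)"
    using assms by (auto simp: min_def max_def field_simps)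
  moreover have "(b - a) * max 0 (min 1 ((z - a) / (b - a))) = max 0 (min (b - a) (z - a))"
    using assms by (auto simp: min_def max_def divide_simps)
  moreover have "min a z + max 0 (min (b - a) (z - a)) + max 0 (z - b) = z"
    using assms by (auto simp: min_def max_def)
  ultimately show ?thesis unfolding pl_map_def by simp
qed

text \<open>All three summands are nondecreasing with positive weights, and on each of the pieces
  below \<open>a\<close>, between \<open>a\<close> and \<open>b\<close>, and above \<open>b\<close>
  one of them grows strictly as soon as the argument leaves \<open>z\<close>.\<close>

lemma pl_map_strict_mono:
  assumes "0 < a" "a < b" "b < 1" "0 < a'" "a' < b'" "b' < 1" "z < z'" "z' \<le> 1"
  shows "pl_map a b a' b' z < pl_map a b a' b' z'"
proof -
  let ?f = "\<lambda>z. min 1 (z / a)" and ?g = "\<lambda>z. max 0 (min 1 ((z - a) / (b - a)))"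
    and ?h = "\<lambda>z. max 0 ((z - b) / (1 - b))"
  have "z / a < z' / a" "(z - a) / (b - a) < (z' - a) / (b - a)" "(z - b) / (1 - b) < (z' - b) / (1 - b)"
    using assms by (auto intro: divide_strict_right_mono)
  then have mono: "?f z \<le> ?f z'" "?g z \<le> ?g z'" "?h z \<le> ?h z'" by (auto simp: min_def max_def)
  have ex: "?f z < ?f z' \<or> ?g z < ?g z' \<or> ?h z < ?h z'"
  proof -
    consider "z < a" | "a \<le> z" "z < b" | "b \<le> z" by linarith
    then show ?thesis
    proof cases
      case 1
      then have "z / a < 1" "z / a < z' / a" using assms by (auto simp: divide_strict_right_mono)
      then show ?thesis by auto
    next
      case 2
      then have "0 \<le> (z - a) / (b - a)" "(z - a) / (b - a) < 1" "(z - a) / (b - a) < (z' - a) / (b - a)"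
        using assms by (auto simp: divide_strict_right_mono)
      then show ?thesis by (auto simp: min_def max_def)
    next
      case 3
      then have "0 \<le> (z - b) / (1 - b)" "(z - b) / (1 - b) < (z' - b) / (1 - b)"
        using assms by (auto simp: divide_strict_right_mono)
      then show ?thesis by (auto simp: max_def)
    qed
  qed
  have w: "0 < a'" "0 < b' - a'" "0 < 1 - b'" using assms by auto
  have le: "a' * ?f z \<le> a' * ?f z'" "(b' - a') * ?g z \<le> (b' - a') * ?g z'" "(1 - b') * ?h z \<le> (1 - b') * ?h z'"
    by (rule mult_left_mono[OF mono(1) less_imp_le[OF w(1)]] mult_left_mono[OF mono(2) less_imp_le[OF w(2)]]
        mult_left_mono[OF mono(3) less_imp_le[OF w(3)]])+
  have lt: "?f z < ?f z' \<Longrightarrow> a' * ?f z < a' * ?f z'"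
    "?g z < ?g z' \<Longrightarrow> (b' - a') * ?g z < (b' - a') * ?g z'" "?h z < ?h z' \<Longrightarrow> (1 - b') * ?h z < (1 - b') * ?h z'"
    by (erule mult_strict_left_mono[OF _ w(1)] mult_strict_left_mono[OF _ w(2)] mult_strict_left_mono[OF _ w(3)])+
  have add: "x + y + w < x' + y' + w'"
    if "x \<le> x'" "y \<le> y'" "w \<le> w'" "x < x' \<or> y < y' \<or> w < w'" for x x' y y' w w' :: real
    using that by linarith
  show ?thesis
    unfolding pl_map_def by (rule add[OF le]) (use lt ex in blast)
qed

text \<open>Near \<open>p0\<close>, away from the finitely many other double strands, the curve is
  injective, so the height is a continuous function of the position on a compact piece of the curve.
  Dugundji's extension theorem spreads it over the whole space without leaving the convex set
  \<open>C\<close>.\<close>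

lemma branch_extension:
  fixes K :: "'p::metric_space set" and c :: "'p \<Rightarrow> torus_pt" and h :: "'p \<Rightarrow> real"
  assumes K: "compact K" "continuous_on K c" "continuous_on K h"
    and fin: "finite {p \<in> K. \<exists>q\<in>K. q \<noteq> p \<and> c q = c p}"
    and p0: "p0 \<in> K" and C: "open C" "convex C" "h p0 \<in> C"
  shows "\<exists>r a. 0 < r \<and> continuous_on UNIV a \<and> range a \<subseteq> C \<and> (\<forall>p\<in>K. dist p p0 < r \<longrightarrow> a (c p) = h p)"
proof -
  \<comment> \<open>The radius keeps every double strand other than \<open>p0\<close> itself out of
    the neighbourhood.\<close>
  obtain r0 where r0: "r0 > 0" "\<And>p. p \<in> K \<Longrightarrow> \<exists>q\<in>K. q \<noteq> p \<and> c q = c p \<Longrightarrow> p \<noteq> p0 \<Longrightarrow> r0 \<le> dist p0 p"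
    using finite_set_avoid[OF fin, of p0] by auto
  obtain r1 where r1: "r1 > 0" "\<And>p. p \<in> K \<Longrightarrow> dist p p0 < r1 \<Longrightarrow> h p \<in> C"
  proof -
    obtain e where e: "e > 0" "ball (h p0) e \<subseteq> C" using C openE by blast
    obtain r where "r > 0" "\<forall>p\<in>K. dist p p0 < r \<longrightarrow> dist (h p) (h p0) < e"
      using K(3) p0 e(1) unfolding continuous_on_iff by blast
    then show thesis using that[of r] e(2) by (auto simp: dist_commute subset_iff)
  qed
  define r where "r = min r0 r1 / 2"
  have r: "r > 0" "r < r0" "r < r1" using r0(1) r1(1) by (auto simp: r_def)
  define N where "N = K \<inter> cball p0 r"
  have N: "compact N" unfolding N_def by (intro compact_Int_closed K closed_cball)
  have cN: "continuous_on N c" "continuous_on N h" using K by (auto simp: N_def intro: continuous_on_subset)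
  have inj: "inj_on c N"
  proof (rule inj_onI)
    fix p q assume pq: "p \<in> N" "q \<in> N" "c p = c q"
    \<comment> \<open>In a colliding pair at least one strand differs from \<open>p0\<close>, and
      that strand would be a double strand closer than \<open>r0\<close>.\<close>
    have far: "x = y" if "x \<in> N" "y \<in> N" "c x = c y" "x \<noteq> p0" for x y
    proof (rule ccontr)
      assume "x \<noteq> y"
      then have "\<exists>q\<in>K. q \<noteq> x \<and> c q = c x" using that by (intro bexI[of _ y]) (auto simp: N_def)
      then have "r0 \<le> dist p0 x" using r0(2)[of x] that by (auto simp: N_def)
      then show False using that(1) r by (auto simp: N_def)
    qed
    show "p = q" using far[of p q] far[of q p] pq by metis
  qed
  have inv: "continuous_on (c ` N) (inv_into N c)"
    by (rule continuous_on_inv) (use cN N inj in auto)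
  have "continuous_on (c ` N) (\<lambda>x. h (inv_into N c x))"
    by (rule continuous_on_compose2[OF cN(2) inv]) (auto intro: inv_into_into)
  moreover have "closedin (top_of_set UNIV) (c ` N)"
    using compact_continuous_image[OF cN(1) N] by (simp add: compact_imp_closed)
  moreover have "(\<lambda>x. h (inv_into N c x)) ` (c ` N) \<subseteq> C"
    using inj r r1(2) by (auto simp: N_def dist_commute)
  ultimately obtain a where a: "continuous_on UNIV a" "a ` UNIV \<subseteq> C" "\<And>x. x \<in> c ` N \<Longrightarrow> a x = h (inv_into N c x)"
    using Dugundji[of C UNIV "c ` N" "\<lambda>x. h (inv_into N c x)"] C by blast
  show ?thesis
  proof (intro exI conjI ballI impI)
    show "0 < r" "continuous_on UNIV a" "range a \<subseteq> C" by fact+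
    fix p assume "p \<in> K" "dist p p0 < r"
    then have "p \<in> N" by (simp add: N_def dist_commute)
    then show "a (c p) = h p" using a(3) inj by auto
  qed
qed

text \<open>Together with continuity these conditions give increasing homeomorphisms of the vertical
  intervals. They survive convex combinations, which mere bijectivity does not.\<close>

definition interval_isotopy :: "(real \<Rightarrow> torus_pt \<Rightarrow> real \<Rightarrow> real) \<Rightarrow> bool" where
  "interval_isotopy G \<longleftrightarrow>
     continuous_on ({0..1} \<times> (torus \<times> {0..1})) (\<lambda>(s, x, z). G s x z) \<and>
     (\<forall>s\<in>{0..1}. \<forall>x\<in>torus. strict_mono_on {0..1} (G s x) \<and> G s x 0 = 0 \<and> G s x 1 = 1) \<and>
     (\<forall>x\<in>torus. \<forall>z\<in>{0..1}. G 0 x z = z)"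

lemma interval_isotopy_pl_map:
  fixes a b a' b' :: "torus_pt \<Rightarrow> real"
  assumes c: "continuous_on UNIV a" "continuous_on UNIV b" "continuous_on UNIV a'" "continuous_on UNIV b'"
    and ab: "\<And>x. 0 < a x" "\<And>x. a x < b x" "\<And>x. b x < 1" "\<And>x. 0 < a' x" "\<And>x. a' x < b' x" "\<And>x. b' x < 1"
  shows "interval_isotopy (\<lambda>s x. pl_map (a x) (b x) ((1 - s) * a x + s * a' x) ((1 - s) * b x + s * b' x))"
  unfolding interval_isotopy_def
proof (intro conjI ballI)
  have c': "continuous_on S (\<lambda>x. f (fst (snd x)))" if "continuous_on UNIV f"
    for f :: "torus_pt \<Rightarrow> real" and S :: "(real \<times> torus_pt \<times> real) set"
    by (rule continuous_on_compose2[OF that]) (auto intro!: continuous_intros)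
  have ne: "a x \<noteq> 0" "b x - a x \<noteq> 0" "1 - b x \<noteq> 0" for x using ab[of x] by auto
  show "continuous_on ({0..1} \<times> (torus \<times> {0..1}))
    (\<lambda>(s, x, z). pl_map (a x) (b x) ((1 - s) * a x + s * a' x) ((1 - s) * b x + s * b' x) z)"
    unfolding pl_map_def case_prod_unfold
    by (intro continuous_intros c'[OF c(1)] c'[OF c(2)] c'[OF c(3)] c'[OF c(4)] ballI ne)
  fix s :: real and x assume s: "s \<in> {0..1}"
  let ?A = "(1 - s) * a x + s * a' x" and ?B = "(1 - s) * b x + s * b' x"
  have "0 < ?A" "0 < ?B - ?A" "0 < 1 - ?B"
  proof -
    \<comment> \<open>Applied to the lower break point, to the gap between the break points and to
      the distance of the upper one from 1: straight-line interpolation keeps all three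
      positive.\<close>
    have pos: "0 < (1 - s) * p + s * q" if "0 < p" "0 < q" for p q :: real
    proof (cases "s = 0")
      case False
      then have "0 < s * q" "0 \<le> (1 - s) * p" using s that by auto
      then show ?thesis by linarith
    qed (use that in simp)
    show "0 < ?A" using pos ab by blast
    have "0 < (1 - s) * (b x - a x) + s * (b' x - a' x)" using pos ab by simp
    then show "0 < ?B - ?A" by (simp add: algebra_simps)
    have "0 < (1 - s) * (1 - b x) + s * (1 - b' x)" using pos ab by simp
    then show "0 < 1 - ?B" by (simp add: algebra_simps)
  qed
  then show "strict_mono_on {0..1} (pl_map (a x) (b x) ?A ?B)"
    using ab by (intro strict_mono_onI pl_map_strict_mono) auto
  show "pl_map (a x) (b x) ?A ?B 0 = 0" "pl_map (a x) (b x) ?A ?B 1 = 1"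
    using pl_map_values ab by auto
next
  fix x z assume "z \<in> {0..1::real}"
  show "pl_map (a x) (b x) ((1 - 0) * a x + 0 * a' x) ((1 - 0) * b x + 0 * b' x) z = z"
    using pl_map_id ab by simp
qed

lemma interval_isotopy_torus_isotopic:
  assumes G: "interval_isotopy G" and K: "c ` K \<subseteq> torus"
    and h0: "\<And>p. p \<in> K \<Longrightarrow> 0 < h0 p \<and> h0 p < 1" and h1: "\<And>p. p \<in> K \<Longrightarrow> G 1 (c p) (h0 p) = h1 p"
  shows "torus_isotopic (height_graph K c h0) (height_graph K c h1)"
proof -
  let ?W = "torus \<times> {0..1::real}" and ?X = "torus \<times> {0<..<1::real}"
  have cont: "continuous_on ({0..1} \<times> ?W) (\<lambda>(s, x, z). G s x z)"
    and mono: "\<And>s x. s \<in> {0..1} \<Longrightarrow> x \<in> torus \<Longrightarrow> strict_mono_on {0..1} (G s x)"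
    and G0: "\<And>s x. s \<in> {0..1} \<Longrightarrow> x \<in> torus \<Longrightarrow> G s x 0 = 0"
    and G1: "\<And>s x. s \<in> {0..1} \<Longrightarrow> x \<in> torus \<Longrightarrow> G s x 1 = 1"
    and Gid: "\<And>x z. x \<in> torus \<Longrightarrow> z \<in> {0..1} \<Longrightarrow> G 0 x z = z"
    using G by (auto simp: interval_isotopy_def)
  have bij: "bij_betw (G s x) {0..1} {0..1}" and bijo: "G s x ` {0<..<1} = {0<..<1}"
    if sx: "s \<in> {0..1}" "x \<in> torus" for s x
  proof -
    have c: "continuous_on {0..1} (G s x)"
    proof -
      have "continuous_on {0..1} (\<lambda>z. case (s, x, z) of (s, x, z) \<Rightarrow> G s x z)"
        by (rule continuous_on_compose2[OF cont]) (use sx in \<open>auto intro!: continuous_intros\<close>)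
      then show ?thesis by simp
    qed
    have inj: "inj_on (G s x) {0..1}" using mono[OF sx] by (rule strict_mono_on_imp_inj_on)
    have lt: "G s x z < G s x z'" if "z \<in> {0..1}" "z' \<in> {0..1}" "z < z'" for z z'
      using mono[OF sx] that by (auto simp: strict_mono_on_def)
    have into: "G s x z \<in> {0..1}" if "z \<in> {0..1}" for z
      using lt[of 0 z] lt[of z 1] that G0[OF sx] G1[OF sx] by (cases "z = 0"; cases "z = 1"; force)
    have intoo: "G s x z \<in> {0<..<1}" if "z \<in> {0<..<1}" for z
      using lt[of 0 z] lt[of z 1] that G0[OF sx] G1[OF sx] by force
    have onto: "\<exists>z\<in>{0..1}. G s x z = y" if "y \<in> {0..1}" for y
      using IVT'[of "G s x" 0 y 1] c that G0[OF sx] G1[OF sx] by auto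
    show "bij_betw (G s x) {0..1} {0..1}"
      unfolding bij_betw_def using inj into onto by blast
    show "G s x ` {0<..<1} = {0<..<1}"
    proof (intro equalityI subsetI)
      fix y :: real assume y: "y \<in> {0<..<1}"
      then have "y \<in> {0..1}" by auto
      then obtain z where z: "z \<in> {0..1}" "G s x z = y" using onto by blast
      then have "z \<noteq> 0" "z \<noteq> 1" using y G0[OF sx] G1[OF sx] by auto
      then show "y \<in> G s x ` {0<..<1}" using z by force
    qed (use intoo in auto)
  qed
  define H where "H s w = (fst w, G s (fst w) (snd w))" for s and w :: "torus_pt \<times> real"
  show ?thesis
    unfolding torus_isotopic_def
  proof (intro exI[of _ H] conjI ballI)
    show "continuous_on ({0..1} \<times> ?W) (\<lambda>(s, w). H s w)"
      using cont by (auto simp: H_def case_prod_unfold intro!: continuous_intros)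
    fix s :: real assume s: "s \<in> {0..1}"
    \<comment> \<open>\<open>bij_betw_fibrewise\<close> moves the first factor; swapping the factors
      lets it move the height over a fixed point of the torus.\<close>
    have swap: "bij_betw prod.swap (A \<times> B) (B \<times> A)" for A :: "'x set" and B :: "'y set"
      by (simp add: bij_betw_def product_swap)
    have fib: "bij_betw (H s) (torus \<times> Z) (torus \<times> Z)"
      if "\<And>x. x \<in> torus \<Longrightarrow> bij_betw (G s x) Z Z" for Z
    proof -
      have "H s = prod.swap \<circ> ((\<lambda>w. (G s (snd w) (fst w), snd w)) \<circ> prod.swap)"
        by (simp add: H_def fun_eq_iff)
      then show ?thesis
        using bij_betw_trans[OF bij_betw_trans[OF swap bij_betw_fibrewise[OF that]] swap] by simp
    qed
    show "bij_betw (H s) ?W ?W" by (rule fib[OF bij[OF s]])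
    have "bij_betw (G s x) {0<..<1} {0<..<1}" if "x \<in> torus" for x
      using bijo[OF s that] by (rule bij_betw_subset[OF bij[OF s that], rotated]) auto
    then show "H s ` ?X = ?X" by (intro bij_betw_imp_surj_on fib)
  next
    fix w assume "w \<in> ?W" then show "H 0 w = w" using Gid[of "fst w" "snd w"] by (auto simp: H_def)
  next
    show "H 1 ` height_graph K c h0 = height_graph K c h1"
      unfolding height_graph_def image_image by (rule image_cong) (auto simp: H_def h1)
  qed
qed

text \<open>Convex combinations of increasing maps are increasing, so that local solutions of the
  interpolation problem can be glued by a partition of unity on the torus.\<close>

lemma interval_isotopy_glue:
  assumes loc: "\<And>x. x \<in> torus \<Longrightarrow> \<exists>U G. open U \<and> x \<in> U \<and> interval_isotopy G \<and> (\<forall>p\<in>K. c p \<in> U \<longrightarrow> G 1 (c p) (h0 p) = h1 p)"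
    and K: "c ` K \<subseteq> torus" and h0: "\<And>p. p \<in> K \<Longrightarrow> 0 < h0 p \<and> h0 p < 1"
  obtains G where "interval_isotopy G" "\<And>p. p \<in> K \<Longrightarrow> G 1 (c p) (h0 p) = h1 p"
proof -
  define good where "good U G \<longleftrightarrow> open U \<and> interval_isotopy G \<and> (\<forall>p\<in>K. c p \<in> U \<longrightarrow> G 1 (c p) (h0 p) = h1 p)"
    for U and G :: "real \<Rightarrow> torus_pt \<Rightarrow> real \<Rightarrow> real"
  obtain D where D: "D \<subseteq> {U. \<exists>G. good U G}" "finite D" "torus \<subseteq> \<Union> D"
  proof (rule compactE[OF compact_torus, of "{U. \<exists>G. good U G}"])
    show "torus \<subseteq> \<Union> {U. \<exists>G. good U G}" using loc unfolding good_def by blast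
    show "open B" if "B \<in> {U. \<exists>G. good U G}" for B using that by (auto simp: good_def)
  qed
  then have "\<forall>U\<in>D. \<exists>G. good U G" by blast
  from bchoice[OF this] obtain g where g: "\<And>U. U \<in> D \<Longrightarrow> good U (g U)" by blast
  obtain F :: "torus_pt set \<Rightarrow> torus_pt \<Rightarrow> real"
    where F: "\<And>U. U \<in> D \<Longrightarrow> continuous_on torus (F U) \<and> (\<forall>x \<in> torus. 0 \<le> F U x)"
      "\<And>x U. U \<in> D \<Longrightarrow> x \<in> torus \<Longrightarrow> x \<notin> U \<Longrightarrow> F U x = 0"
      "\<And>x. x \<in> torus \<Longrightarrow> supp_sum (\<lambda>W. F W x) D = 1"
    by (rule subordinate_partition_of_unity[OF D(3)])
      (use g D(2) in \<open>auto simp: good_def intro!: exI[of _ UNIV]\<close>)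
  have F1: "(\<Sum>U\<in>D. F U x) = 1" if "x \<in> torus" for x
  proof -
    have "supp_sum (\<lambda>W. F W x) D = (\<Sum>U\<in>D. F U x)"
      unfolding supp_sum_def support_on_def by (rule sum.mono_neutral_left) (use D(2) in auto)
    then show ?thesis using F(3)[OF that] by simp
  qed
  define G where "G s x z = (\<Sum>U\<in>D. F U x * g U s x z)" for s x z
  have gi: "interval_isotopy (g U)" if "U \<in> D" for U using g that by (simp add: good_def)
  have "interval_isotopy G"
    unfolding interval_isotopy_def
  proof (intro conjI ballI)
    have "continuous_on ({0..1} \<times> (torus \<times> {0..1})) (\<lambda>x. F U (fst (snd x)))" if "U \<in> D" for U
      by (rule continuous_on_compose2[of torus "F U"]) (use F(1)[OF that] in \<open>auto intro!: continuous_intros\<close>)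
    moreover have "continuous_on ({0..1} \<times> (torus \<times> {0..1})) (\<lambda>x. g U (fst x) (fst (snd x)) (snd (snd x)))" if "U \<in> D" for U
      using gi[OF that] by (simp add: interval_isotopy_def case_prod_unfold)
    ultimately show "continuous_on ({0..1} \<times> (torus \<times> {0..1})) (\<lambda>(s, x, z). G s x z)"
      unfolding G_def case_prod_unfold by (intro continuous_intros) auto
    fix s :: real and x assume s: "s \<in> {0..1}" and x: "x \<in> torus"
    show "strict_mono_on {0..1} (G s x)"
    proof (rule strict_mono_onI)
      fix z z' :: real assume z: "z \<in> {0..1}" "z' \<in> {0..1}" "z < z'"
      have lt: "g U s x z < g U s x z'" if "U \<in> D" for U
        using gi[OF that] s x z by (auto simp: interval_isotopy_def strict_mono_on_def)
      \<comment> \<open>The weights are nonnegative with sum 1, so one of them is positive, and its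
        summand makes the inequality strict.\<close>
      have "\<exists>U\<in>D. F U x \<noteq> 0" using F1[OF x] by (metis sum.neutral zero_neq_one)
      then obtain U where U: "U \<in> D" "0 < F U x" using F(1) x by (metis less_eq_real_def)
      show "G s x z < G s x z'"
        unfolding G_def
      proof (rule sum_strict_mono_ex1[OF D(2)])
        show "\<forall>U\<in>D. F U x * g U s x z \<le> F U x * g U s x z'"
          using F(1) x by (intro ballI mult_left_mono less_imp_le[OF lt]) auto
        show "\<exists>U\<in>D. F U x * g U s x z < F U x * g U s x z'"
          using U lt[OF U(1)] by (intro bexI[of _ U] mult_strict_left_mono)
      qed
    qed
    show "G s x 0 = 0" "G s x 1 = 1"
      using gi s x F1[OF x] by (auto simp: G_def interval_isotopy_def)
  next
    fix x z assume x: "x \<in> torus" and z: "z \<in> {0..1::real}"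
    have "G 0 x z = (\<Sum>U\<in>D. F U x * z)"
      unfolding G_def by (rule sum.cong) (use gi x z in \<open>auto simp: interval_isotopy_def\<close>)
    then show "G 0 x z = z" using F1[OF x] by (simp add: sum_distrib_right[symmetric])
  qed
  moreover have "G 1 (c p) (h0 p) = h1 p" if p: "p \<in> K" for p
  proof -
    have x: "c p \<in> torus" using p K by auto
    \<comment> \<open>A nonzero weight means that the point lies in \<open>U\<close>; so every
      contributing isotopy has the value \<open>h1 p\<close>, and so has their average.\<close>
    have "G 1 (c p) (h0 p) = (\<Sum>U\<in>D. F U (c p) * h1 p)"
      unfolding G_def
    proof (rule sum.cong)
      fix U assume U: "U \<in> D"
      show "F U (c p) * g U 1 (c p) (h0 p) = F U (c p) * h1 p"
        using g[OF U] p F(2)[OF U x] by (cases "c p \<in> U") (auto simp: good_def)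
    qed simp
    then show ?thesis using F1[OF x] by (simp add: sum_distrib_right[symmetric])
  qed
  ultimately show thesis using that by blast
qed

text \<open>At most two strands lie over a point of the torus, so near it at most two branches have
  to be carried from \<open>h0\<close> to \<open>h1\<close>. Having the same order under both
  heights is exactly what an increasing map of the interval requires.\<close>

lemma vertical_isotopic:
  fixes K :: "'p::metric_space set" and c :: "'p \<Rightarrow> torus_pt"
  assumes K: "compact K" "continuous_on K c" "c ` K \<subseteq> torus"
    and fin: "finite {p \<in> K. \<exists>q\<in>K. q \<noteq> p \<and> c q = c p}"
    and two: "\<And>p q r. \<lbrakk>p \<in> K; q \<in> K; r \<in> K; c p = c q; c p = c r; p \<noteq> q; p \<noteq> r\<rbrakk> \<Longrightarrow> q = r"
    and h0: "continuous_on K h0" "\<And>p. p \<in> K \<Longrightarrow> 0 < h0 p \<and> h0 p < 1"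
    and h1: "continuous_on K h1" "\<And>p. p \<in> K \<Longrightarrow> 0 < h1 p \<and> h1 p < 1"
    and ord: "\<And>p q. \<lbrakk>p \<in> K; q \<in> K; p \<noteq> q; c p = c q\<rbrakk> \<Longrightarrow> h0 p < h0 q \<and> h1 p < h1 q \<or> h0 q < h0 p \<and> h1 q < h1 p"
  shows "torus_isotopic (height_graph K c h0) (height_graph K c h1)"
proof -
  have branch: "\<exists>r a a'. 0 < r \<and> continuous_on UNIV a \<and> continuous_on UNIV a' \<and> range a \<subseteq> C \<and> range a' \<subseteq> C' \<and>
      (\<forall>p\<in>K. dist p p0 < r \<longrightarrow> a (c p) = h0 p \<and> a' (c p) = h1 p)"
    if p0: "p0 \<in> K" and C: "open C" "convex C" "h0 p0 \<in> C" "open C'" "convex C'" "h1 p0 \<in> C'" for p0 C C'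
  proof -
    obtain r a where a: "0 < r" "continuous_on UNIV a" "range a \<subseteq> C" "\<forall>p\<in>K. dist p p0 < r \<longrightarrow> a (c p) = h0 p"
      using branch_extension[OF K(1,2) h0(1) fin p0 C(1-3)] by blast
    obtain r' a' where a': "0 < r'" "continuous_on UNIV a'" "range a' \<subseteq> C'" "\<forall>p\<in>K. dist p p0 < r' \<longrightarrow> a' (c p) = h1 p"
      using branch_extension[OF K(1,2) h1(1) fin p0 C(4-6)] by blast
    show ?thesis
      by (intro exI[of _ "min r r'"] exI[of _ a] exI[of _ a']) (use a a' in auto)
  qed
  have "\<exists>U G. open U \<and> x0 \<in> U \<and> interval_isotopy G \<and> (\<forall>p\<in>K. c p \<in> U \<longrightarrow> G 1 (c p) (h0 p) = h1 p)"
    if x0: "x0 \<in> torus" for x0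
  proof -
    \<comment> \<open>If \<open>V\<close> contains all strands over a point, the complement of the
      image of the other strands is a neighbourhood of that point over which only strands of
      \<open>V\<close> lie.\<close>
    have outer: "open (- c ` (K - V))" if "open V" for V
      using compact_continuous_image[of "K - V" c] K that
      by (metis Diff_subset closed_def compact_diff compact_imp_closed continuous_on_subset)
    \<comment> \<open>In the last case the names are chosen such that \<open>p0\<close> is the lower
      strand for both heights.\<close>
    consider "\<forall>p\<in>K. c p \<noteq> x0" | p0 where "p0 \<in> K" "c p0 = x0" "\<forall>p\<in>K. c p = x0 \<longrightarrow> p = p0"
      | p0 q0 where "p0 \<in> K" "q0 \<in> K" "c p0 = x0" "c q0 = x0" "h0 p0 < h0 q0" "h1 p0 < h1 q0"
      using ord by metis
    then show ?thesis
    proof cases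
      case 1
      show ?thesis
      proof (intro exI conjI)
        show "open (- c ` (K - {}))" by (rule outer) simp
        \<comment> \<open>No strand passes near \<open>x0\<close>; with equal initial and final
          break points the map is the identity.\<close>
        show "interval_isotopy (\<lambda>s x. pl_map ((\<lambda>_. 1/3) x) ((\<lambda>_. 2/3) x)
            ((1 - s) * (\<lambda>_. 1/3) x + s * (\<lambda>_. 1/3) x) ((1 - s) * (\<lambda>_. 2/3) x + s * (\<lambda>_. 2/3) x))"
          by (rule interval_isotopy_pl_map) auto
      qed (use 1 in auto)
    next
      case 2
      have "\<exists>r a a'. 0 < r \<and> continuous_on UNIV a \<and> continuous_on UNIV a' \<and> range a \<subseteq> {0<..<1} \<and> range a' \<subseteq> {0<..<1} \<and>
          (\<forall>p\<in>K. dist p p0 < r \<longrightarrow> a (c p) = h0 p \<and> a' (c p) = h1 p)"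
        by (rule branch) (use 2(1) h0(2)[OF 2(1)] h1(2)[OF 2(1)] in auto)
      then obtain r a a' where a: "0 < r" "continuous_on UNIV a" "continuous_on UNIV a'" "range a \<subseteq> {0<..<1}" "range a' \<subseteq> {0<..<1}"
        "\<forall>p\<in>K. dist p p0 < r \<longrightarrow> a (c p) = h0 p \<and> a' (c p) = h1 p"
        by (elim exE conjE)
      have pos: "0 < a x" "a x < 1" "0 < a' x" "a' x < 1" for x
        using subsetD[OF a(4) rangeI[of a x]] subsetD[OF a(5) rangeI[of a' x]] by simp_all
      show ?thesis
      proof (intro exI conjI ballI impI)
        show "open (- c ` (K - ball p0 r))" by (rule outer) simp
        have "c p \<noteq> x0" if "p \<in> K - ball p0 r" for p
          using that 2(3) a(1) by (metis DiffD1 DiffD2 centre_in_ball)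
        then show "x0 \<in> - c ` (K - ball p0 r)" by blast
        \<comment> \<open>Only one branch has to be followed; the second break point is put halfway
          between the branch and 1.\<close>
        show "interval_isotopy (\<lambda>s x. pl_map (a x) ((1 + a x) / 2) ((1 - s) * a x + s * a' x) ((1 - s) * ((1 + a x) / 2) + s * ((1 + a' x) / 2)))"
          by (rule interval_isotopy_pl_map) (use a(2,3) pos in \<open>auto intro!: continuous_intros\<close>)
        fix p assume p: "p \<in> K" "c p \<in> - c ` (K - ball p0 r)"
        then have "dist p p0 < r" by (auto simp: dist_commute)
        then have "a (c p) = h0 p" "a' (c p) = h1 p" using a(6) p by auto
        then show "pl_map (a (c p)) ((1 + a (c p)) / 2) ((1 - 1) * a (c p) + 1 * a' (c p)) ((1 - 1) * ((1 + a (c p)) / 2) + 1 * ((1 + a' (c p)) / 2)) (h0 p) = h1 p"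
          using pl_map_values(2)[of "a (c p)" "(1 + a (c p)) / 2"] pos[of "c p"] by simp
      qed
    next
      case 3
      have pq: "p0 \<noteq> q0" using 3 by auto
      \<comment> \<open>The midpoints separate the two branches: extensions confined to opposite
        sides of \<open>m\<close> and of \<open>m'\<close> stay in order everywhere, not only near
        \<open>x0\<close>.\<close>
      define m where "m = (h0 p0 + h0 q0) / 2"
      define m' where "m' = (h1 p0 + h1 q0) / 2"
      have m: "h0 p0 < m" "m < h0 q0" "h1 p0 < m'" "m' < h1 q0" using 3 by (auto simp: m_def m'_def)
      have "\<exists>r a a'. 0 < r \<and> continuous_on UNIV a \<and> continuous_on UNIV a' \<and> range a \<subseteq> {0<..<m} \<and> range a' \<subseteq> {0<..<m'} \<and>
          (\<forall>p\<in>K. dist p p0 < r \<longrightarrow> a (c p) = h0 p \<and> a' (c p) = h1 p)"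
        by (rule branch) (use 3(1) h0(2)[OF 3(1)] h1(2)[OF 3(1)] m in auto)
      then obtain r a a' where a: "0 < r" "continuous_on UNIV a" "continuous_on UNIV a'" "range a \<subseteq> {0<..<m}" "range a' \<subseteq> {0<..<m'}"
        "\<forall>p\<in>K. dist p p0 < r \<longrightarrow> a (c p) = h0 p \<and> a' (c p) = h1 p"
        by (elim exE conjE)
      have "\<exists>r a a'. 0 < r \<and> continuous_on UNIV a \<and> continuous_on UNIV a' \<and> range a \<subseteq> {m<..<1} \<and> range a' \<subseteq> {m'<..<1} \<and>
          (\<forall>p\<in>K. dist p q0 < r \<longrightarrow> a (c p) = h0 p \<and> a' (c p) = h1 p)"
        by (rule branch) (use 3(2) h0(2)[OF 3(2)] h1(2)[OF 3(2)] m in auto)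
      then obtain r' b b' where b: "0 < r'" "continuous_on UNIV b" "continuous_on UNIV b'" "range b \<subseteq> {m<..<1}" "range b' \<subseteq> {m'<..<1}"
        "\<forall>p\<in>K. dist p q0 < r' \<longrightarrow> b (c p) = h0 p \<and> b' (c p) = h1 p"
        by (elim exE conjE)
      have pos: "0 < a x" "a x < m" "0 < a' x" "a' x < m'" "m < b x" "b x < 1" "m' < b' x" "b' x < 1" for x
        using subsetD[OF a(4) rangeI[of a x]] subsetD[OF a(5) rangeI[of a' x]]
          subsetD[OF b(4) rangeI[of b x]] subsetD[OF b(5) rangeI[of b' x]] by simp_all
      have lt: "a x < b x" "a' x < b' x" for x using pos[of x] by linarith+
      let ?V = "ball p0 r \<union> ball q0 r'"
      show ?thesis
      proof (intro exI conjI ballI impI)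
        show "open (- c ` (K - ?V))" by (rule outer) auto
        have "c p \<noteq> x0" if "p \<in> K - ?V" for p
        proof
          assume "c p = x0"
          then have "p = p0 \<or> p = q0" using two[OF 3(1,2), of p] 3(3,4) pq that by (metis DiffD1)
          then show False using that a(1) b(1) by auto
        qed
        then show "x0 \<in> - c ` (K - ?V)" by blast
        show "interval_isotopy (\<lambda>s x. pl_map (a x) (b x) ((1 - s) * a x + s * a' x) ((1 - s) * b x + s * b' x))"
          by (rule interval_isotopy_pl_map) (use a(2,3) b(2,3) pos lt in auto)
        fix p assume p: "p \<in> K" "c p \<in> - c ` (K - ?V)"
        then have "dist p p0 < r \<or> dist p q0 < r'" by (auto simp: dist_commute)
        then have "a (c p) = h0 p \<and> a' (c p) = h1 p \<or> b (c p) = h0 p \<and> b' (c p) = h1 p" using a(6) b(6) p by auto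
        then show "pl_map (a (c p)) (b (c p)) ((1 - 1) * a (c p) + 1 * a' (c p)) ((1 - 1) * b (c p) + 1 * b' (c p)) (h0 p) = h1 p"
          using pl_map_values(2,3)[of "a (c p)" "b (c p)"] pos[of "c p"] lt[of "c p"] by auto
      qed
    qed
  qed
  then obtain G where "interval_isotopy G" "\<And>p. p \<in> K \<Longrightarrow> G 1 (c p) (h0 p) = h1 p"
    using interval_isotopy_glue[of K c h0 h1] K(3) h0(2) by blast
  then show ?thesis
    using interval_isotopy_torus_isotopic K(3) h0(2) by blast
qed

section \<open>Horizontal isotopies supported in a chart\<close>

lemma compact_square: "compact square"
  unfolding square_def by (intro compact_Times) auto

text \<open>\<open>S\<close> fixes the border of the square, so its extension by the identity is
  continuous: two closed sets are pasted, the chart and the complement of its interior. The map of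
  the chart may depend on the height but preserves it. Continuity of \<open>c'\<close> comes along,
  because \<open>c'\<close> is a component of the time-one image of the graph of \<open>h\<close>
  over \<open>c\<close>.\<close>

lemma chart_isotopic:
  fixes S :: "real \<Rightarrow> real \<Rightarrow> real \<times> real \<Rightarrow> real \<times> real" and K :: "'p :: topological_space set"
  assumes \<phi>: "continuous_on square \<phi>" "inj_on \<phi> square" "\<phi> ` square \<subseteq> torus"
    and cont: "continuous_on ({0..1} \<times> ({0..1} \<times> square)) (\<lambda>(s, z, w). S s z w)"
    and bij: "\<And>s z. s \<in> {0..1} \<Longrightarrow> z \<in> {0..1} \<Longrightarrow> bij_betw (S s z) square square"
    and bd: "\<And>s z w. \<lbrakk>s \<in> {0..1}; z \<in> {0..1}; w \<in> square; \<bar>fst w\<bar> = 1 \<or> \<bar>snd w\<bar> = 1\<rbrakk> \<Longrightarrow> S s z w = w"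
    and S0: "\<And>z w. \<lbrakk>z \<in> {0..1}; w \<in> square\<rbrakk> \<Longrightarrow> S 0 z w = w"
    and K: "c ` K \<subseteq> torus" "\<And>p. p \<in> K \<Longrightarrow> 0 < h p \<and> h p < 1"
    and c': "\<And>p. p \<in> K \<Longrightarrow> c p \<notin> \<phi> ` square \<and> c' p = c p \<or> (\<exists>w\<in>square. c p = \<phi> w \<and> c' p = \<phi> (S 1 (h p) w))"
  shows "torus_isotopic (height_graph K c h) (height_graph K c' h) \<and>
    (continuous_on K c \<longrightarrow> continuous_on K h \<longrightarrow> continuous_on K c')"
proof -
  let ?W = "torus \<times> {0..1::real}"
  define osq where "osq = {-1<..<1::real} \<times> {-1<..<1::real}"
  define \<psi> where "\<psi> = inv_into square \<phi>"
  have \<psi>: "\<psi> (\<phi> w) = w" if "w \<in> square" for w using \<phi>(2) that by (simp add: \<psi>_def)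
  have \<psi>sq: "\<psi> y \<in> square" "\<phi> (\<psi> y) = y" if "y \<in> \<phi> ` square" for y
    using that by (auto simp: \<psi>_def inv_into_into f_inv_into_f)
  have c\<psi>: "continuous_on (\<phi> ` square) \<psi>"
    by (rule continuous_on_inv[OF \<phi>(1) compact_square]) (use \<psi> in auto)
  have osq: "osq \<subseteq> square" by (auto simp: osq_def square_def)
  \<comment> \<open>Invariance of domain makes the inner square open in the torus; this is what
    makes the second set of the pasting closed.\<close>
  have "openin (top_of_set torus) (\<phi> ` osq)"
    by (rule torus_invariance_of_domain)
      (use \<phi> osq in \<open>auto simp: osq_def open_Times intro: continuous_on_subset inj_on_subset\<close>)
  then have "closedin (top_of_set torus) (torus - \<phi> ` osq)" by (simp add: closedin_diff)
  then have compB: "compact (torus - \<phi> ` osq)" using compact_torus closedin_compact by blast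
  have compA: "compact (\<phi> ` square)" using \<phi>(1) compact_square by (rule compact_continuous_image)
  have Sin: "S s z w \<in> square" if "s \<in> {0..1}" "z \<in> {0..1}" "w \<in> square" for s z w
    using bij_betwE[OF bij[OF that(1,2)]] that(3) by blast
  define T where "T s z y = (if y \<in> \<phi> ` square then \<phi> (S s z (\<psi> y)) else y)" for s z y
  define H where "H s w = (T s (snd w) (fst w), snd w)" for s :: real and w :: "torus_pt \<times> real"
  have bijT: "bij_betw (T s z) torus torus" if sz: "s \<in> {0..1}" "z \<in> {0..1}" for s z
  proof -
    have "bij_betw \<psi> (\<phi> ` square) square" unfolding \<psi>_def
      by (rule bij_betw_inv_into) (use \<phi> in \<open>simp add: bij_betw_def\<close>)
    moreover have "bij_betw \<phi> square (\<phi> ` square)" using \<phi> by (simp add: bij_betw_def)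
    ultimately have "bij_betw (\<phi> \<circ> (S s z \<circ> \<psi>)) (\<phi> ` square) (\<phi> ` square)"
      using bij[OF sz] by (blast intro: bij_betw_trans)
    then have 1: "bij_betw (T s z) (\<phi> ` square) (\<phi> ` square)"
      by (rule bij_betw_cong[THEN iffD1, rotated]) (simp add: T_def)
    have 2: "bij_betw (T s z) (torus - \<phi> ` square) (torus - \<phi> ` square)"
      by (rule bij_betw_cong[THEN iffD1, OF _ bij_betw_id]) (auto simp: T_def)
    have "\<phi> ` square \<union> (torus - \<phi> ` square) = torus" using \<phi>(3) by blast
    then show ?thesis using bij_betw_combine[OF 1 2] by auto
  qed
  let ?A = "{0..1::real} \<times> (\<phi> ` square \<times> {0..1::real})"
  let ?B = "{0..1::real} \<times> ((torus - \<phi> ` osq) \<times> {0..1::real})"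
  have "continuous_on (?A \<union> ?B) (\<lambda>(s, w). H s w)"
  proof (rule continuous_on_closed_Un)
    show "closed ?A" "closed ?B" using compA compB by (auto intro!: compact_imp_closed compact_Times)
    have 1: "continuous_on ?A (\<lambda>x. \<psi> (fst (snd x)))"
      by (rule continuous_on_compose2[OF c\<psi>]) (auto intro!: continuous_intros)
    have "continuous_on ?A (\<lambda>x. case (fst x, snd (snd x), \<psi> (fst (snd x))) of (s, z, w) \<Rightarrow> S s z w)"
      by (rule continuous_on_compose2[OF cont]) (use \<psi> in \<open>auto intro!: continuous_intros 1\<close>)
    then have 2: "continuous_on ?A (\<lambda>x. S (fst x) (snd (snd x)) (\<psi> (fst (snd x))))" by simp
    have "continuous_on ?A (\<lambda>x. \<phi> (S (fst x) (snd (snd x)) (\<psi> (fst (snd x)))))"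
      by (rule continuous_on_compose2[OF \<phi>(1) 2]) (use \<psi> Sin in auto)
    then have "continuous_on ?A (\<lambda>x. (\<phi> (S (fst x) (snd (snd x)) (\<psi> (fst (snd x)))), snd (snd x)))"
      by (intro continuous_intros)
    then show "continuous_on ?A (\<lambda>(s, w). H s w)"
      by (rule continuous_on_eq) (auto simp: H_def T_def)
    have "continuous_on ?B (\<lambda>x. snd x)" by (intro continuous_intros)
    then show "continuous_on ?B (\<lambda>(s, w). H s w)"
    proof (rule continuous_on_eq)
      fix x assume x: "x \<in> ?B"
      obtain s y z where xe: "x = (s, (y, z))" by (metis prod.collapse)
      have sz: "s \<in> {0..1}" "z \<in> {0..1}" "y \<notin> \<phi> ` osq" using x xe by auto
      have "T s z y = y"
      proof (cases "y \<in> \<phi> ` square")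
        case True
        have "\<psi> y \<notin> osq" using \<psi>sq(2)[OF True] sz(3) by (metis imageI)
        then have "\<bar>fst (\<psi> y)\<bar> = 1 \<or> \<bar>snd (\<psi> y)\<bar> = 1"
          using \<psi>sq(1)[OF True] by (auto simp: osq_def square_def mem_Times_iff abs_if)
        then show ?thesis using bd[OF sz(1,2) \<psi>sq(1)[OF True]] \<psi>sq(2)[OF True] True by (simp add: T_def)
      qed (simp add: T_def)
      then show "snd x = (case x of (s, w) \<Rightarrow> H s w)" by (simp add: xe H_def)
    qed
  qed
  moreover have "?A \<union> ?B = {0..1} \<times> ?W" using \<phi>(3) osq by blast
  ultimately have contH: "continuous_on ({0..1} \<times> ?W) (\<lambda>(s, w). H s w)" by simp
  have H1: "H 1 (c p, h p) = (c' p, h p)" if "p \<in> K" for p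
    using c'[OF that]
  proof
    assume "c p \<notin> \<phi> ` square \<and> c' p = c p" then show ?thesis by (simp add: H_def T_def)
  next
    assume "\<exists>w\<in>square. c p = \<phi> w \<and> c' p = \<phi> (S 1 (h p) w)"
    then obtain w where "w \<in> square" "c p = \<phi> w" "c' p = \<phi> (S 1 (h p) w)" by blast
    then show ?thesis using \<psi> by (simp add: H_def T_def)
  qed
  have "torus_isotopic (height_graph K c h) (height_graph K c' h)"
    unfolding torus_isotopic_def
  proof (intro exI[of _ H] conjI ballI contH)
    fix s :: real assume s: "s \<in> {0..1}"
    show "bij_betw (H s) ?W ?W"
      unfolding H_def by (rule bij_betw_fibrewise[OF bijT[OF s]])
    have "bij_betw (H s) (torus \<times> {0<..<1}) (torus \<times> {0<..<1})"
      unfolding H_def by (rule bij_betw_fibrewise[OF bijT[OF s]]) auto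
    then show "H s ` (torus \<times> {0<..<1}) = torus \<times> {0<..<1}" by (rule bij_betw_imp_surj_on)
  next
    fix w assume w: "w \<in> ?W"
    have "T 0 (snd w) (fst w) = fst w"
      using S0[of "snd w"] \<psi>sq w by (auto simp: T_def mem_Times_iff)
    then show "H 0 w = w" by (simp add: H_def)
  next
    show "H 1 ` height_graph K c h = height_graph K c' h"
      unfolding height_graph_def image_image by (rule image_cong[OF refl]) (rule H1)
  qed
  moreover have "continuous_on K c'" if "continuous_on K c" "continuous_on K h"
  proof -
    have "continuous_on ?W (H 1)" by (rule continuous_on_slice[OF contH]) simp
    then have "continuous_on K (\<lambda>p. H 1 (c p, h p))"
    proof (rule continuous_on_compose2)
      show "(\<lambda>p. (c p, h p)) ` K \<subseteq> ?W"
        using K by (intro image_subsetI) (simp add: image_subset_iff less_imp_le)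
    qed (intro continuous_intros that)
    then have "continuous_on K (\<lambda>p. fst (H 1 (c p, h p)))" by (intro continuous_intros)
    then show ?thesis by (rule continuous_on_eq) (simp add: H1)
  qed
  ultimately show ?thesis by blast
qed

text \<open>Translation by \<open>D\<close>, cut off such that the map is increasing and fixes \<open>-1\<close> and \<open>1\<close>.\<close>

definition slide :: "real \<Rightarrow> real \<Rightarrow> real" where
  "slide D x = max (max (x / 5 - 4 / 5) (5 * x - 4)) (min (min (x / 5 + 4 / 5) (5 * x + 4)) (x + D))"

lemma slide_strict_mono: "x < y \<Longrightarrow> slide D x < slide D y"
  unfolding slide_def by (auto simp: max_def min_def)

text \<open>The bounds are the lines of slopes 1/5 and 5 through \<open>(1, 1)\<close> and
  \<open>(-1, -1)\<close>; as long as the translate lies between them nothing is cut off.\<close>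

lemma slide_eq:
  assumes "x + D \<le> x / 5 + 4 / 5" "x + D \<le> 5 * x + 4" "x / 5 - 4 / 5 \<le> x + D" "5 * x - 4 \<le> x + D"
  shows "slide D x = x + D"
proof -
  have "min (min (x / 5 + 4 / 5) (5 * x + 4)) (x + D) = x + D" by (rule min_absorb2) (use assms in simp)
  moreover have "max (max (x / 5 - 4 / 5) (5 * x - 4)) (x + D) = x + D" by (rule max_absorb2) (use assms in simp)
  ultimately show ?thesis by (simp add: slide_def)
qed

lemma slide_ends: "slide D 1 = 1" "slide D (-1) = -1"
  by (auto simp: slide_def max_def min_def)

lemma slide_0: "-1 \<le> x \<Longrightarrow> x \<le> 1 \<Longrightarrow> slide 0 x = x"
  using slide_eq[of x 0] by simp

lemma continuous_on_slide [continuous_intros]: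
  assumes "continuous_on S f" "continuous_on S g"
  shows "continuous_on S (\<lambda>x. slide (f x) (g x))"
  unfolding slide_def by (intro continuous_intros assms) auto

lemma bij_betw_slide: "bij_betw (slide D) {-1..1} {-1..1}"
  unfolding bij_betw_def
proof (intro conjI equalityI subsetI)
  show "inj_on (slide D) {-1..1}" by (rule inj_onI) (metis less_irrefl linorder_neqE slide_strict_mono)
  have mono: "x \<le> y \<Longrightarrow> slide D x \<le> slide D y" for x y using slide_strict_mono[of x y D] by (cases "x = y") auto
  fix y assume "y \<in> slide D ` {-1..1}"
  then show "y \<in> {-1..1}" using mono[of "-1"] mono[of _ 1] by (auto simp: slide_ends)
next
  fix y :: real assume "y \<in> {-1..1}"
  moreover have "continuous_on {-1..1} (\<lambda>x. slide D x)" by (intro continuous_intros)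
  ultimately obtain x where "-1 \<le> x" "x \<le> 1" "slide D x = y"
    using IVT'[of "slide D" "-1" y 1] by (auto simp: slide_ends)
  then show "y \<in> slide D ` {-1..1}" by auto
qed

text \<open>\<open>D\<close> may vary with the transverse coordinate and with the height, so that
  one arc can move while arcs at other levels stay. It is scaled by the time. The border is fixed
  because \<open>D\<close> vanishes on two sides of the square and \<open>slide\<close> fixes the
  ends on the other two.\<close>

lemma slide_isotopic:
  fixes K :: "'p :: topological_space set"
  assumes \<phi>: "continuous_on square \<phi>" "inj_on \<phi> square" "\<phi> ` square \<subseteq> torus"
    and D: "continuous_on ({-1..1} \<times> {0..1}) (\<lambda>(y, z). D y z)" "\<And>y z. \<bar>y\<bar> = 1 \<Longrightarrow> z \<in> {0..1} \<Longrightarrow> D y z = 0"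
    and K: "c ` K \<subseteq> torus" "\<And>p. p \<in> K \<Longrightarrow> 0 < h p \<and> h p < 1"
    and c': "\<And>p. p \<in> K \<Longrightarrow> c p \<notin> \<phi> ` square \<and> c' p = c p \<or>
      (\<exists>x y. (x, y) \<in> square \<and> c p = \<phi> (x, y) \<and> c' p = \<phi> (slide (D y (h p)) x, y))"
  shows "torus_isotopic (height_graph K c h) (height_graph K c' h) \<and>
    (continuous_on K c \<longrightarrow> continuous_on K h \<longrightarrow> continuous_on K c')"
proof (rule chart_isotopic[OF \<phi>, where S = "\<lambda>s z w. (slide (s * D (snd w) z) (fst w), snd w)"])
  have "continuous_on ({0..1} \<times> ({0..1} \<times> square)) (\<lambda>x. case (snd (snd (snd x)), fst (snd x)) of (y, z) \<Rightarrow> D y z)"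
    by (rule continuous_on_compose2[OF D(1)]) (auto simp: square_def intro!: continuous_intros)
  then show "continuous_on ({0..1} \<times> ({0..1} \<times> square)) (\<lambda>(s, z, w). (slide (s * D (snd w) z) (fst w), snd w))"
    unfolding case_prod_unfold by (intro continuous_intros) simp
  fix s z :: real assume s: "s \<in> {0..1}" and z: "z \<in> {0..1}"
  show "bij_betw (\<lambda>w. (slide (s * D (snd w) z) (fst w), snd w)) square square"
    unfolding square_def by (rule bij_betw_fibrewise) (rule bij_betw_slide)
  fix w :: "real \<times> real" assume w: "w \<in> square" "\<bar>fst w\<bar> = 1 \<or> \<bar>snd w\<bar> = 1"
  have "slide (s * D (snd w) z) (fst w) = fst w"
  proof (cases "\<bar>snd w\<bar> = 1")
    case True
    then show ?thesis using D(2)[OF True z] w by (simp add: slide_0 square_def mem_Times_iff)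
  next
    case False
    then have "fst w = 1 \<or> fst w = -1" using w by (auto simp: abs_if split: if_splits)
    then show ?thesis using slide_ends by metis
  qed
  then show "(slide (s * D (snd w) z) (fst w), snd w) = w" by simp
next
  fix z :: real and w :: "real \<times> real" assume "z \<in> {0..1}" "w \<in> square"
  then show "(slide (0 * D (snd w) z) (fst w), snd w) = w" by (simp add: slide_0 square_def mem_Times_iff)
next
  fix p assume "p \<in> K"
  then show "c p \<notin> \<phi> ` square \<and> c' p = c p \<or>
    (\<exists>w\<in>square. c p = \<phi> w \<and> c' p = \<phi> (slide (1 * D (snd w) (h p)) (fst w), snd w))"
    using c'[of p] by force
qed (use K in auto)

section \<open>Resolved diagrams\<close>

text \<open>The type of natural numbers is not an instance of the class of metric spaces, so metric arguments on
  \<open>circles n\<close> are carried out in \<open>\<real> \<times> \<complex>\<close>.\<close>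

definition real_strand :: "nat \<times> complex \<Rightarrow> real \<times> complex" where
  "real_strand p = (real (fst p), snd p)"

lemma real_strand_inj: "real_strand p = real_strand q \<longleftrightarrow> p = q"
  by (simp add: real_strand_def prod_eq_iff)

lemma continuous_on_real_strand: "continuous_on S real_strand"
proof -
  have "continuous_on UNIV (real :: nat \<Rightarrow> real)"
    by (simp add: continuous_on_open_vimage open_discrete)
  then have "continuous_on S (\<lambda>p :: nat \<times> complex. real (fst p))"
    by (rule continuous_on_compose2) (auto intro!: continuous_intros)
  then show ?thesis unfolding real_strand_def by (intro continuous_intros)
qed

lemma real_strand_inverse:
  assumes "compact K"
  obtains \<iota> where "continuous_on (real_strand ` K) \<iota>" "\<And>p. \<iota> (real_strand p) = p"
proof
  show "inv real_strand (real_strand p) = p" for p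
    by (rule inv_f_f) (simp add: inj_def real_strand_inj)
  then show "continuous_on (real_strand ` K) (inv real_strand)"
    by (intro continuous_on_inv[OF continuous_on_real_strand assms]) auto
qed

lemma strand_vertical_isotopic:
  fixes K :: "(nat \<times> complex) set" and c :: "nat \<times> complex \<Rightarrow> torus_pt"
  assumes K: "compact K" "continuous_on K c" "c ` K \<subseteq> torus"
    and fin: "finite {p \<in> K. \<exists>q\<in>K. q \<noteq> p \<and> c q = c p}"
    and two: "\<And>p q r. \<lbrakk>p \<in> K; q \<in> K; r \<in> K; c p = c q; c p = c r; p \<noteq> q; p \<noteq> r\<rbrakk> \<Longrightarrow> q = r"
    and h0: "continuous_on K h0" "\<And>p. p \<in> K \<Longrightarrow> 0 < h0 p \<and> h0 p < 1"
    and h1: "continuous_on K h1" "\<And>p. p \<in> K \<Longrightarrow> 0 < h1 p \<and> h1 p < 1"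
    and ord: "\<And>p q. \<lbrakk>p \<in> K; q \<in> K; p \<noteq> q; c p = c q\<rbrakk> \<Longrightarrow> h0 p < h0 q \<and> h1 p < h1 q \<or> h0 q < h0 p \<and> h1 q < h1 p"
  shows "torus_isotopic (height_graph K c h0) (height_graph K c h1)"
proof -
  obtain \<iota> where \<iota>: "continuous_on (real_strand ` K) \<iota>" "\<And>p. \<iota> (real_strand p) = p"
    using real_strand_inverse[OF K(1)] by blast
  have graph: "height_graph (real_strand ` K) (c \<circ> \<iota>) (h \<circ> \<iota>) = height_graph K c h" for h
    by (simp add: height_graph_def image_image \<iota>(2))
  have cont: "continuous_on (real_strand ` K) (f \<circ> \<iota>)" if "continuous_on K f" for f :: "nat \<times> complex \<Rightarrow> 'b::topological_space"
    by (intro continuous_on_compose \<iota>(1)) (simp add: image_image \<iota>(2) that)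
  have "torus_isotopic (height_graph (real_strand ` K) (c \<circ> \<iota>) (h0 \<circ> \<iota>)) (height_graph (real_strand ` K) (c \<circ> \<iota>) (h1 \<circ> \<iota>))"
  proof (rule vertical_isotopic)
    show "compact (real_strand ` K)" by (rule compact_continuous_image[OF continuous_on_real_strand K(1)])
    have "{p \<in> real_strand ` K. \<exists>q\<in>real_strand ` K. q \<noteq> p \<and> (c \<circ> \<iota>) q = (c \<circ> \<iota>) p} \<subseteq>
        real_strand ` {p \<in> K. \<exists>q\<in>K. q \<noteq> p \<and> c q = c p}"
    proof
      fix x assume "x \<in> {p \<in> real_strand ` K. \<exists>q\<in>real_strand ` K. q \<noteq> p \<and> (c \<circ> \<iota>) q = (c \<circ> \<iota>) p}"
      then have "x \<in> real_strand ` K" "\<exists>y\<in>real_strand ` K. y \<noteq> x \<and> (c \<circ> \<iota>) y = (c \<circ> \<iota>) x" by auto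
      then obtain p q where "x = real_strand p" "p \<in> K" "q \<in> K" "real_strand q \<noteq> x" "(c \<circ> \<iota>) (real_strand q) = (c \<circ> \<iota>) x"
        by blast
      then have "x = real_strand p" "p \<in> K" "q \<in> K" "q \<noteq> p" "c q = c p" by (auto simp: \<iota>(2))
      then show "x \<in> real_strand ` {p \<in> K. \<exists>q\<in>K. q \<noteq> p \<and> c q = c p}" by blast
    qed
    then show "finite {p \<in> real_strand ` K. \<exists>q\<in>real_strand ` K. q \<noteq> p \<and> (c \<circ> \<iota>) q = (c \<circ> \<iota>) p}"
      by (rule finite_subset) (use fin in simp)
  next
    fix p q r assume "p \<in> real_strand ` K" "q \<in> real_strand ` K" "r \<in> real_strand ` K" "(c \<circ> \<iota>) p = (c \<circ> \<iota>) q"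
      "(c \<circ> \<iota>) p = (c \<circ> \<iota>) r" "p \<noteq> q" "p \<noteq> r"
    then show "q = r" using two by (elim imageE) (simp add: \<iota>(2), metis)
  next
    fix p q assume "p \<in> real_strand ` K" "q \<in> real_strand ` K" "p \<noteq> q" "(c \<circ> \<iota>) p = (c \<circ> \<iota>) q"
    then show "(h0 \<circ> \<iota>) p < (h0 \<circ> \<iota>) q \<and> (h1 \<circ> \<iota>) p < (h1 \<circ> \<iota>) q \<or> (h0 \<circ> \<iota>) q < (h0 \<circ> \<iota>) p \<and> (h1 \<circ> \<iota>) q < (h1 \<circ> \<iota>) p"
      using ord by (elim imageE) (simp add: \<iota>(2), metis)
  qed (use cont K h0 h1 in \<open>auto simp: \<iota>(2)\<close>)
  then show ?thesis by (simp add: graph)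
qed

text \<open>Dugundji's theorem after transport to a metric space; the open interval is convex, so
  the extended heights stay strictly between 0 and 1.\<close>

lemma strand_extension:
  fixes K :: "(nat \<times> complex) set" and f :: "nat \<times> complex \<Rightarrow> real"
  assumes K: "compact K" and S: "closed S" "S \<subseteq> K" and f: "continuous_on S f" "f ` S \<subseteq> {0<..<1}"
  shows "\<exists>h. continuous_on K h \<and> h ` K \<subseteq> {0<..<1} \<and> (\<forall>p\<in>S. h p = f p)"
proof -
  obtain \<iota> where \<iota>: "continuous_on (real_strand ` K) \<iota>" "\<And>p. \<iota> (real_strand p) = p"
    using real_strand_inverse[OF K] by blast
  have cS: "compact S" using compact_Int_closed[OF K S(1)] S(2) by (simp add: Int_absorb1)
  have "closedin (top_of_set (real_strand ` K)) (real_strand ` S)"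
    using S(2) by (intro closed_subset compact_imp_closed compact_continuous_image[OF continuous_on_real_strand cS]) auto
  moreover have "continuous_on (real_strand ` S) (f \<circ> \<iota>)"
    by (intro continuous_on_compose continuous_on_subset[OF \<iota>(1)]) (use S f in \<open>auto simp: image_image \<iota>(2)\<close>)
  moreover have "(f \<circ> \<iota>) ` (real_strand ` S) \<subseteq> {0<..<1}" using f(2) by (auto simp: \<iota>(2))
  ultimately obtain g where g: "continuous_on (real_strand ` K) g" "g ` (real_strand ` K) \<subseteq> {0<..<1}"
    "\<And>x. x \<in> real_strand ` S \<Longrightarrow> g x = (f \<circ> \<iota>) x"
    using Dugundji[of "{0<..<1::real}" "real_strand ` K" "real_strand ` S" "f \<circ> \<iota>",
        OF convex_real_interval(8)] by (metis greaterThanLessThan_empty_iff not_le zero_less_one)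
  have "continuous_on K (g \<circ> real_strand)"
    by (intro continuous_on_compose continuous_on_real_strand g(1))
  moreover have "\<forall>p\<in>S. (g \<circ> real_strand) p = f p" using g(3) by (simp add: \<iota>(2))
  moreover have "(g \<circ> real_strand) ` K \<subseteq> {0<..<1}" using g(2) by (simp add: image_image image_subset_iff)
  ultimately show ?thesis by blast
qed

section \<open>Height functions and the links they resolve to\<close>

definition height_function :: "('p :: topological_space, 's) pseudo_diagram \<Rightarrow> 'p set \<Rightarrow> ('p \<Rightarrow> real) \<Rightarrow> bool" where
  "height_function D Ov h \<longleftrightarrow> continuous_on (params D) h \<and> (\<forall>p\<in>params D. 0 < h p \<and> h p < 1) \<and>
     (\<forall>p q. partner_strands D p q \<and> p \<in> Ov \<and> q \<notin> Ov \<longrightarrow> h q < h p)"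

definition diagram_graph :: "('p, 's) pseudo_diagram \<Rightarrow> ('p \<Rightarrow> real) \<Rightarrow> ('s \<times> real) set" where
  "diagram_graph D h = height_graph (params D) (curve D) h"

text \<open>The choice stays a parameter because a change of lattice has to compare the choices of
  two resolutions.\<close>

definition resolved_with :: "('p :: topological_space, 's) pseudo_diagram \<Rightarrow> 'p set \<Rightarrow> ('s \<times> real) set \<Rightarrow> bool" where
  "resolved_with D Ov t \<longleftrightarrow> resolution_choice D Ov \<and> (\<exists>h. height_function D Ov h \<and> t = diagram_graph D h)"

definition resolved_by :: "('p :: topological_space, 's) pseudo_diagram \<Rightarrow> ('s \<times> real) set \<Rightarrow> bool" where
  "resolved_by D t \<longleftrightarrow> (\<exists>Ov. resolved_with D Ov t)"

definition link_resolutions :: "motif \<Rightarrow> (torus_pt \<times> real) set set" where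
  "link_resolutions d = {L. thick_torus_link L \<and> resolved_by d L}"

lemma resolution_set_eq: "resolution_set u v D = {t. DP_tangle_over u v t \<and> resolved_by D t}"
  unfolding resolution_set_def resolved_by_def resolved_with_def spatial_lift_def height_function_def diagram_graph_def height_graph_def
  by blast

lemma partner_strands_sym: "partner_strands D p q \<longleftrightarrow> partner_strands D q p"
  by (auto simp: partner_strands_def)

lemma partner_strands_params: "partner_strands D p q \<Longrightarrow> p \<in> params D \<and> q \<in> params D"
  by (simp add: partner_strands_def)

lemma double_strands_params: "double_strands D \<subseteq> params D"
  by (auto simp: double_strands_def partner_strands_def)

lemma pre_strands_params: "pre_strands D \<subseteq> params D"
  by (auto simp: pre_strands_def partner_strands_def)

lemma resolution_choice_partner:
  "resolution_choice D Ov \<Longrightarrow> partner_strands D p q \<Longrightarrow> p \<in> Ov \<longleftrightarrow> q \<notin> Ov"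
  by (simp add: resolution_choice_def)

lemma pseudo_motifD:
  assumes "pseudo_motif d"
  shows "compact (params d)" "continuous_on (params d) (curve d)" "curve d ` params d \<subseteq> torus"
    "finite (double_strands d)" "\<And>p q r. partner_strands d p q \<Longrightarrow> partner_strands d p r \<Longrightarrow> q = r"
    "over d \<subseteq> double_strands d" "\<And>p q. partner_strands d p q \<Longrightarrow> \<not> (p \<in> over d \<and> q \<in> over d)"
    "valid_marking d" "\<exists>n. params d = circles n"
proof -
  obtain n where n: "params d = circles n" using assms by (auto simp: pseudo_motif_def)
  show "compact (params d)" unfolding n circles_def by (intro compact_Times finite_imp_compact compact_sphere) simp
  have c: "continuous_on (params d) (curve d)" "curve d ` params d \<subseteq> torus" "finite (double_strands d)"
    "\<forall>p q r. partner_strands d p q \<and> partner_strands d p r \<longrightarrow> q = r" "over d \<subseteq> double_strands d"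
    "\<forall>p q. partner_strands d p q \<longrightarrow> \<not> (p \<in> over d \<and> q \<in> over d)" "valid_marking d"
    using assms unfolding pseudo_motif_def by simp_all
  show "continuous_on (params d) (curve d)" "curve d ` params d \<subseteq> torus" "finite (double_strands d)"
    "over d \<subseteq> double_strands d" "valid_marking d" by (fact c)+
  show "\<And>p q r. partner_strands d p q \<Longrightarrow> partner_strands d p r \<Longrightarrow> q = r" using c(4) by blast
  show "\<And>p q. partner_strands d p q \<Longrightarrow> \<not> (p \<in> over d \<and> q \<in> over d)" using c(6) by blast
  show "\<exists>n. params d = circles n" using n by blast
qed

lemma valid_markingD:
  assumes "valid_marking d"
  shows "homol d \<subseteq> pre_strands d \<times> pre_strands d" "\<And>p. p \<in> pre_strands d \<Longrightarrow> (p, p) \<in> homol d"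
    "\<And>p q. (p, q) \<in> homol d \<Longrightarrow> (q, p) \<in> homol d"
    "\<And>p q r. (p, q) \<in> homol d \<Longrightarrow> (q, r) \<in> homol d \<Longrightarrow> (p, r) \<in> homol d"
    "\<And>p q p' q'. (p, p') \<in> homol d \<Longrightarrow> partner_strands d p q \<Longrightarrow> partner_strands d p' q' \<Longrightarrow> (q, q') \<in> homol d"
    "\<And>p q. partner_strands d p q \<Longrightarrow> (p, q) \<notin> homol d"
  using assms unfolding valid_marking_def equiv_def refl_on_def sym_on_def trans_on_def by blast+

lemma height_function_isotopic:
  assumes d: "pseudo_motif d" and Ov: "resolution_choice d Ov"
    and h0: "height_function d Ov h0" and h1: "height_function d Ov h1"
  shows "torus_isotopic (diagram_graph d h0) (diagram_graph d h1)"
  unfolding diagram_graph_def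
proof (rule strand_vertical_isotopic)
  note D = pseudo_motifD[OF d]
  show "compact (params d)" "continuous_on (params d) (curve d)" "curve d ` params d \<subseteq> torus" by (fact D)+
  have "{p \<in> params d. \<exists>q\<in>params d. q \<noteq> p \<and> curve d q = curve d p} = double_strands d"
    unfolding double_strands_def partner_strands_def by (rule Collect_cong) metis
  then show "finite {p \<in> params d. \<exists>q\<in>params d. q \<noteq> p \<and> curve d q = curve d p}" using D(4) by simp
  show "continuous_on (params d) h0" "continuous_on (params d) h1"
    "\<And>p. p \<in> params d \<Longrightarrow> 0 < h0 p \<and> h0 p < 1" "\<And>p. p \<in> params d \<Longrightarrow> 0 < h1 p \<and> h1 p < 1"
    using h0 h1 by (auto simp: height_function_def)
  fix p q assume pq: "p \<in> params d" "q \<in> params d" "curve d p = curve d q"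
  { fix r assume "r \<in> params d" "curve d p = curve d r" "p \<noteq> q" "p \<noteq> r"
    then show "q = r" using D(5)[of p q r] pq by (auto simp: partner_strands_def) }
  assume "p \<noteq> q"
  then have part: "partner_strands d p q" "partner_strands d q p" using pq by (auto simp: partner_strands_def)
  then show "h0 p < h0 q \<and> h1 p < h1 q \<or> h0 q < h0 p \<and> h1 q < h1 p"
    using resolution_choice_partner[OF Ov part(1)] h0 h1 unfolding height_function_def by blast
qed

text \<open>Outside \<open>J\<close> only finitely many double strands constrain the height.
  Partners lie both in \<open>J\<close> or both outside, so the values prescribed on
  \<open>J\<close> never compete with those chosen elsewhere.\<close>

lemma height_function_exists:
  fixes D :: "(nat \<times> complex, 's) pseudo_diagram"
  assumes D: "compact (params D)" "finite (double_strands D)" and Ov: "resolution_choice D Ov"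
    and J: "compact J" "J \<subseteq> params D" "continuous_on J g" "\<And>p. p \<in> J \<Longrightarrow> 0 < g p \<and> g p < (1::real)"
    and sep: "\<And>p q. partner_strands D p q \<Longrightarrow> p \<in> J \<longleftrightarrow> q \<in> J"
    and ord: "\<And>p q. \<lbrakk>p \<in> J; q \<in> J; partner_strands D p q; p \<in> Ov; q \<notin> Ov\<rbrakk> \<Longrightarrow> g q < g p"
  shows "\<exists>h. height_function D Ov h \<and> (\<forall>p\<in>J. h p = g p)"
proof -
  let ?A = "double_strands D - J"
  \<comment> \<open>The constants are a high value for upper strands and a low value for lower
    strands, both inside the open interval.\<close>
  define f where "f p = (if p \<in> J then g p else if p \<in> Ov then 2/3 else 1/3)" for p
  have fin: "finite ?A" using D by simp
  have "continuous_on (J \<union> ?A) f"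
  proof (rule continuous_on_closed_Un)
    show "closed J" using J(1) by (rule compact_imp_closed)
    show "closed ?A" using fin by (rule finite_imp_closed)
    show "continuous_on J f" using J(3) by (rule continuous_on_eq) (simp add: f_def)
    show "continuous_on ?A f" using fin by (rule continuous_on_finite)
  qed
  moreover have "closed (J \<union> ?A)" using J(1) fin by (intro closed_Un compact_imp_closed finite_imp_closed)
  moreover have "f ` (J \<union> ?A) \<subseteq> {0<..<1}" using J(4) by (auto simp: f_def)
  moreover have "J \<union> ?A \<subseteq> params D" using J(2) double_strands_params[of D] by blast
  ultimately obtain h where h: "continuous_on (params D) h" "h ` params D \<subseteq> {0<..<1}" "\<And>p. p \<in> J \<union> ?A \<Longrightarrow> h p = f p"
    using strand_extension[OF D(1), of "J \<union> ?A" f] by blast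
  have "height_function D Ov h"
    unfolding height_function_def
  proof (intro conjI allI impI ballI)
    fix p assume "p \<in> params D" then show "0 < h p" "h p < 1" using h(2) by auto
  next
    fix p q assume pq: "partner_strands D p q \<and> p \<in> Ov \<and> q \<notin> Ov"
    then have "p \<in> double_strands D" "q \<in> double_strands D"
      using partner_strands_sym[of D p q] unfolding double_strands_def by blast+
    then have "h p = f p" "h q = f q" using h(3) by auto
    then show "h q < h p" using pq ord[of p q] sep[of p q] by (auto simp: f_def)
  qed (fact h(1))
  moreover have "h p = g p" if "p \<in> J" for p using that h(3)[of p] by (simp add: f_def)
  ultimately show ?thesis by blast
qed

subsection \<open>Reparametrised and pushed diagrams\<close>

text \<open>\<open>same_diagram\<close> with its homeomorphism named, so that a choice can be pushed
  forward along \<open>b\<close> and back along \<open>g\<close>.\<close>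

definition diagram_iso :: "('p \<Rightarrow> 'q) \<Rightarrow> ('q \<Rightarrow> 'p) \<Rightarrow> ('p :: topological_space, 's) pseudo_diagram \<Rightarrow>
    ('q :: topological_space, 's) pseudo_diagram \<Rightarrow> bool" where
  "diagram_iso b g D D' \<longleftrightarrow> homeomorphism (params D) (params D') b g \<and>
     (\<forall>p\<in>params D. curve D' (b p) = curve D p) \<and> b ` over D = over D' \<and> map_prod b b ` homol D = homol D'"

lemma same_diagram_iso: "same_diagram D D' \<longleftrightarrow> (\<exists>b g. diagram_iso b g D D')"
  by (simp add: same_diagram_def diagram_iso_def)

text \<open>Reparametrisation moves no point of space: the heights are pulled back along
  \<open>g\<close>, and the resulting tangle is literally the same set.\<close>

lemma diagram_iso_resolved:
  assumes "diagram_iso b g D D'" and hom: "homol D \<subseteq> params D \<times> params D" and res: "resolved_with D Ov t"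
  shows "resolved_with D' (b ` Ov) t"
proof -
  have b: "homeomorphism (params D) (params D') b g"
    "\<And>p. p \<in> params D \<Longrightarrow> curve D' (b p) = curve D p" "b ` over D = over D'" "map_prod b b ` homol D = homol D'"
    using assms(1) by (auto simp: diagram_iso_def)
  obtain h where Ov: "resolution_choice D Ov" and h: "height_function D Ov h" and t: "t = diagram_graph D h"
    using res by (auto simp: resolved_with_def)
  have gb: "g (b p) = p" if "p \<in> params D" for p using b(1) that by (simp add: homeomorphism_def)
  have bg: "b (g p) = p" "g p \<in> params D" if "p \<in> params D'" for p using b(1) that by (auto simp: homeomorphism_def)
  have bP: "params D' = b ` params D" using b(1) by (simp add: homeomorphism_def)
  have OvP: "Ov \<subseteq> params D" using Ov double_strands_params[of D] by (auto simp: resolution_choice_def)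
  have mem: "b p \<in> b ` Ov \<longleftrightarrow> p \<in> Ov" if "p \<in> params D" for p
    using that OvP gb by (metis image_iff subsetD)
  have part: "partner_strands D' (b p) (b q) \<longleftrightarrow> partner_strands D p q" if "p \<in> params D" "q \<in> params D" for p q
    using that b(2) bP gb unfolding partner_strands_def by (metis imageI)
  have part': "\<exists>p q. p' = b p \<and> q' = b q \<and> partner_strands D p q" if "partner_strands D' p' q'" for p' q'
  proof -
    have "p' \<in> b ` params D" "q' \<in> b ` params D" using that bP by (auto simp: partner_strands_def)
    then show ?thesis using part that by blast
  qed
  have "resolution_choice D' (b ` Ov)"
    unfolding resolution_choice_def
  proof (intro conjI allI impI)
    show "over D' \<subseteq> b ` Ov" unfolding b(3)[symmetric] using Ov by (intro image_mono) (simp add: resolution_choice_def)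
    show "b ` Ov \<subseteq> double_strands D'"
    proof
      fix p' assume "p' \<in> b ` Ov"
      then obtain p where "p \<in> Ov" "p' = b p" by blast
      then obtain q where "partner_strands D p q" "p' = b p" using Ov by (auto simp: resolution_choice_def double_strands_def)
      then show "p' \<in> double_strands D'"
        using part[of p q] partner_strands_params[of D p q] by (auto simp: double_strands_def)
    qed
    fix p' q' assume "partner_strands D' p' q'"
    then obtain p q where "p' = b p" "q' = b q" "partner_strands D p q" using part' by blast
    then show "(p' \<in> b ` Ov) = (q' \<notin> b ` Ov)"
      using mem[of p] mem[of q] partner_strands_params[of D p q] resolution_choice_partner[OF Ov, of p q] by simp
  next
    show "\<forall>(p', q')\<in>homol D'. (p' \<in> b ` Ov) = (q' \<in> b ` Ov)"
    proof (intro ballI, clarify)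
      fix p' q' assume "(p', q') \<in> homol D'"
      then obtain p q where pq: "(p, q) \<in> homol D" "p' = b p" "q' = b q" unfolding b(4)[symmetric] by auto
      then have "p \<in> Ov \<longleftrightarrow> q \<in> Ov" using Ov by (auto simp: resolution_choice_def)
      then show "(p' \<in> b ` Ov) = (q' \<in> b ` Ov)" using pq mem[of p] mem[of q] subsetD[OF hom pq(1)] by simp
    qed
  qed
  moreover have "height_function D' (b ` Ov) (h \<circ> g)"
    unfolding height_function_def
  proof (intro conjI allI impI)
    show "continuous_on (params D') (h \<circ> g)"
      using h b(1) by (intro continuous_on_compose) (auto simp: homeomorphism_def height_function_def)
    show "\<forall>p\<in>params D'. 0 < (h \<circ> g) p \<and> (h \<circ> g) p < 1"
      using h bg(2) by (simp add: height_function_def)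
    fix p' q' assume pq': "partner_strands D' p' q' \<and> p' \<in> b ` Ov \<and> q' \<notin> b ` Ov"
    then obtain p q where pq: "p' = b p" "q' = b q" "partner_strands D p q" using part' by blast
    then have P: "p \<in> params D" "q \<in> params D" using partner_strands_params[OF pq(3)] by auto
    then show "(h \<circ> g) q' < (h \<circ> g) p'"
      using h pq pq' mem gb by (simp add: height_function_def)
  qed
  moreover have "t = diagram_graph D' (h \<circ> g)"
    unfolding t diagram_graph_def height_graph_def bP image_image
    by (rule image_cong) (use b(2) gb in auto)
  ultimately show ?thesis unfolding resolved_with_def by blast
qed

lemma diagram_iso_sym:
  assumes "diagram_iso b g D D'" "over D \<subseteq> params D" "homol D \<subseteq> params D \<times> params D"
  shows "diagram_iso g b D' D"
proof -
  have b: "homeomorphism (params D) (params D') b g"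
    "\<And>p. p \<in> params D \<Longrightarrow> curve D' (b p) = curve D p" "b ` over D = over D'" "map_prod b b ` homol D = homol D'"
    using assms(1) by (auto simp: diagram_iso_def)
  have gb: "g (b p) = p" if "p \<in> params D" for p using b(1) that by (simp add: homeomorphism_def)
  have bg: "b (g p) = p" "g p \<in> params D" if "p \<in> params D'" for p using b(1) that by (auto simp: homeomorphism_def)
  have "g ` over D' = over D"
    unfolding b(3)[symmetric] image_image using gb assms(2) by (force simp: subset_iff)
  moreover have "map_prod g g ` homol D' = homol D"
  proof -
    have "map_prod g g ` homol D' = (\<lambda>w. w) ` homol D"
      unfolding b(4)[symmetric] image_image by (rule image_cong) (use gb assms(3) in auto)
    then show ?thesis by simp
  qed
  moreover have "curve D (g p) = curve D' p" if "p \<in> params D'" for p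
    using b(2)[of "g p"] bg[OF that] by simp
  ultimately show ?thesis
    unfolding diagram_iso_def using homeomorphism_symD[OF b(1)] by blast
qed

lemma same_diagram_resolved:
  assumes "same_diagram D D'" "over D \<subseteq> params D" "homol D \<subseteq> params D \<times> params D"
    "homol D' \<subseteq> params D' \<times> params D'"
  shows "resolved_by D t \<longleftrightarrow> resolved_by D' t"
proof -
  obtain b g where b: "diagram_iso b g D D'" using assms(1) by (auto simp: same_diagram_iso)
  show ?thesis
    using diagram_iso_resolved[OF b assms(3)] diagram_iso_resolved[OF diagram_iso_sym[OF b assms(2,3)] assms(4)]
    unfolding resolved_by_def by blast
qed

lemma motif_strands_params:
  assumes "pseudo_motif d"
  shows "over d \<subseteq> params d" "homol d \<subseteq> params d \<times> params d"
proof -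
  show "over d \<subseteq> params d"
    using pseudo_motifD(6)[OF assms] double_strands_params by (rule order_trans)
  show "homol d \<subseteq> params d \<times> params d"
    using valid_markingD(1)[OF pseudo_motifD(8)[OF assms]] by (rule order_trans) (intro Sigma_mono pre_strands_params)
qed

lemma push_diagram_simps [simp]:
  "params (push_diagram F d) = params d" "curve (push_diagram F d) = F \<circ> curve d"
  "over (push_diagram F d) = over d" "homol (push_diagram F d) = homol d"
  by (simp_all add: push_diagram_def)

definition thicken :: "(torus_pt \<Rightarrow> torus_pt) \<Rightarrow> torus_pt \<times> real \<Rightarrow> torus_pt \<times> real" where
  "thicken F w = (F (fst w), snd w)"

text \<open>An injective map of the torus neither creates nor removes double points, so the choices
  and the height functions are literally the same.\<close>

lemma push_diagram_resolved:
  assumes d: "pseudo_motif d" and F: "inj_on F torus"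
  shows "resolved_by (push_diagram F d) L \<longleftrightarrow> (\<exists>L0. resolved_by d L0 \<and> L = thicken F ` L0)"
proof -
  have "partner_strands (push_diagram F d) p q \<longleftrightarrow> partner_strands d p q" for p q
    using F pseudo_motifD(3)[OF d] unfolding partner_strands_def
    by (auto dest: inj_onD simp: image_subset_iff)
  then have part: "partner_strands (push_diagram F d) = partner_strands d" by (simp add: fun_eq_iff)
  have "resolution_choice (push_diagram F d) = resolution_choice d"
    by (simp add: fun_eq_iff resolution_choice_def double_strands_def part)
  moreover have "height_function (push_diagram F d) = height_function d"
    by (simp add: fun_eq_iff height_function_def part)
  moreover have "diagram_graph (push_diagram F d) h = thicken F ` diagram_graph d h" for h
    by (simp add: diagram_graph_def height_graph_def thicken_def image_image)
  ultimately show ?thesis unfolding resolved_by_def resolved_with_def by auto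
qed

lemma link_resolutions_push:
  assumes d: "pseudo_motif d" and d': "pseudo_motif d'" and F: "homeomorphism torus torus F G"
    and same: "same_diagram (push_diagram F d) d'"
  shows "link_resolutions d' = (`) (thicken F) ` link_resolutions d"
proof -
  have inj: "inj_on F torus" using F by (auto simp: homeomorphism_def intro: inj_on_inverseI)
  have hom: "homeomorphism (torus \<times> {0<..<1}) (torus \<times> {0<..<1}) (thicken F) (thicken G)"
    if "homeomorphism torus torus F G" for F G
  proof -
    have FG: "continuous_on torus F" "continuous_on torus G" "\<And>x. x \<in> torus \<Longrightarrow> F x \<in> torus \<and> G x \<in> torus \<and> F (G x) = x \<and> G (F x) = x"
      using that by (auto simp: homeomorphism_def)
    show ?thesis
      unfolding thicken_def
      by (rule homeomorphismI)
        (use FG(3) in \<open>auto intro!: continuous_intros continuous_on_compose2[OF FG(1)] continuous_on_compose2[OF FG(2)]\<close>)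
  qed
  note [simp] = motif_strands_params[OF d]
  have res: "resolved_by d' L \<longleftrightarrow> resolved_by (push_diagram F d) L" for L
    using same_diagram_resolved[OF same] motif_strands_params[OF d'] by simp
  show ?thesis
  proof (intro equalityI subsetI)
    fix L assume L: "L \<in> link_resolutions d'"
    then obtain L0 where L0: "resolved_by d L0" "L = thicken F ` L0"
      using res push_diagram_resolved[OF d inj] by (auto simp: link_resolutions_def)
    have T: "thick_torus_link L" using L by (simp add: link_resolutions_def)
    have "L0 \<subseteq> torus \<times> UNIV"
      using L0(1) pseudo_motifD(3)[OF d] by (auto simp: resolved_by_def resolved_with_def diagram_graph_def height_graph_def)
    \<comment> \<open>The inverse homeomorphism recovers \<open>L0\<close> from its image, and with
      it the local flatness of \<open>L0\<close>.\<close>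
    then have "thicken G (thicken F w) = w" if "w \<in> L0" for w
      using that F by (auto simp: thicken_def homeomorphism_def)
    then have "thicken G ` L = L0" unfolding L0(2) image_image by simp
    then have "thick_torus_link L0"
      using thick_torus_link_homeomorphic[OF T hom[OF homeomorphism_symD[OF F]]] by simp
    then show "L \<in> (`) (thicken F) ` link_resolutions d" using L0 by (auto simp: link_resolutions_def)
  next
    fix L assume "L \<in> (`) (thicken F) ` link_resolutions d"
    then obtain L0 where L0: "thick_torus_link L0" "resolved_by d L0" "L = thicken F ` L0"
      by (auto simp: link_resolutions_def)
    then show "L \<in> link_resolutions d'"
      using thick_torus_link_homeomorphic[OF L0(1) hom[OF F]] res push_diagram_resolved[OF d inj]
      by (auto simp: link_resolutions_def)
  qed
qed

subsection \<open>Resolutions of a lifted diagram\<close>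

lemma diagram_lift_simps:
  "(q, p) \<in> params (diagram_lift u v d) \<longleftrightarrow> p \<in> params d \<and> univ_cover u v q = curve d p"
  "curve (diagram_lift u v d) = fst"
  "(q, p) \<in> over (diagram_lift u v d) \<longleftrightarrow> p \<in> params d \<and> univ_cover u v q = curve d p \<and> p \<in> over d"
  "(w, w') \<in> homol (diagram_lift u v d) \<longleftrightarrow>
     w \<in> params (diagram_lift u v d) \<and> w' \<in> params (diagram_lift u v d) \<and> (snd w, snd w') \<in> homol d"
  by (auto simp: diagram_lift_def Let_def)

lemma partner_strands_lift:
  "partner_strands (diagram_lift u v d) (q, p) (q', p') \<longleftrightarrow>
     q = q' \<and> univ_cover u v q = curve d p \<and> partner_strands d p p'"
  by (auto simp: partner_strands_def diagram_lift_simps)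

lemma double_strands_lift:
  "(q, p) \<in> double_strands (diagram_lift u v d) \<longleftrightarrow> univ_cover u v q = curve d p \<and> p \<in> double_strands d"
  by (auto simp: double_strands_def partner_strands_lift)

definition lift_strands :: "plane \<Rightarrow> plane \<Rightarrow> ('p, torus_pt) pseudo_diagram \<Rightarrow> 'p set \<Rightarrow> (plane \<times> 'p) set" where
  "lift_strands u v d Ov = {w \<in> params (diagram_lift u v d). snd w \<in> Ov}"

lemma mem_lift_strands:
  "(q, p) \<in> lift_strands u v d Ov \<longleftrightarrow> p \<in> params d \<and> univ_cover u v q = curve d p \<and> p \<in> Ov"
  by (simp add: lift_strands_def diagram_lift_simps)

text \<open>The point is that a choice upstairs is constant along the fibres of the covering and
  therefore comes from the motif.\<close>

lemma resolution_choice_lift: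
  assumes uv: "plane_basis u v" and d: "pseudo_motif d"
  shows "resolution_choice (diagram_lift u v d) Ov \<longleftrightarrow> (\<exists>O'. resolution_choice d O' \<and> Ov = lift_strands u v d O')"
proof
  let ?D = "diagram_lift u v d"
  note dd = pseudo_motifD[OF d] and m = valid_markingD[OF pseudo_motifD(8)[OF d]]
  assume Ov: "resolution_choice ?D Ov"
  have sub: "over ?D \<subseteq> Ov" "Ov \<subseteq> double_strands ?D"
    and hom: "\<And>w w'. (w, w') \<in> homol ?D \<Longrightarrow> w \<in> Ov \<longleftrightarrow> w' \<in> Ov"
    using Ov by (auto simp: resolution_choice_def)
  define O' where "O' = {p. \<exists>q. (q, p) \<in> Ov}"
  have surj: "\<exists>q. univ_cover u v q = curve d p" if "p \<in> params d" for p
    using univ_cover_surj[OF uv, of "curve d p"] dd(3) that by blast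
  have indep: "(q', p) \<in> Ov" if "(q, p) \<in> Ov" "univ_cover u v q' = curve d p" for q q' p
  proof -
    have q: "univ_cover u v q = curve d p" "p \<in> double_strands d"
      using subsetD[OF sub(2) that(1)] by (simp_all add: double_strands_lift)
    then obtain r where r: "partner_strands d p r" by (auto simp: double_strands_def)
    have P: "p \<in> params d" "r \<in> params d" using partner_strands_params[OF r] by auto
    \<comment> \<open>Over strands are always chosen, their partners never; and all lifts of one
      precrossing strand are homologous, by reflexivity of the marking of \<open>d\<close>.\<close>
    consider "p \<in> over d" | "p \<notin> over d" "r \<in> over d" | "p \<in> pre_strands d"
      using r unfolding pre_strands_def by blast
    then show ?thesis
    proof cases
      case 1
      then have "(q', p) \<in> over ?D" using that(2) P by (simp add: diagram_lift_simps)
      then show ?thesis using sub by blast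
    next
      case 2
      have "curve d r = curve d p" using r by (simp add: partner_strands_def)
      then have "(q, r) \<in> over ?D" using 2 q P by (simp add: diagram_lift_simps)
      then have "(q, r) \<in> Ov" using sub by blast
      moreover have "partner_strands ?D (q, p) (q, r)" using q r by (simp add: partner_strands_lift)
      ultimately show ?thesis using resolution_choice_partner[OF Ov] that(1) by blast
    next
      case 3
      then have "((q, p), (q', p)) \<in> homol ?D" using m(2) q that(2) P by (simp add: diagram_lift_simps)
      then show ?thesis using hom that(1) by blast
    qed
  qed
  have mem: "(q, p) \<in> Ov \<longleftrightarrow> p \<in> O'" if "univ_cover u v q = curve d p" for q p
    using indep that unfolding O'_def by blast
  have "resolution_choice d O'"
    unfolding resolution_choice_def
  proof (intro conjI allI impI)
    show "over d \<subseteq> O'"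
    proof
      fix p assume p: "p \<in> over d"
      then have P: "p \<in> params d" using dd(6) double_strands_params[of d] by blast
      then obtain q where "univ_cover u v q = curve d p" using surj by blast
      then have "(q, p) \<in> over ?D" using p P by (simp add: diagram_lift_simps)
      then show "p \<in> O'" using sub unfolding O'_def by blast
    qed
    show "O' \<subseteq> double_strands d" using subsetD[OF sub(2)] by (auto simp: O'_def double_strands_lift)
    fix p r assume r: "partner_strands d p r"
    then obtain q where q: "univ_cover u v q = curve d p" using surj[of p] partner_strands_params[OF r] by blast
    have "curve d r = curve d p" using r by (simp add: partner_strands_def)
    then have "partner_strands ?D (q, p) (q, r)" "univ_cover u v q = curve d r"
      using q r by (simp_all add: partner_strands_lift)
    then show "(p \<in> O') = (r \<notin> O')" using mem q resolution_choice_partner[OF Ov] by blast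
  next
    show "\<forall>(p, p')\<in>homol d. (p \<in> O') = (p' \<in> O')"
    proof (intro ballI, clarify)
      fix p p' assume h: "(p, p') \<in> homol d"
      then have P: "p \<in> params d" "p' \<in> params d" using m(1) pre_strands_params[of d] by blast+
      obtain q q' where q: "univ_cover u v q = curve d p" "univ_cover u v q' = curve d p'" using surj P by metis
      then have "((q, p), (q', p')) \<in> homol ?D" using h P by (simp add: diagram_lift_simps)
      then show "(p \<in> O') = (p' \<in> O')" using hom mem q by blast
    qed
  qed
  moreover have "Ov = lift_strands u v d O'"
  proof (intro equalityI subrelI)
    fix q p assume w: "(q, p) \<in> Ov"
    then show "(q, p) \<in> lift_strands u v d O'"
      using subsetD[OF sub(2) w] double_strands_params[of d] by (auto simp: mem_lift_strands O'_def double_strands_lift)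
  next
    fix q p assume "(q, p) \<in> lift_strands u v d O'"
    then show "(q, p) \<in> Ov" using mem by (auto simp: mem_lift_strands)
  qed
  ultimately show "\<exists>O'. resolution_choice d O' \<and> Ov = lift_strands u v d O'" by blast
next
  let ?D = "diagram_lift u v d"
  assume "\<exists>O'. resolution_choice d O' \<and> Ov = lift_strands u v d O'"
  then obtain O' where O': "resolution_choice d O'" and Ov: "Ov = lift_strands u v d O'" by blast
  show "resolution_choice ?D Ov"
    unfolding resolution_choice_def
  proof (intro conjI allI impI)
    show "over ?D \<subseteq> Ov"
      using O' unfolding Ov by (auto simp: resolution_choice_def mem_lift_strands diagram_lift_simps)
    show "Ov \<subseteq> double_strands ?D"
      using O' unfolding Ov by (auto simp: resolution_choice_def mem_lift_strands double_strands_lift)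
    fix w w' assume w: "partner_strands ?D w w'"
    obtain q p q' p' where e: "w = (q, p)" "w' = (q', p')" by (metis prod.collapse)
    have "q' = q" "univ_cover u v q = curve d p" "partner_strands d p p'" using w unfolding e partner_strands_lift by auto
    moreover from this have "curve d p' = curve d p" "p \<in> params d" "p' \<in> params d" by (auto simp: partner_strands_def)
    ultimately show "(w \<in> Ov) = (w' \<notin> Ov)"
      unfolding e Ov mem_lift_strands using resolution_choice_partner[OF O'] by auto
  next
    show "\<forall>(w, w')\<in>homol ?D. (w \<in> Ov) = (w' \<in> Ov)"
    proof (intro ballI, clarify)
      fix q p q' p' assume "((q, p), (q', p')) \<in> homol ?D"
      then show "((q, p) \<in> Ov) = ((q', p') \<in> Ov)"
        using O' unfolding Ov mem_lift_strands by (auto simp: diagram_lift_simps resolution_choice_def)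
    qed
  qed
qed

lemma diagram_graph_lift:
  "diagram_graph (diagram_lift u v d) (h \<circ> snd) = tangle_lift u v (diagram_graph d h)"
  by (auto simp: diagram_graph_def height_graph_def diagram_lift_def Let_def tangle_lift_def image_iff Bex_def)

lemma diagram_graph_cong:
  "(\<And>p. p \<in> params D \<Longrightarrow> h p = h' p) \<Longrightarrow> diagram_graph D h = diagram_graph D h'"
  by (auto simp: diagram_graph_def height_graph_def)

lemma height_function_lift:
  assumes "height_function d Ov h"
  shows "height_function (diagram_lift u v d) (lift_strands u v d Ov) (h \<circ> snd)"
  unfolding height_function_def
proof (intro conjI allI impI)
  let ?D = "diagram_lift u v d"
  show "continuous_on (params ?D) (h \<circ> snd)"
  proof (rule continuous_on_compose)
    show "continuous_on (params ?D) snd" by (intro continuous_intros)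
    show "continuous_on (snd ` params ?D) h"
      by (rule continuous_on_subset[of "params d"]) (use assms in \<open>auto simp: height_function_def diagram_lift_simps\<close>)
  qed
  show "\<forall>w\<in>params ?D. 0 < (h \<circ> snd) w \<and> (h \<circ> snd) w < 1"
    using assms by (auto simp: height_function_def diagram_lift_simps)
  fix w w' assume w: "partner_strands ?D w w' \<and> w \<in> lift_strands u v d Ov \<and> w' \<notin> lift_strands u v d Ov"
  obtain q p q' p' where e: "w = (q, p)" "w' = (q', p')" by (metis prod.collapse)
  have "q' = q" "univ_cover u v q = curve d p" "partner_strands d p p'" using w unfolding e partner_strands_lift by auto
  moreover from this have "curve d p' = curve d p" "p \<in> params d" "p' \<in> params d" by (auto simp: partner_strands_def)
  ultimately have "p \<in> Ov \<and> p' \<notin> Ov" using w unfolding e by (auto simp: mem_lift_strands)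
  then show "(h \<circ> snd) w' < (h \<circ> snd) w"
    using assms \<open>partner_strands d p p'\<close> by (auto simp: height_function_def e)
qed

text \<open>Two strands over the same point are told apart by their order, which is periodic; hence so are
  their heights.\<close>

lemma height_function_descends:
  assumes uv: "plane_basis u v" and d: "pseudo_motif d" and Ov: "resolution_choice d Ov"
    and h: "height_function (diagram_lift u v d) (lift_strands u v d Ov) h"
    and L: "diagram_graph (diagram_lift u v d) h = tangle_lift u v L"
  obtains h' where "height_function d Ov h'" "\<And>w. w \<in> params (diagram_lift u v d) \<Longrightarrow> h w = h' (snd w)"
proof -
  let ?D = "diagram_lift u v d"
  let ?\<rho> = "univ_cover u v"
  note dd = pseudo_motifD[OF d]
  have surj: "\<exists>q. ?\<rho> q = curve d p" if "p \<in> params d" for p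
    using univ_cover_surj[OF uv, of "curve d p"] dd(3) that by blast
  \<comment> \<open>The lifted link is periodic, so the point over \<open>q\<close> at height
    \<open>h (q, p)\<close> reappears over \<open>q'\<close>; a priori it may belong to another
    strand \<open>r\<close>.\<close>
  have transfer: "\<exists>r. r \<in> params d \<and> curve d r = curve d p \<and> h (q', r) = h (q, p)"
    if "p \<in> params d" "?\<rho> q = curve d p" "?\<rho> q' = curve d p" for p q q'
  proof -
    have "(q, p) \<in> params ?D" using that by (simp add: diagram_lift_simps)
    then have "(q, h (q, p)) \<in> diagram_graph ?D h"
      unfolding diagram_graph_def height_graph_def diagram_lift_simps(2) by (rule image_eqI[rotated]) simp
    then have "(q', h (q, p)) \<in> diagram_graph ?D h"
      unfolding L tangle_lift_def using that by simp
    then obtain w where w: "w \<in> params ?D" "(q', h (q, p)) = (fst w, h w)"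
      unfolding diagram_graph_def height_graph_def diagram_lift_simps(2) by blast
    then show ?thesis using that(3) by (intro exI[of _ "snd w"]) (cases w, simp add: diagram_lift_simps)
  qed
  have ord: "h (q, r) < h (q, p)" if "partner_strands d p r" "?\<rho> q = curve d p" "p \<in> Ov" for p q r
  proof -
    have "r \<notin> Ov" using resolution_choice_partner[OF Ov that(1)] that(3) by simp
    moreover have "curve d r = curve d p" "p \<in> params d" "r \<in> params d" using that(1) by (auto simp: partner_strands_def)
    ultimately have "partner_strands ?D (q, p) (q, r)" "(q, p) \<in> lift_strands u v d Ov" "(q, r) \<notin> lift_strands u v d Ov"
      using that by (simp_all add: partner_strands_lift mem_lift_strands)
    then show ?thesis using h unfolding height_function_def by blast
  qed
  have periodic: "h (q', p) = h (q, p)"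
    if p: "p \<in> params d" "?\<rho> q = curve d p" "?\<rho> q' = curve d p" for p q q'
  proof -
    obtain r where r: "r \<in> params d" "curve d r = curve d p" "h (q', r) = h (q, p)" using transfer[OF p] by blast
    obtain r' where r': "r' \<in> params d" "curve d r' = curve d p" "h (q, r') = h (q', p)" using transfer[OF p(1,3,2)] by blast
    show ?thesis
    proof (cases "r = p \<or> r' = p")
      case False
      \<comment> \<open>If the strand changes, then \<open>r\<close> is the unique partner of
        \<open>p\<close> and the two heights are interchanged between \<open>q\<close> and
        \<open>q'\<close>. This reverses their order, contrary to \<open>ord\<close>.\<close>
      then have part: "partner_strands d p r" "partner_strands d p r'"
        using r r' p by (auto simp: partner_strands_def)
      then have "r' = r" using dd(5) by blast
      then have "h (q, r) = h (q', p)" using r' by simp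
      have "p \<in> Ov \<or> r \<in> Ov" using resolution_choice_partner[OF Ov part(1)] by blast
      then show ?thesis
      proof
        assume "p \<in> Ov"
        then have "h (q, r) < h (q, p)" "h (q', r) < h (q', p)" using ord[OF part(1)] p by auto
        then show ?thesis using r(3) \<open>h (q, r) = h (q', p)\<close> by linarith
      next
        assume "r \<in> Ov"
        then have "h (q, p) < h (q, r)" "h (q', p) < h (q', r)"
          using ord[of r p] part(1) p r(2) partner_strands_sym[of d r p] by auto
        then show ?thesis using r(3) \<open>h (q, r) = h (q', p)\<close> by linarith
      qed
    qed (use r r' in auto)
  qed
  define \<sigma> where "\<sigma> p = (SOME q. ?\<rho> q = curve d p)" for p
  have \<sigma>: "?\<rho> (\<sigma> p) = curve d p" if "p \<in> params d" for p
    unfolding \<sigma>_def using someI_ex[OF surj[OF that]] .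
  define h' where "h' p = h (\<sigma> p, p)" for p
  have hh': "h (q, p) = h' p" if "p \<in> params d" "?\<rho> q = curve d p" for q p
    using periodic[OF that(1) \<sigma>[OF that(1)] that(2)] by (simp add: h'_def)
  \<comment> \<open>The selected preimages \<sigma> need not vary continuously. Near
    \<open>p\<close> the covering has a continuous section \<open>g\<close>, and by periodicity
    \<open>h'\<close> is \<open>h\<close> along that section.\<close>
  have "continuous (at p within params d) h'" if p: "p \<in> params d" for p
  proof -
    obtain B g where B: "open B" "\<sigma> p \<in> B" "openin (top_of_set torus) (?\<rho> ` B)" "homeomorphism B (?\<rho> ` B) ?\<rho> g"
      using univ_cover_local_homeomorphism[OF uv] by metis
    define N where "N = params d \<inter> curve d -` (?\<rho> ` B)"
    have N: "openin (top_of_set (params d)) N"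
      unfolding N_def using continuous_on_open_gen[of "curve d" "params d" torus] dd(2,3) B(3) by blast
    have "curve d p \<in> ?\<rho> ` B" using imageI[OF B(2), of ?\<rho>] \<sigma>[OF p] by simp
    then have pN: "p \<in> N" using p by (simp add: N_def)
    have g: "?\<rho> (g (curve d r)) = curve d r" if "r \<in> N" for r
      using that B(4) by (auto simp: N_def homeomorphism_def)
    have cg: "continuous_on N (\<lambda>r. g (curve d r))"
      by (rule continuous_on_compose2[OF homeomorphism_cont2[OF B(4)] continuous_on_subset[OF dd(2)]])
        (auto simp: N_def)
    have "continuous_on N (\<lambda>r. h (g (curve d r), r))"
    proof (rule continuous_on_compose2[of "params ?D" h])
      show "continuous_on (params ?D) h" using h by (simp add: height_function_def)
      show "(\<lambda>r. (g (curve d r), r)) ` N \<subseteq> params ?D" 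
      proof (rule image_subsetI)
        fix r assume r: "r \<in> N"
        then have "r \<in> params d" by (simp add: N_def)
        then show "(g (curve d r), r) \<in> params ?D" using g[OF r] by (simp add: diagram_lift_simps)
      qed
    qed (intro continuous_intros cg)
    then have "continuous_on N h'"
    proof (rule continuous_on_eq)
      fix r assume "r \<in> N"
      then show "h (g (curve d r), r) = h' r" using hh'[of r "g (curve d r)"] g[of r] by (simp add: N_def)
    qed
    then have "continuous (at p within N) h'" using pN by (simp add: continuous_on_eq_continuous_within)
    moreover have "at p within N = at p within params d"
    proof -
      obtain T where T: "open T" "N = params d \<inter> T" using N by (auto simp: openin_open)
      have "at p within (params d \<inter> T) = at p within params d"
        by (rule at_within_nhd[of p T]) (use T pN in auto)
      then show ?thesis by (simp add: T)
    qed
    ultimately show ?thesis by (simp add: continuous_within)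
  qed
  then have c: "continuous_on (params d) h'" by (simp add: continuous_on_eq_continuous_within)
  have "height_function d Ov h'"
    unfolding height_function_def
  proof (intro conjI allI impI)
    show "\<forall>p\<in>params d. 0 < h' p \<and> h' p < 1"
      using h \<sigma> by (auto simp: h'_def height_function_def diagram_lift_simps)
    fix p r assume pr: "partner_strands d p r \<and> p \<in> Ov \<and> r \<notin> Ov"
    then have P: "p \<in> params d" "r \<in> params d" "curve d r = curve d p" by (auto simp: partner_strands_def)
    then show "h' r < h' p"
      using ord[of p r "\<sigma> p"] pr \<sigma>[OF P(1)] hh'[of r "\<sigma> p"] hh'[of p "\<sigma> p"] by simp
  qed (fact c)
  moreover have "h w = h' (snd w)" if "w \<in> params ?D" for w
    using that hh' by (cases w) (auto simp: diagram_lift_simps)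
  ultimately show thesis using that by blast
qed

lemma tangle_lift_eqD:
  assumes "plane_basis u v" "tangle_lift u v L = tangle_lift u v L'" "L \<subseteq> torus \<times> UNIV" "L' \<subseteq> torus \<times> UNIV"
  shows "L = L'"
proof -
  have "w \<in> L \<longleftrightarrow> w \<in> L'" for w
  proof (cases "fst w \<in> torus")
    case True
    then obtain q where q: "univ_cover u v q = fst w" using univ_cover_surj[OF assms(1)] by metis
    have "(q, snd w) \<in> tangle_lift u v L \<longleftrightarrow> (q, snd w) \<in> tangle_lift u v L'" using assms(2) by simp
    then show ?thesis using q by (simp add: tangle_lift_def)
  next
    case False
    then show ?thesis using subsetD[OF assms(3), of w] subsetD[OF assms(4), of w] by (auto simp: mem_Times_iff)
  qed
  then show ?thesis by blast
qed

lemma diagram_graph_torus: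
  "pseudo_motif d \<Longrightarrow> diagram_graph d h \<subseteq> torus \<times> UNIV"
  using pseudo_motifD(3) by (auto simp: diagram_graph_def height_graph_def)

lemma resolved_with_lift:
  assumes uv: "plane_basis u v" and d: "pseudo_motif d" and L: "L \<subseteq> torus \<times> UNIV"
  shows "resolved_with (diagram_lift u v d) Ov (tangle_lift u v L) \<longleftrightarrow>
    (\<exists>O'. Ov = lift_strands u v d O' \<and> resolved_with d O' L)"
proof
  assume "resolved_with (diagram_lift u v d) Ov (tangle_lift u v L)"
  then obtain h where Ov: "resolution_choice (diagram_lift u v d) Ov" and h: "height_function (diagram_lift u v d) Ov h"
    and t: "tangle_lift u v L = diagram_graph (diagram_lift u v d) h" by (auto simp: resolved_with_def)
  obtain O' where O': "resolution_choice d O'" "Ov = lift_strands u v d O'"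
    using Ov resolution_choice_lift[OF uv d] by blast
  obtain h' where h': "height_function d O' h'" "\<And>w. w \<in> params (diagram_lift u v d) \<Longrightarrow> h w = h' (snd w)"
    using height_function_descends[OF uv d O'(1) _ t[symmetric]] h O'(2) by blast
  have "tangle_lift u v L = diagram_graph (diagram_lift u v d) (h' \<circ> snd)"
    unfolding t by (rule diagram_graph_cong) (simp add: h'(2))
  then have "L = diagram_graph d h'"
    using tangle_lift_eqD[OF uv _ L diagram_graph_torus[OF d]] by (simp add: diagram_graph_lift)
  then show "\<exists>O'. Ov = lift_strands u v d O' \<and> resolved_with d O' L" using O' h'(1) by (auto simp: resolved_with_def)
next
  assume "\<exists>O'. Ov = lift_strands u v d O' \<and> resolved_with d O' L"
  then obtain O' h where "Ov = lift_strands u v d O'" "resolution_choice d O'" "height_function d O' h" "L = diagram_graph d h"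
    by (auto simp: resolved_with_def)
  then show "resolved_with (diagram_lift u v d) Ov (tangle_lift u v L)"
    unfolding resolved_with_def using resolution_choice_lift[OF uv d] height_function_lift diagram_graph_lift by metis
qed

lemma resolved_by_lift:
  assumes "plane_basis u v" "pseudo_motif d" "L \<subseteq> torus \<times> UNIV"
  shows "resolved_by (diagram_lift u v d) (tangle_lift u v L) \<longleftrightarrow> resolved_by d L"
  unfolding resolved_by_def resolved_with_lift[OF assms] by blast

lemma lift_strands_eqD:
  assumes uv: "plane_basis u v" and d: "pseudo_motif d" and "lift_strands u v d Ov = lift_strands u v d Ov'"
    and "resolution_choice d Ov" "resolution_choice d Ov'"
  shows "Ov = Ov'"
proof -
  have sub: "Ov \<subseteq> params d" "Ov' \<subseteq> params d"
    using assms(4,5) double_strands_params[of d] by (auto simp: resolution_choice_def)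
  have "p \<in> Ov \<longleftrightarrow> p \<in> Ov'" if p: "p \<in> params d" for p
  proof -
    obtain q where "univ_cover u v q = curve d p"
      using univ_cover_surj[OF uv, of "curve d p"] pseudo_motifD(3)[OF d] p by blast
    then show ?thesis using assms(3) mem_lift_strands[of q p u v d] p by metis
  qed
  then show ?thesis using sub by blast
qed

lemma resolution_set_lift:
  assumes "plane_basis u v" "pseudo_motif d"
  shows "resolution_set u v (diagram_lift u v d) = tangle_lift u v ` link_resolutions d"
proof -
  have "L \<subseteq> torus \<times> UNIV" if "thick_torus_link L" for L
    using that by (auto simp: thick_torus_link_def)
  then show ?thesis
    unfolding resolution_set_eq link_resolutions_def DP_tangle_over_def
    using resolved_by_lift[OF assms] assms(1) by blast
qed

section \<open>Moves that do not change the diagram\<close>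

definition isotopy_related :: "slab_pt set set \<Rightarrow> slab_pt set set \<Rightarrow> bool" where
  "isotopy_related R R' \<longleftrightarrow> (\<forall>t\<in>R. \<exists>t'\<in>R'. DP_isotopic t t') \<and> (\<forall>t'\<in>R'. \<exists>t\<in>R. DP_isotopic t' t)"

lemma DP_isotopic_refl: "DP_isotopic t t"
  unfolding DP_isotopic_def by (rule equivclp_refl)

lemma DP_isotopic_sym: "DP_isotopic t t' \<Longrightarrow> DP_isotopic t' t"
  unfolding DP_isotopic_def by (rule equivclp_sym)

lemma DP_isotopic_trans: "DP_isotopic t t' \<Longrightarrow> DP_isotopic t' t'' \<Longrightarrow> DP_isotopic t t''"
  unfolding DP_isotopic_def by (rule equivclp_trans)

lemma isotopy_related_refl: "isotopy_related R R"
  unfolding isotopy_related_def using DP_isotopic_refl by blast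

lemma isotopy_related_sym: "isotopy_related R R' \<Longrightarrow> isotopy_related R' R"
  unfolding isotopy_related_def by blast

lemma isotopy_related_trans: "isotopy_related R R' \<Longrightarrow> isotopy_related R' R'' \<Longrightarrow> isotopy_related R R''"
  unfolding isotopy_related_def using DP_isotopic_trans by meson

lemma classical_DP_tangle_lift:
  "plane_basis u v \<Longrightarrow> thick_torus_link L \<Longrightarrow> classical_DP_tangle (tangle_lift u v L)"
  unfolding classical_DP_tangle_def DP_tangle_over_def by blast

lemma torus_isotopic_DP_isotopic:
  assumes "plane_basis u v" "thick_torus_link L" "torus_isotopic L L'"
  shows "DP_isotopic (tangle_lift u v L) (tangle_lift u v L')"
  unfolding DP_isotopic_def
  using classical_DP_tangle_lift[OF assms(1,2)] classical_DP_tangle_lift[OF assms(1) torus_isotopic_thick[OF assms(2,3)]]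
    torus_isotopic_lift[OF assms] by (intro r_into_equivclp) blast

lemma torus_isotopic_chain:
  assumes "torus_isotopic\<^sup>*\<^sup>* L L'" "thick_torus_link L" "plane_basis u v"
  shows "thick_torus_link L' \<and> DP_isotopic (tangle_lift u v L) (tangle_lift u v L')"
  using assms(1)
proof (induction rule: rtranclp_induct)
  case base
  show ?case using assms(2) DP_isotopic_refl by blast
next
  case (step L1 L2)
  then show ?case
    using torus_isotopic_DP_isotopic[OF assms(3)] torus_isotopic_thick DP_isotopic_trans by blast
qed

text \<open>Chains are allowed, so isotopies never have to be concatenated in time; upstairs a chain
  is absorbed by transitivity of \<open>DP_isotopic\<close>.\<close>

definition motif_related :: "motif \<Rightarrow> motif \<Rightarrow> bool" where
  "motif_related d d' \<longleftrightarrow>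
     (\<forall>L\<in>link_resolutions d. \<exists>L'\<in>link_resolutions d'. torus_isotopic\<^sup>*\<^sup>* L L') \<and>
     (\<forall>L'\<in>link_resolutions d'. \<exists>L\<in>link_resolutions d. torus_isotopic\<^sup>*\<^sup>* L' L)"

lemma motif_related_resolution_sets:
  assumes uv: "plane_basis u v" and d: "pseudo_motif d" "pseudo_motif d'" and rel: "motif_related d d'"
  shows "isotopy_related (resolution_set u v (diagram_lift u v d)) (resolution_set u v (diagram_lift u v d'))"
proof -
  have "thick_torus_link L" if "L \<in> link_resolutions d" for L d using that by (simp add: link_resolutions_def)
  then show ?thesis
    using rel torus_isotopic_chain[OF _ _ uv]
    unfolding isotopy_related_def motif_related_def resolution_set_lift[OF uv d(1)] resolution_set_lift[OF uv d(2)]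
    by blast
qed

lemma link_resolutions_subset: "L \<in> link_resolutions d \<Longrightarrow> L \<subseteq> torus \<times> {0..1}"
  by (rule order_trans[of _ "torus \<times> {0<..<1}"]) (auto simp: link_resolutions_def thick_torus_link_def)

lemma surface_isotopy_related:
  assumes d: "pseudo_motif d" "pseudo_motif d'" and si: "surface_isotopy d d'"
  shows "motif_related d d'"
proof -
  obtain F :: "real \<Rightarrow> torus_pt \<Rightarrow> torus_pt" where F: "continuous_on ({0..1} \<times> torus) (\<lambda>(s, x). F s x)"
    "\<And>s. s \<in> {0..1} \<Longrightarrow> \<exists>g. homeomorphism torus torus (F s) g" "\<And>x. x \<in> torus \<Longrightarrow> F 0 x = x"
    "same_diagram (push_diagram (F 1) d) d'"
    using si unfolding surface_isotopy_def by blast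
  obtain G where "homeomorphism torus torus (F 1) G" using F(2)[of 1] by auto
  then have img: "link_resolutions d' = (`) (thicken (F 1)) ` link_resolutions d"
    using link_resolutions_push[OF d] F(4) by blast
  have iso: "torus_isotopic L (thicken (F 1) ` L)" for L
    unfolding torus_isotopic_def
  proof (intro exI[of _ "\<lambda>s. thicken (F s)"] conjI ballI)
    have "continuous_on ({0..1} \<times> (torus \<times> {0..1::real})) (\<lambda>x. case (fst x, fst (snd x)) of (s, y) \<Rightarrow> F s y)"
      by (rule continuous_on_compose2[OF F(1)]) (auto intro!: continuous_intros)
    then show "continuous_on ({0..1} \<times> (torus \<times> {0..1})) (\<lambda>(s, w). thicken (F s) w)"
      unfolding thicken_def case_prod_unfold by (intro continuous_intros) simp
    fix s :: real assume s: "s \<in> {0..1}"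
    obtain g where g: "homeomorphism torus torus (F s) g" using F(2)[OF s] by blast
    then have bij: "bij_betw (F s) torus torus"
      by (auto simp: bij_betw_def homeomorphism_def intro: inj_on_inverseI)
    have "bij_betw (thicken (F s)) (torus \<times> Z) (torus \<times> Z)" for Z
      unfolding thicken_def by (rule bij_betw_fibrewise[of Z "\<lambda>_. F s"]) (rule bij)
    from this[of "{0..1}"] bij_betw_imp_surj_on[OF this[of "{0<..<1}"]]
    show "bij_betw (thicken (F s)) (torus \<times> {0..1}) (torus \<times> {0..1})"
      "thicken (F s) ` (torus \<times> {0<..<1}) = torus \<times> {0<..<1}" by this
  next
    fix w assume "w \<in> torus \<times> {0..1::real}"
    then show "thicken (F 0) w = w" using F(3) by (auto simp: thicken_def)
  qed simp
  show ?thesis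
    unfolding motif_related_def img
  proof (intro conjI ballI)
    fix L assume L: "L \<in> link_resolutions d"
    show "\<exists>L'\<in>(`) (thicken (F 1)) ` link_resolutions d. torus_isotopic\<^sup>*\<^sup>* L L'"
      using iso L by blast
  next
    fix L' assume "L' \<in> (`) (thicken (F 1)) ` link_resolutions d"
    then obtain L where L: "L \<in> link_resolutions d" "L' = thicken (F 1) ` L" by blast
    then have "torus_isotopic L' L" using torus_isotopic_sym[OF iso] link_resolutions_subset by blast
    then show "\<exists>L\<in>link_resolutions d. torus_isotopic\<^sup>*\<^sup>* L' L" using L by blast
  qed
qed

text \<open>A shift is the end of the path of rotations by the angles \<open>s * a\<close> and
  \<open>s * b\<close>.\<close>

lemma shift_surface_isotopy:
  assumes "cmod \<alpha> = 1" "cmod \<beta> = 1" "same_diagram (push_diagram (\<lambda>(x, y). (\<alpha> * x, \<beta> * y)) d) d'"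
  shows "surface_isotopy d d'"
proof -
  obtain a b where ab: "\<alpha> = cis a" "\<beta> = cis b"
    using assms(1,2) by (metis cis_Arg norm_zero sgn_div_norm zero_neq_one scaleR_one inverse_1)
  define F :: "real \<Rightarrow> torus_pt \<Rightarrow> torus_pt" where "F s w = (cis (s * a) * fst w, cis (s * b) * snd w)" for s w
  define G :: "real \<Rightarrow> torus_pt \<Rightarrow> torus_pt" where "G s w = (cis (- (s * a)) * fst w, cis (- (s * b)) * snd w)" for s w
  have "F 1 = (\<lambda>(x, y). (\<alpha> * x, \<beta> * y))" by (auto simp: F_def ab)
  moreover have "homeomorphism torus torus (F s) (G s)" for s
    by (rule homeomorphismI)
      (auto simp: F_def G_def torus_def norm_mult mult.assoc[symmetric] cis_mult intro!: continuous_intros)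
  moreover have "continuous_on ({0..1} \<times> torus) (\<lambda>(s, x). F s x)"
    unfolding F_def case_prod_unfold cis_conv_exp by (intro continuous_intros)
  moreover have "F 0 x = x" for x by (simp add: F_def)
  ultimately show ?thesis
    unfolding surface_isotopy_def using assms(3) by (intro exI[of _ F]) auto
qed

text \<open>Common frame for rescalings and Dehn twists: a map \<open>f\<close> of the links on the
  torus that is covered by a linear map of the plane.\<close>

lemma affine_move_related:
  assumes A: "orientation_preserving_linear A" and uv: "plane_basis u v" "plane_basis u' v'"
    and img: "\<And>L. L \<in> link_resolutions d \<Longrightarrow> f L \<in> link_resolutions d' \<and>
      tangle_lift u' v' (f L) = (\<lambda>(q, z). (A q, z)) ` tangle_lift u v L"
    and onto: "link_resolutions d' \<subseteq> f ` link_resolutions d"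
    and d: "pseudo_motif d" "pseudo_motif d'"
  shows "isotopy_related (resolution_set u v (diagram_lift u v d)) (resolution_set u' v' (diagram_lift u' v' d'))"
proof -
  have iso: "DP_isotopic (tangle_lift u v L) (tangle_lift u' v' (f L))" if L: "L \<in> link_resolutions d" for L
  proof -
    have "thick_torus_link L" "thick_torus_link (f L)" using L img[OF L] by (auto simp: link_resolutions_def)
    moreover have "affine_move (tangle_lift u v L) (tangle_lift u' v' (f L))"
      unfolding affine_move_def using A img[OF L] by (intro exI[of _ A] exI[of _ 0]) simp
    ultimately show ?thesis
      unfolding DP_isotopic_def using classical_DP_tangle_lift uv by (intro r_into_equivclp) blast
  qed
  show ?thesis
    unfolding isotopy_related_def resolution_set_lift[OF uv(1) d(1)] resolution_set_lift[OF uv(2) d(2)]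
  proof (intro conjI ballI)
    fix t assume "t \<in> tangle_lift u v ` link_resolutions d"
    then show "\<exists>t'\<in>tangle_lift u' v' ` link_resolutions d'. DP_isotopic t t'" using iso img by blast
  next
    fix t' assume "t' \<in> tangle_lift u' v' ` link_resolutions d'"
    then obtain L where "L \<in> link_resolutions d" "t' = tangle_lift u' v' (f L)" using onto by blast
    then show "\<exists>t\<in>tangle_lift u v ` link_resolutions d. DP_isotopic t' t" using DP_isotopic_sym[OF iso] by blast
  qed
qed

lemma orientation_preserving_linear_inj:
  assumes "orientation_preserving_linear A"
  shows "linear A" "inj A" "surj A"
proof -
  show lin: "linear A" using assms by (simp add: orientation_preserving_linear_def)
  have "det (matrix A) \<noteq> 0" using assms by (simp add: orientation_preserving_linear_def)
  then show inj: "inj A" using det_nz_iff_inj[OF lin] by simp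
  then show "surj A" using lin by (simp add: linear_injective_imp_surjective)
qed

lemma plane_basis_image:
  assumes A: "orientation_preserving_linear A" and uv: "plane_basis u v"
  shows "plane_basis (A u) (A v)" "univ_cover (A u) (A v) (A q) = univ_cover u v q"
proof -
  note l = orientation_preserving_linear_inj[OF A]
  have "independent (A ` {u, v})"
    using uv l(1,2) by (intro linear_independent_injective_image) (auto simp: plane_basis_def intro: inj_on_subset)
  then show b: "plane_basis (A u) (A v)" using uv l(2) by (auto simp: plane_basis_def inj_eq)
  obtain x y where xy: "\<And>q. q = x q *\<^sub>R u + y q *\<^sub>R v" using plane_basis_coords[OF uv] by metis
  have "A q = x q *\<^sub>R A u + y q *\<^sub>R A v"
    by (subst xy[of q]) (simp add: linear_add[OF l(1)] linear_scale[OF l(1)])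
  then show "univ_cover (A u) (A v) (A q) = univ_cover u v q"
    using plane_basis_univ_cover[OF b] plane_basis_univ_cover[OF uv] xy by metis
qed

lemma rescale_related:
  assumes A: "orientation_preserving_linear A" and uv: "plane_basis u v" and d: "pseudo_motif d"
  shows "isotopy_related (resolution_set u v (diagram_lift u v d)) (resolution_set (A u) (A v) (diagram_lift (A u) (A v) d))"
proof (rule affine_move_related[OF A uv plane_basis_image(1)[OF A uv] _ _ d d, where f = "\<lambda>L. L"])
  fix L assume L: "L \<in> link_resolutions d"
  have "tangle_lift (A u) (A v) L = (\<lambda>(q, z). (A q, z)) ` tangle_lift u v L"
  proof (intro equalityI subrelI)
    fix q z assume "(q, z) \<in> tangle_lift (A u) (A v) L"
    moreover obtain q' where "q = A q'" using orientation_preserving_linear_inj(3)[OF A] by (metis surjD)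
    ultimately show "(q, z) \<in> (\<lambda>(q, z). (A q, z)) ` tangle_lift u v L"
      using plane_basis_image(2)[OF A uv] by (intro image_eqI[of _ _ "(q', z)"]) (auto simp: tangle_lift_def)
  qed (auto simp: tangle_lift_def plane_basis_image(2)[OF A uv])
  then show "L \<in> link_resolutions d \<and> tangle_lift (A u) (A v) L = (\<lambda>(q, z). (A q, z)) ` tangle_lift u v L"
    using L by blast
qed simp

text \<open>A Dehn twist is not isotopic to the identity of the torus, so the two links are compared
  upstairs, where the linear map covering the twist is an admissible affine move.\<close>

lemma dehn_twist_related:
  assumes uv: "plane_basis u v" and d: "pseudo_motif d" "pseudo_motif d'"
    and F: "homeomorphism torus torus F G" and same: "same_diagram (push_diagram F d) d'"
    and A: "linear A" "inj A" and FA: "\<And>q. F (univ_cover u v q) = univ_cover u v (A (A q))"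
  shows "isotopy_related (resolution_set u v (diagram_lift u v d)) (resolution_set u v (diagram_lift u v d'))"
proof (rule affine_move_related[OF _ uv uv _ _ d, where f = "(`) (thicken F)" and A = "\<lambda>q. A (A q)"])
  have "det (matrix A) \<noteq> 0" using det_nz_iff_inj[OF A(1)] A(2) by simp
  then show "orientation_preserving_linear (\<lambda>q. A (A q))"
    using A(1) matrix_compose[OF A(1) A(1)]
    by (auto simp: orientation_preserving_linear_def o_def det_mul linear_compose[unfolded o_def] not_less zero_less_mult_iff)
  have img: "link_resolutions d' = (`) (thicken F) ` link_resolutions d"
    by (rule link_resolutions_push[OF d F same])
  then show "link_resolutions d' \<subseteq> (`) (thicken F) ` link_resolutions d" by simp
  have surjA: "surj A" using A by (simp add: linear_injective_imp_surjective)
  have injF: "inj_on F torus" using F by (auto simp: homeomorphism_def intro: inj_on_inverseI)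
  fix L assume L: "L \<in> link_resolutions d"
  have sub: "L \<subseteq> torus \<times> UNIV" using L by (auto simp: link_resolutions_def thick_torus_link_def)
  have mem: "(univ_cover u v (A (A q)), z) \<in> thicken F ` L \<longleftrightarrow> (univ_cover u v q, z) \<in> L" for q z
  proof
    assume "(univ_cover u v (A (A q)), z) \<in> thicken F ` L"
    then obtain x where x: "(x, z) \<in> L" "F (univ_cover u v q) = F x" by (auto simp: thicken_def FA)
    then have "x = univ_cover u v q"
      using inj_onD[OF injF x(2)[symmetric]] sub univ_cover_in_torus by blast
    then show "(univ_cover u v q, z) \<in> L" using x by simp
  next
    assume "(univ_cover u v q, z) \<in> L"
    then show "(univ_cover u v (A (A q)), z) \<in> thicken F ` L" by (force simp: thicken_def FA)
  qed
  have "tangle_lift u v (thicken F ` L) = (\<lambda>(q, z). (A (A q), z)) ` tangle_lift u v L"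
  proof (intro equalityI subrelI)
    fix q z assume q: "(q, z) \<in> tangle_lift u v (thicken F ` L)"
    obtain q' where "q = A (A q')" using surjA by (metis surjD)
    then show "(q, z) \<in> (\<lambda>(q, z). (A (A q), z)) ` tangle_lift u v L"
      using q mem by (intro image_eqI[of _ _ "(q', z)"]) (auto simp: tangle_lift_def)
  qed (auto simp: tangle_lift_def mem)
  then show "thicken F ` L \<in> link_resolutions d' \<and>
      tangle_lift u v (thicken F ` L) = (\<lambda>(q, z). (A (A q), z)) ` tangle_lift u v L"
    using L img by blast
qed

text \<open>A Dehn twist is covered by a shear, which is the square of half the shear and therefore preserves
  the orientation.\<close>

lemma dehn_longitude_related:
  assumes uv: "plane_basis u v" and d: "pseudo_motif d" "pseudo_motif d'"
    and same: "same_diagram (push_diagram (\<lambda>(x, y). (x * y, y)) d) d'"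
  shows "isotopy_related (resolution_set u v (diagram_lift u v d)) (resolution_set u v (diagram_lift u v d'))"
proof -
  obtain x y where xy: "linear x" "linear y" "\<And>q. q = x q *\<^sub>R u + y q *\<^sub>R v"
    "\<And>a b. x (a *\<^sub>R u + b *\<^sub>R v) = a" "\<And>a b. y (a *\<^sub>R u + b *\<^sub>R v) = b"
    "\<And>q. univ_cover u v q = (cis (2 * pi * x q), cis (2 * pi * y q))"
    using plane_basis_coords[OF uv] by metis
  have uv1: "x u = 1" "y u = 0" using xy(4)[of 1 0] xy(5)[of 1 0] by auto
  \<comment> \<open>Half of the shear along \<open>u\<close>. The coordinate \<open>y\<close> is
    unchanged by it, so applying it twice replaces the coordinate \<open>x\<close> by
    \<open>x + y\<close>, which covers multiplication of the first circle coordinate by the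
    second.\<close>
  define A where "A q = q + (y q / 2) *\<^sub>R u" for q
  have Axy: "x (A q) = x q + y q / 2" "y (A q) = y q" for q
    by (simp_all add: A_def linear_add[OF xy(1)] linear_add[OF xy(2)] linear_scale[OF xy(1)] linear_scale[OF xy(2)] uv1)
  show ?thesis
  proof (rule dehn_twist_related[OF uv d _ same])
    show "homeomorphism torus torus (\<lambda>(x, y). (x * y, y)) (\<lambda>(x, y). (x * inverse y, y))"
    proof (rule homeomorphismI)
      show "continuous_on torus (\<lambda>(x, y). (x * inverse y, y))" unfolding case_prod_unfold
        by (intro continuous_intros) (auto simp: torus_def)
      have nz: "fst w \<noteq> 0" "snd w \<noteq> 0" if "w \<in> torus" for w :: torus_pt
        using that by (auto simp: torus_def mem_Times_iff)
      show "(case case w of (x, y) \<Rightarrow> (x * inverse y, y) of (x, y) \<Rightarrow> (x * y, y)) = w"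
        "(case case w of (x, y) \<Rightarrow> (x * y, y) of (x, y) \<Rightarrow> (x * inverse y, y)) = w" if "w \<in> torus" for w
        using nz[OF that] by (simp_all add: case_prod_unfold mult.assoc prod_eq_iff)
    qed (auto simp: torus_def norm_mult norm_inverse case_prod_unfold intro!: continuous_intros)
    show "linear A"
      by (rule linearI) (simp_all add: A_def linear_add[OF xy(2)] linear_scale[OF xy(2)] algebra_simps add_divide_distrib)
    show "inj A"
    proof (rule injI)
      fix q q' assume "A q = A q'"
      then have "y q = y q'" "x q = x q'" using Axy by (metis, metis add_right_cancel)
      then show "q = q'" using xy(3) by metis
    qed
    show "(\<lambda>(x, y). (x * y, y)) (univ_cover u v q) = univ_cover u v (A (A q))" for q
      by (simp add: xy(6) Axy cis_mult distrib_left add.commute)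
  qed
qed

lemma dehn_meridian_related:
  assumes uv: "plane_basis u v" and d: "pseudo_motif d" "pseudo_motif d'"
    and same: "same_diagram (push_diagram (\<lambda>(x, y). (x, x * y)) d) d'"
  shows "isotopy_related (resolution_set u v (diagram_lift u v d)) (resolution_set u v (diagram_lift u v d'))"
proof -
  obtain x y where xy: "linear x" "linear y" "\<And>q. q = x q *\<^sub>R u + y q *\<^sub>R v"
    "\<And>a b. x (a *\<^sub>R u + b *\<^sub>R v) = a" "\<And>a b. y (a *\<^sub>R u + b *\<^sub>R v) = b"
    "\<And>q. univ_cover u v q = (cis (2 * pi * x q), cis (2 * pi * y q))"
    using plane_basis_coords[OF uv] by metis
  have uv1: "x v = 0" "y v = 1" using xy(4)[of 0 1] xy(5)[of 0 1] by auto
  define A where "A q = q + (x q / 2) *\<^sub>R v" for q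
  have Axy: "x (A q) = x q" "y (A q) = y q + x q / 2" for q
    by (simp_all add: A_def linear_add[OF xy(1)] linear_add[OF xy(2)] linear_scale[OF xy(1)] linear_scale[OF xy(2)] uv1)
  show ?thesis
  proof (rule dehn_twist_related[OF uv d _ same])
    show "homeomorphism torus torus (\<lambda>(x, y). (x, x * y)) (\<lambda>(x, y). (x, inverse x * y))"
    proof (rule homeomorphismI)
      show "continuous_on torus (\<lambda>(x, y). (x, inverse x * y))" unfolding case_prod_unfold
        by (intro continuous_intros) (auto simp: torus_def)
      have nz: "fst w \<noteq> 0" "snd w \<noteq> 0" if "w \<in> torus" for w :: torus_pt
        using that by (auto simp: torus_def mem_Times_iff)
      show "(case case w of (x, y) \<Rightarrow> (x, inverse x * y) of (x, y) \<Rightarrow> (x, x * y)) = w"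
        "(case case w of (x, y) \<Rightarrow> (x, x * y) of (x, y) \<Rightarrow> (x, inverse x * y)) = w" if "w \<in> torus" for w
        using nz[OF that] by (simp_all add: case_prod_unfold mult.assoc prod_eq_iff)
    qed (auto simp: torus_def norm_mult norm_inverse case_prod_unfold intro!: continuous_intros)
    show "linear A"
      by (rule linearI) (simp_all add: A_def linear_add[OF xy(1)] linear_scale[OF xy(1)] algebra_simps add_divide_distrib)
    show "inj A"
    proof (rule injI)
      fix q q' assume "A q = A q'"
      then have "x q = x q'" "y q = y q'" using Axy by (metis, metis add_right_cancel)
      then show "q = q'" using xy(3) by metis
    qed
    show "(\<lambda>(x, y). (x, x * y)) (univ_cover u v q) = univ_cover u v (A (A q))" for q
      by (simp add: xy(6) Axy cis_mult distrib_left add.commute)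
  qed
qed

section \<open>Pseudo cover equivalence\<close>

text \<open>Both coverings are homeomorphisms on a common small open set of the plane. Through the
  plane, neighbourhoods in the two tori are identified, and the identification carries
  \<open>L\<close> to \<open>L'\<close> because their lifts agree.\<close>

lemma flat_at_change_lattice:
  assumes uv: "plane_basis u v" and uv': "plane_basis u' v'"
    and eq: "tangle_lift u v L = tangle_lift u' v' L'" and w: "w \<in> tangle_lift u v L" "snd w \<in> {0<..<1}"
    and flat: "flat_at (torus \<times> {0<..<1}) L (thick_cover u v w)"
  shows "flat_at (torus \<times> {0<..<1}) L' (thick_cover u' v' w)"
proof -
  let ?X = "torus \<times> {0<..<1::real}"
  let ?\<rho> = "univ_cover u v" and ?\<rho>' = "univ_cover u' v'"
  obtain B1 g where B1: "open B1" "fst w \<in> B1" "openin (top_of_set torus) (?\<rho> ` B1)" "homeomorphism B1 (?\<rho> ` B1) ?\<rho> g"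
    using univ_cover_local_homeomorphism[OF uv] by metis
  obtain B2 g' where B2: "open B2" "fst w \<in> B2" "openin (top_of_set torus) (?\<rho>' ` B2)" "homeomorphism B2 (?\<rho>' ` B2) ?\<rho>' g'"
    using univ_cover_local_homeomorphism[OF uv'] by metis
  define B where "B = B1 \<inter> B2"
  have B: "open B" "fst w \<in> B" "B \<subseteq> B1" "B \<subseteq> B2" using B1 B2 by (auto simp: B_def)
  have open1: "openin (top_of_set torus) (?\<rho> ` B)" 
    using homeomorphism_imp_open_map[OF B1(4), of B] B B1(1,3) by (metis openin_open_eq openin_trans)
  have open2: "openin (top_of_set torus) (?\<rho>' ` B)"
    using homeomorphism_imp_open_map[OF B2(4), of B] B B2(1,3) by (metis openin_open_eq openin_trans)
  have g: "g (?\<rho> q) = q" "g' (?\<rho>' q) = q" if "q \<in> B" for q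
    using that B B1(4) B2(4) by (auto simp: homeomorphism_def)
  have cg: "continuous_on (?\<rho> ` B) g" "continuous_on (?\<rho>' ` B) g'"
    using B B1(4) B2(4) by (auto simp: homeomorphism_def intro: continuous_on_subset)
  let ?V = "?\<rho> ` B \<times> {0<..<1::real}" and ?V' = "?\<rho>' ` B \<times> {0<..<1::real}"
  define \<psi> where "\<psi> y = (?\<rho>' (g (fst y)), snd y)" for y :: "torus_pt \<times> real"
  define \<psi>' where "\<psi>' y = (?\<rho> (g' (fst y)), snd y)" for y :: "torus_pt \<times> real"
  have hom: "homeomorphism ?V ?V' \<psi> \<psi>'"
  proof (rule homeomorphismI)
    have 1: "continuous_on ?V (\<lambda>y. g (fst y))"
      by (rule continuous_on_compose2[OF cg(1)]) (auto intro!: continuous_intros)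
    have 2: "continuous_on ?V' (\<lambda>y. g' (fst y))"
      by (rule continuous_on_compose2[OF cg(2)]) (auto intro!: continuous_intros)
    have "continuous_on ?V (\<lambda>y. ?\<rho>' (g (fst y)))"
      by (rule continuous_on_compose2[OF continuous_on_univ_cover[OF uv', of UNIV] 1]) simp
    then show "continuous_on ?V \<psi>" unfolding \<psi>_def by (intro continuous_intros)
    have "continuous_on ?V' (\<lambda>y. ?\<rho> (g' (fst y)))"
      by (rule continuous_on_compose2[OF continuous_on_univ_cover[OF uv, of UNIV] 2]) simp
    then show "continuous_on ?V' \<psi>'" unfolding \<psi>'_def by (intro continuous_intros)
  qed (auto simp: \<psi>_def \<psi>'_def g)
  have mem: "(?\<rho> q, z) \<in> L \<longleftrightarrow> (?\<rho>' q, z) \<in> L'" for q z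
    using eq by (auto simp: tangle_lift_def set_eq_iff)
  have "flat_at ?X L' (\<psi> (thick_cover u v w))"
  proof (rule flat_at_transfer[OF flat _ _ _ hom])
    show "thick_cover u v w \<in> L" using w by (simp add: mem_tangle_lift)
    show "thick_cover u v w \<in> ?V" using w B by (simp add: thick_cover_def)
    show "openin (top_of_set ?X) ?V" "openin (top_of_set ?X) ?V'"
      using open1 open2 by (auto intro!: openin_Times)
    show "\<psi> ` (L \<inter> ?V) = L' \<inter> ?V'"
    proof (intro equalityI subsetI)
      fix y assume "y \<in> \<psi> ` (L \<inter> ?V)"
      then obtain x where x: "x \<in> L" "x \<in> ?V" "y = \<psi> x" by blast
      then obtain q where q: "q \<in> B" "fst x = ?\<rho> q" "snd x \<in> {0<..<1}" by (auto simp: mem_Times_iff)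
      have "y = (?\<rho>' q, snd x)" using x(3) q g by (simp add: \<psi>_def)
      moreover have "(?\<rho> q, snd x) \<in> L" using x(1) q(2) by (metis prod.collapse)
      ultimately show "y \<in> L' \<inter> ?V'" using mem q by simp
    next
      fix y assume y: "y \<in> L' \<inter> ?V'"
      then obtain q where q: "q \<in> B" "fst y = ?\<rho>' q" "snd y \<in> {0<..<1}" by (auto simp: mem_Times_iff)
      have "(?\<rho> q, snd y) \<in> L" using y q mem by (metis IntE prod.collapse)
      moreover have "y = \<psi> (?\<rho> q, snd y)" using q g by (simp add: \<psi>_def prod_eq_iff)
      ultimately show "y \<in> \<psi> ` (L \<inter> ?V)" using q by blast
    qed
  qed
  then show ?thesis using g B by (simp add: \<psi>_def thick_cover_def)
qed

text \<open>Two strands over one position are partners, and the choice makes their heights differ;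
  so the graph parametrisation is injective.\<close>

lemma diagram_graph_embedded:
  assumes d: "pseudo_motif d" and L: "resolved_by d L"
  shows "\<exists>n k. continuous_on (circles n) k \<and> inj_on k (circles n) \<and> k ` circles n = L" "L \<subseteq> torus \<times> {0<..<1}"
proof -
  obtain Ov h where Ov: "resolution_choice d Ov" and h: "height_function d Ov h" and Lh: "L = diagram_graph d h"
    using L by (auto simp: resolved_by_def resolved_with_def)
  obtain n where n: "params d = circles n" using pseudo_motifD(9)[OF d] by blast
  have "continuous_on (params d) (\<lambda>p. (curve d p, h p))"
    using pseudo_motifD(2)[OF d] h by (intro continuous_intros) (auto simp: height_function_def)
  moreover have "inj_on (\<lambda>p. (curve d p, h p)) (params d)"
  proof (rule inj_onI, rule ccontr)
    fix p q assume pq: "p \<in> params d" "q \<in> params d" "(curve d p, h p) = (curve d q, h q)" "p \<noteq> q"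
    then have part: "partner_strands d p q" "partner_strands d q p" by (auto simp: partner_strands_def)
    then have "h p < h q \<or> h q < h p"
      using resolution_choice_partner[OF Ov part(1)] h unfolding height_function_def by blast
    then show False using pq by auto
  qed
  ultimately show "\<exists>n k. continuous_on (circles n) k \<and> inj_on k (circles n) \<and> k ` circles n = L"
    unfolding Lh diagram_graph_def height_graph_def n by blast
  show "L \<subseteq> torus \<times> {0<..<1}"
    using pseudo_motifD(3)[OF d] h by (auto simp: Lh diagram_graph_def height_graph_def height_function_def)
qed

text \<open>That \<open>L'\<close> consists of embedded circles comes from its diagram; local
  flatness comes from \<open>L\<close>, point by point through the plane.\<close>

lemma thick_torus_link_change_lattice:
  assumes uv: "plane_basis u v" and uv': "plane_basis u' v'"
    and eq: "tangle_lift u v L = tangle_lift u' v' L'" and L: "thick_torus_link L"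
    and d: "pseudo_motif d" and L': "resolved_by d L'"
  shows "thick_torus_link L'"
  unfolding thick_torus_link_iff
proof (intro conjI ballI diagram_graph_embedded[OF d L'])
  fix x assume x: "x \<in> L'"
  then have X: "fst x \<in> torus" "snd x \<in> {0<..<1}" using diagram_graph_embedded(2)[OF d L'] by (auto simp: mem_Times_iff)
  obtain q where q: "univ_cover u' v' q = fst x" using univ_cover_surj[OF uv' X(1)] .
  have w: "(q, snd x) \<in> tangle_lift u v L" unfolding eq using x q by (simp add: tangle_lift_def)
  then have "flat_at (torus \<times> {0<..<1}) L (thick_cover u v (q, snd x))"
    using L by (simp add: thick_torus_link_iff mem_tangle_lift)
  from flat_at_change_lattice[OF uv uv' eq w _ this] X show "flat_at (torus \<times> {0<..<1}) L' x"
    by (simp add: thick_cover_def q)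
qed

text \<open>\<open>L\<close> is the image of the tangle in the quotient by the sublattice. Lifting
  it again adds nothing, since the tangle is invariant under the whole lattice and so under the
  sublattice.\<close>

lemma tangle_lift_sublattice:
  assumes uv: "plane_basis u v" and uv0: "plane_basis u\<^sub>0 v\<^sub>0" and sub: "lattice u v \<subseteq> lattice u\<^sub>0 v\<^sub>0"
  obtains L where "tangle_lift u v L = tangle_lift u\<^sub>0 v\<^sub>0 L\<^sub>0" "L \<subseteq> torus \<times> UNIV"
proof
  let ?L = "thick_cover u v ` tangle_lift u\<^sub>0 v\<^sub>0 L\<^sub>0"
  show "?L \<subseteq> torus \<times> UNIV" by (auto simp: thick_cover_def univ_cover_in_torus)
  show "tangle_lift u v ?L = tangle_lift u\<^sub>0 v\<^sub>0 L\<^sub>0"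
  proof (intro equalityI subsetI)
    fix w assume "w \<in> tangle_lift u v ?L"
    then obtain w' where w': "w' \<in> tangle_lift u\<^sub>0 v\<^sub>0 L\<^sub>0" "thick_cover u v w = thick_cover u v w'"
      by (auto simp: mem_tangle_lift)
    then have "fst w - fst w' \<in> lattice u\<^sub>0 v\<^sub>0" "snd w = snd w'"
      using lattice_iff[OF uv, of "fst w" "fst w'"] sub by (auto simp: thick_cover_def)
    then have "thick_cover u\<^sub>0 v\<^sub>0 w = thick_cover u\<^sub>0 v\<^sub>0 w'"
      using lattice_iff[OF uv0, of "fst w" "fst w'"] by (simp add: thick_cover_def)
    then show "w \<in> tangle_lift u\<^sub>0 v\<^sub>0 L\<^sub>0" using w' by (simp add: mem_tangle_lift)
  next
    fix w assume "w \<in> tangle_lift u\<^sub>0 v\<^sub>0 L\<^sub>0"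
    then show "w \<in> tangle_lift u v ?L" by (auto simp: mem_tangle_lift[of w u v])
  qed
qed

lemma diagram_lift_marking:
  "over (diagram_lift u v d) \<subseteq> params (diagram_lift u v d)"
  "homol (diagram_lift u v d) \<subseteq> params (diagram_lift u v d) \<times> params (diagram_lift u v d)"
  by (auto simp: diagram_lift_def Let_def)

text \<open>A tangle over the coarser lattice need not be periodic under the finer one. Its resolution choice
  is, however, so the heights may be exchanged for periodic ones.\<close>

lemma cover_related:
  assumes uv: "plane_basis u v" and uv0: "plane_basis u\<^sub>0 v\<^sub>0" and sub: "lattice u v \<subseteq> lattice u\<^sub>0 v\<^sub>0"
    and d: "pseudo_motif d" and d0: "pseudo_motif d\<^sub>0"
    and same: "same_diagram (diagram_lift u v d) (diagram_lift u\<^sub>0 v\<^sub>0 d\<^sub>0)"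
  shows "isotopy_related (resolution_set u v (diagram_lift u v d)) (resolution_set u\<^sub>0 v\<^sub>0 (diagram_lift u\<^sub>0 v\<^sub>0 d\<^sub>0))"
proof -
  let ?D = "diagram_lift u v d" and ?E = "diagram_lift u\<^sub>0 v\<^sub>0 d\<^sub>0"
  obtain b g where b: "diagram_iso b g ?D ?E" using same by (auto simp: same_diagram_iso)
  have b': "diagram_iso g b ?E ?D" by (rule diagram_iso_sym[OF b diagram_lift_marking])
  have gb: "g ` b ` Ov = Ov" if "Ov \<subseteq> params ?D" for Ov
  proof -
    have "g (b p) = p" if "p \<in> Ov" for p
      using that \<open>Ov \<subseteq> params ?D\<close> b by (auto simp: diagram_iso_def homeomorphism_def)
    then show ?thesis by (simp add: image_image)
  qed
  have thick_sub: "L \<subseteq> torus \<times> UNIV" if "thick_torus_link L" for L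
    using that by (auto simp: thick_torus_link_def)
  \<comment> \<open>The easy direction: a tangle periodic under the larger lattice is periodic under
    the sublattice.\<close>
  have descend: "t0 \<in> resolution_set u v ?D" if t0: "t0 \<in> resolution_set u\<^sub>0 v\<^sub>0 ?E" for t0
  proof -
    obtain L0 where L0: "thick_torus_link L0" "resolved_by d\<^sub>0 L0" "t0 = tangle_lift u\<^sub>0 v\<^sub>0 L0"
      using t0 by (auto simp: resolution_set_lift[OF uv0 d0] link_resolutions_def)
    obtain L where L: "tangle_lift u v L = tangle_lift u\<^sub>0 v\<^sub>0 L0" "L \<subseteq> torus \<times> UNIV"
      using tangle_lift_sublattice[OF uv uv0 sub] .
    have "resolved_by ?E t0" using L0 resolved_by_lift[OF uv0 d0 thick_sub] by simp
    then have "resolved_by ?D (tangle_lift u v L)"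
      using same_diagram_resolved[OF same diagram_lift_marking diagram_lift_marking(2)] L L0 by simp
    then have res: "resolved_by d L" using resolved_by_lift[OF uv d L(2)] by simp
    then have "thick_torus_link L"
      using thick_torus_link_change_lattice[OF uv0 uv L(1)[symmetric] L0(1) d] by blast
    then show ?thesis using res L L0 by (auto simp: resolution_set_lift[OF uv d] link_resolutions_def)
  qed
  show ?thesis
    unfolding isotopy_related_def
  proof (intro conjI ballI)
    fix t0 assume "t0 \<in> resolution_set u\<^sub>0 v\<^sub>0 ?E"
    then show "\<exists>t\<in>resolution_set u v ?D. DP_isotopic t0 t" using descend DP_isotopic_refl by blast
  next
    fix t assume "t \<in> resolution_set u v ?D"
    then obtain L where L: "thick_torus_link L" "resolved_by d L" "t = tangle_lift u v L"
      by (auto simp: resolution_set_lift[OF uv d] link_resolutions_def)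
    obtain Ov h where Ov: "resolution_choice d Ov" and h: "height_function d Ov h" "L = diagram_graph d h"
      using L by (auto simp: resolved_by_def resolved_with_def)
    have "resolved_with ?D (lift_strands u v d Ov) t"
      unfolding L(3) resolved_with_lift[OF uv d thick_sub[OF L(1)]] using Ov h by (auto simp: resolved_with_def)
    \<comment> \<open>The choice is carried to the other lift, where it must respect the marking of
      that lift; it then descends to \<open>d\<^sub>0\<close>. This is where the agreement of the
      two markings enters.\<close>
    from diagram_iso_resolved[OF b diagram_lift_marking(2) this]
    have "resolution_choice ?E (b ` lift_strands u v d Ov)" by (simp add: resolved_with_def)
    then obtain O0 where O0: "resolution_choice d\<^sub>0 O0" "b ` lift_strands u v d Ov = lift_strands u\<^sub>0 v\<^sub>0 d\<^sub>0 O0"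
      using resolution_choice_lift[OF uv0 d0] by blast
    obtain h0 where h0: "height_function d\<^sub>0 O0 h0"
      using height_function_exists[OF pseudo_motifD(1,4)[OF d0] O0(1), of "{}"] by auto
    define L0 where "L0 = diagram_graph d\<^sub>0 h0"
    have res0: "resolved_with d\<^sub>0 O0 L0" using O0 h0 by (auto simp: resolved_with_def L0_def)
    obtain L1 where L1: "tangle_lift u v L1 = tangle_lift u\<^sub>0 v\<^sub>0 L0" "L1 \<subseteq> torus \<times> UNIV"
      using tangle_lift_sublattice[OF uv uv0 sub] .
    have "resolved_with ?E (lift_strands u\<^sub>0 v\<^sub>0 d\<^sub>0 O0) (tangle_lift u\<^sub>0 v\<^sub>0 L0)"
      using resolved_with_lift[OF uv0 d0, of L0] diagram_graph_torus[OF d0] res0 by (auto simp: L0_def)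
    from diagram_iso_resolved[OF b' diagram_lift_marking(2) this]
    have "resolved_with ?D (lift_strands u v d Ov) (tangle_lift u v L1)"
      using gb[of "lift_strands u v d Ov"] unfolding O0(2)[symmetric] L1(1)[symmetric] by (simp add: lift_strands_def)
    then obtain O1 where O1: "lift_strands u v d Ov = lift_strands u v d O1" "resolved_with d O1 L1"
      using resolved_with_lift[OF uv d L1(2)] by blast
    \<comment> \<open>\<open>L1\<close> has the same upper strands as \<open>L\<close>, so the two
      links differ only in their heights.\<close>
    then have "O1 = Ov" using lift_strands_eqD[OF uv d _ Ov] by (auto simp: resolved_with_def)
    then obtain h1 where h1: "height_function d Ov h1" "L1 = diagram_graph d h1"
      using O1 by (auto simp: resolved_with_def)
    have iso: "torus_isotopic L L1"
      unfolding h(2) h1(2) by (rule height_function_isotopic[OF d Ov h(1) h1(1)])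
    then have "thick_torus_link L1" by (rule torus_isotopic_thick[OF L(1)])
    \<comment> \<open>Flatness travels from \<open>L\<close> to \<open>L1\<close> by the vertical
      isotopy and from \<open>L1\<close> to \<open>L0\<close> through the plane.\<close>
    then have "thick_torus_link L0"
      using thick_torus_link_change_lattice[OF uv uv0 L1(1) _ d0] res0 by (auto simp: resolved_by_def)
    then have "tangle_lift u\<^sub>0 v\<^sub>0 L0 \<in> resolution_set u\<^sub>0 v\<^sub>0 ?E"
      using res0 by (auto simp: resolution_set_lift[OF uv0 d0] link_resolutions_def resolved_by_def)
    moreover have "DP_isotopic t (tangle_lift u\<^sub>0 v\<^sub>0 L0)"
      using torus_isotopic_DP_isotopic[OF uv L(1) iso] L(3) L1(1) by simp
    ultimately show "\<exists>t'\<in>resolution_set u\<^sub>0 v\<^sub>0 ?E. DP_isotopic t t'" by blast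
  qed
qed

section \<open>Diagrams containing a local picture\<close>

lemma torus_isotopic_chain_sub:
  assumes "torus_isotopic\<^sup>*\<^sup>* L L'" "L \<subseteq> torus \<times> {0..1}"
  shows "L' \<subseteq> torus \<times> {0..1} \<and> torus_isotopic\<^sup>*\<^sup>* L' L"
  using assms(1)
proof (induction rule: rtranclp_induct)
  case base
  show ?case using assms(2) by simp
next
  case (step L1 L2)
  obtain H where H: "bij_betw (H (1::real)) (torus \<times> {0..1}) (torus \<times> {0..1::real})" "H 1 ` L1 = L2"
    using step(2) unfolding torus_isotopic_def by (metis atLeastAtMost_iff order_refl zero_le_one)
  have "L2 \<subseteq> H 1 ` (torus \<times> {0..1})" using H(2) step.IH by blast
  then have "L2 \<subseteq> torus \<times> {0..1}" using H(1) by (simp add: bij_betw_def)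
  moreover have "torus_isotopic L2 L1" using torus_isotopic_sym[OF step(2)] step.IH by blast
  ultimately show ?case using step.IH by (meson converse_rtranclp_into_rtranclp)
qed

lemma torus_isotopic_chain_thick:
  "torus_isotopic\<^sup>*\<^sup>* L L' \<Longrightarrow> thick_torus_link L \<Longrightarrow> thick_torus_link L'"
  by (induction rule: rtranclp_induct) (auto intro: torus_isotopic_thick)

text \<open>One pair of height functions suffices, because all height functions of one choice give
  isotopic graphs; they can be selected to suit the move.\<close>

definition choices_matched :: "motif \<Rightarrow> (nat \<times> complex) set \<Rightarrow> motif \<Rightarrow> (nat \<times> complex) set \<Rightarrow> bool" where
  "choices_matched d Ov d' Ov' \<longleftrightarrow> resolution_choice d' Ov' \<and>
     (\<exists>h h'. height_function d Ov h \<and> height_function d' Ov' h' \<and>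
       torus_isotopic\<^sup>*\<^sup>* (diagram_graph d h) (diagram_graph d' h'))"

lemma diagram_graph_subset:
  assumes "pseudo_motif d" "height_function d Ov h"
  shows "diagram_graph d h \<subseteq> torus \<times> {0..1}"
  using pseudo_motifD(3)[OF assms(1)] assms(2)
  unfolding diagram_graph_def height_graph_def height_function_def
  by (intro image_subsetI) (simp add: image_subset_iff less_imp_le)

lemma choices_matched_sym:
  assumes "choices_matched d Ov d' Ov'" "pseudo_motif d" "resolution_choice d Ov"
  shows "choices_matched d' Ov' d Ov"
  using assms torus_isotopic_chain_sub[OF _ diagram_graph_subset[OF assms(2)]]
  unfolding choices_matched_def by blast

text \<open>The given resolution has arbitrary heights, so a vertical isotopy to the convenient ones
  is put in front of the chain. The graph at the end is a link because flatness is transported along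
  the chain.\<close>

lemma choices_matched_link_resolution:
  assumes d: "pseudo_motif d"
    and ex: "\<And>Ov. resolution_choice d Ov \<Longrightarrow> \<exists>Ov'. choices_matched d Ov d' Ov'" and L: "L \<in> link_resolutions d"
  shows "\<exists>L'\<in>link_resolutions d'. torus_isotopic\<^sup>*\<^sup>* L L'"
proof -
  obtain Ov h0 where Ov: "resolution_choice d Ov" and h0: "height_function d Ov h0" and Lh: "L = diagram_graph d h0"
    and thick: "thick_torus_link L"
    using L by (auto simp: link_resolutions_def resolved_by_def resolved_with_def)
  obtain Ov' h h' where m: "resolution_choice d' Ov'" "height_function d Ov h" "height_function d' Ov' h'"
    "torus_isotopic\<^sup>*\<^sup>* (diagram_graph d h) (diagram_graph d' h')"
    using ex[OF Ov] unfolding choices_matched_def by blast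
  have chain: "torus_isotopic\<^sup>*\<^sup>* L (diagram_graph d' h')"
    using height_function_isotopic[OF d Ov h0 m(2)] m(4) unfolding Lh by (rule converse_rtranclp_into_rtranclp)
  moreover have "diagram_graph d' h' \<in> link_resolutions d'"
    using torus_isotopic_chain_thick[OF chain thick] m(1,3)
    unfolding link_resolutions_def resolved_by_def resolved_with_def by blast
  ultimately show ?thesis by blast
qed

lemma motif_relatedI:
  assumes "pseudo_motif d" "pseudo_motif d'"
    and "\<And>Ov. resolution_choice d Ov \<Longrightarrow> \<exists>Ov'. choices_matched d Ov d' Ov'"
    and "\<And>Ov'. resolution_choice d' Ov' \<Longrightarrow> \<exists>Ov. choices_matched d' Ov' d Ov"
  shows "motif_related d d'"
  unfolding motif_related_def
  using choices_matched_link_resolution[OF assms(1,3)] choices_matched_link_resolution[OF assms(2,4)] by blast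

section \<open>A motif seen through the chart of a local move\<close>

definition strands_of :: "nat \<Rightarrow> (nat \<Rightarrow> real \<Rightarrow> nat \<times> complex) \<Rightarrow> (nat \<times> complex) set" where
  "strands_of k e = (\<lambda>(j, t). e j t) ` ({..<k} \<times> {-1..1})"

text \<open>One side of a local move. By \<open>inside\<close> no foreign strand enters the chart,
  so partners of strands in the picture belong to the picture, and its crossings can be computed
  from the arcs \<open>a\<close>.\<close>

locale picture =
  fixes d :: motif and k :: nat and a :: arcs and Ov :: "local_strand set"
    and \<phi> :: "real \<times> real \<Rightarrow> torus_pt" and e :: "nat \<Rightarrow> real \<Rightarrow> nat \<times> complex"
  assumes motif: "pseudo_motif d"
    and chart: "continuous_on square \<phi>" "inj_on \<phi> square" "\<phi> ` square \<subseteq> torus"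
    and arcs_cont: "\<And>j. j < k \<Longrightarrow> continuous_on {-1..1} (e j)"
    and arcs_inj: "inj_on (\<lambda>(j, t). e j t) ({..<k} \<times> {-1..1})"
    and inside: "{p \<in> params d. curve d p \<in> \<phi> ` square} = strands_of k e"
    and in_square: "\<And>j t. j < k \<Longrightarrow> t \<in> {-1..1} \<Longrightarrow> a j t \<in> square"
    and curve_e: "\<And>j t. j < k \<Longrightarrow> t \<in> {-1..1} \<Longrightarrow> curve d (e j t) = \<phi> (a j t)"
    and over_e: "\<And>j t. j < k \<Longrightarrow> t \<in> {-1..1} \<Longrightarrow> e j t \<in> over d \<longleftrightarrow> (j, t) \<in> Ov"
begin

abbreviation "J \<equiv> strands_of k e"

lemma e_in: "j < k \<Longrightarrow> t \<in> {-1..1} \<Longrightarrow> e j t \<in> J"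
  unfolding strands_of_def by (rule image_eqI[of _ _ "(j, t)"]) auto

lemma e_eq_iff:
  assumes "j < k" "t \<in> {-1..1}" "i < k" "s \<in> {-1..1}"
  shows "e j t = e i s \<longleftrightarrow> j = i \<and> t = s"
  using inj_onD[OF arcs_inj, of "(j, t)" "(i, s)"] assms by auto

lemma J_E:
  assumes "p \<in> J"
  obtains j t where "j < k" "t \<in> {-1..1}" "p = e j t"
  using assms unfolding strands_of_def by auto

lemma J_params: "J \<subseteq> params d"
  unfolding inside[symmetric] by blast

lemma J_iff: "p \<in> params d \<Longrightarrow> p \<in> J \<longleftrightarrow> curve d p \<in> \<phi> ` square"
  unfolding inside[symmetric] by blast

lemma partner_J: "partner_strands d p q \<Longrightarrow> p \<in> J \<longleftrightarrow> q \<in> J"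
  using J_iff[of p] J_iff[of q] by (simp add: partner_strands_def)

lemma partner_e:
  assumes "j < k" "t \<in> {-1..1}" "i < k" "s \<in> {-1..1}"
  shows "partner_strands d (e j t) (e i s) \<longleftrightarrow> (j, t) \<noteq> (i, s) \<and> a j t = a i s"
  using assms e_in J_params e_eq_iff[OF assms] curve_e in_square inj_onD[OF chart(2), of "a j t" "a i s"]
  by (auto simp: partner_strands_def)

lemma partner_e_E:
  assumes "j < k" "t \<in> {-1..1}" "partner_strands d (e j t) q"
  obtains i s where "i < k" "s \<in> {-1..1}" "q = e i s" "(j, t) \<noteq> (i, s)" "a j t = a i s"
proof -
  have "q \<in> J" using partner_J[OF assms(3)] e_in[OF assms(1,2)] by simp
  then obtain i s where "i < k" "s \<in> {-1..1}" "q = e i s" by (rule J_E)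
  then show thesis using that partner_e[OF assms(1,2), of i s] assms(3) by blast
qed

lemma pre_e:
  assumes "j < k" "t \<in> {-1..1}"
  shows "e j t \<in> pre_strands d \<longleftrightarrow>
    (j, t) \<notin> Ov \<and> (\<exists>i<k. \<exists>s\<in>{-1..1}. (j, t) \<noteq> (i, s) \<and> a j t = a i s \<and> (i, s) \<notin> Ov)"
proof -
  have "(\<exists>q. partner_strands d (e j t) q \<and> q \<notin> over d) \<longleftrightarrow>
    (\<exists>i<k. \<exists>s\<in>{-1..1}. (j, t) \<noteq> (i, s) \<and> a j t = a i s \<and> (i, s) \<notin> Ov)"
  proof
    assume "\<exists>q. partner_strands d (e j t) q \<and> q \<notin> over d"
    then obtain q where q: "partner_strands d (e j t) q" "q \<notin> over d" by blast
    obtain i s where "i < k" "s \<in> {-1..1}" "q = e i s" "(j, t) \<noteq> (i, s)" "a j t = a i s"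
      using partner_e_E[OF assms q(1)] .
    then show "\<exists>i<k. \<exists>s\<in>{-1..1}. (j, t) \<noteq> (i, s) \<and> a j t = a i s \<and> (i, s) \<notin> Ov"
      using q(2) over_e by blast
  next
    assume "\<exists>i<k. \<exists>s\<in>{-1..1}. (j, t) \<noteq> (i, s) \<and> a j t = a i s \<and> (i, s) \<notin> Ov"
    then show "\<exists>q. partner_strands d (e j t) q \<and> q \<notin> over d"
      using partner_e[OF assms] over_e by blast
  qed
  then show ?thesis unfolding pre_strands_def using over_e[OF assms] by simp
qed

definition loc :: "nat \<times> complex \<Rightarrow> nat \<times> real" where
  "loc = inv_into ({..<k} \<times> {-1..1}) (\<lambda>(j, t). e j t)"

lemma loc_e: "j < k \<Longrightarrow> t \<in> {-1..1} \<Longrightarrow> loc (e j t) = (j, t)"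
  unfolding loc_def using inv_into_f_f[OF arcs_inj, of "(j, t)"] by simp

lemma J_Union: "J = (\<Union>j\<in>{..<k}. e j ` {-1..1})"
  using e_in by (auto elim!: J_E)

lemma compact_arc: "j < k \<Longrightarrow> compact (e j ` {-1..1})"
  by (intro compact_continuous_image arcs_cont) auto

lemma compact_J: "compact J"
  unfolding J_Union by (intro compact_UN compact_arc) auto

text \<open>The picture is a finite union of closed arcs, on each of which the inverse of the
  parametrisation is continuous.\<close>

lemma continuous_on_loc:
  assumes "\<And>j. j < k \<Longrightarrow> continuous_on {-1..1} (\<gamma> j)"
  shows "continuous_on J (\<lambda>p. \<gamma> (fst (loc p)) (snd (loc p)))"
  unfolding J_Union
proof (rule continuous_on_closed_Union)
  fix j assume j: "j \<in> {..<k}"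
  then show "closed (e j ` {-1..1})" using compact_arc compact_imp_closed by blast
  have "continuous_on (e j ` {-1..1}) (\<lambda>p. snd (loc p))"
    by (rule continuous_on_inv[OF arcs_cont]) (use j loc_e in auto)
  then have "continuous_on (e j ` {-1..1}) (\<lambda>p. \<gamma> j (snd (loc p)))"
    by (rule continuous_on_compose2[OF assms, rotated]) (use j loc_e in auto)
  then show "continuous_on (e j ` {-1..1}) (\<lambda>p. \<gamma> (fst (loc p)) (snd (loc p)))"
    by (rule continuous_on_eq) (use j loc_e in auto)
qed simp

lemma heights_exist:
  assumes R: "resolution_choice d R" and \<gamma>: "\<And>j. j < k \<Longrightarrow> continuous_on {-1..1} (\<gamma> j)"
    "\<And>j t. j < k \<Longrightarrow> t \<in> {-1..1} \<Longrightarrow> 0 < \<gamma> j t \<and> \<gamma> j t < (1::real)"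
    and ord: "\<And>j t i s. \<lbrakk>j < k; t \<in> {-1..1}; i < k; s \<in> {-1..1}; (j, t) \<noteq> (i, s); a j t = a i s; e j t \<in> R; e i s \<notin> R\<rbrakk>
      \<Longrightarrow> \<gamma> i s < \<gamma> j t"
  shows "\<exists>h. height_function d R h \<and> (\<forall>j<k. \<forall>t\<in>{-1..1}. h (e j t) = \<gamma> j t)"
proof -
  have "\<exists>h. height_function d R h \<and> (\<forall>p\<in>J. h p = \<gamma> (fst (loc p)) (snd (loc p)))"
  proof (rule height_function_exists[OF pseudo_motifD(1,4)[OF motif] R compact_J J_params continuous_on_loc])
    fix p assume "p \<in> J"
    then obtain j t where "j < k" "t \<in> {-1..1}" "p = e j t" by (rule J_E)
    then show "0 < \<gamma> (fst (loc p)) (snd (loc p)) \<and> \<gamma> (fst (loc p)) (snd (loc p)) < 1" using \<gamma>(2) loc_e by simp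
  next
    fix p q assume pq: "p \<in> J" "q \<in> J" "partner_strands d p q" "p \<in> R" "q \<notin> R"
    obtain j t where j: "j < k" "t \<in> {-1..1}" "p = e j t" using pq(1) by (rule J_E)
    obtain i s where i: "i < k" "s \<in> {-1..1}" "q = e i s" "(j, t) \<noteq> (i, s)" "a j t = a i s"
      using partner_e_E[OF j(1,2)] pq(3) j(3) by blast
    show "\<gamma> (fst (loc q)) (snd (loc q)) < \<gamma> (fst (loc p)) (snd (loc p))"
      using ord[OF j(1,2) i(1,2,4,5)] pq j i loc_e by simp
  qed (use \<gamma>(1) partner_J in auto)
  then obtain h where "height_function d R h" "\<forall>p\<in>J. h p = \<gamma> (fst (loc p)) (snd (loc p))" by blast
  then show ?thesis using loc_e e_in by (intro exI[of _ h]) simp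
qed

text \<open>Intermediate pictures of an isotopy need not be regular diagrams, so they are treated as
  mere curves over the parameters of \<open>d\<close>.\<close>

definition pcurve :: "arcs \<Rightarrow> nat \<times> complex \<Rightarrow> torus_pt" where
  "pcurve b p = (if p \<in> J then \<phi> (b (fst (loc p)) (snd (loc p))) else curve d p)"

lemma pcurve_e: "j < k \<Longrightarrow> t \<in> {-1..1} \<Longrightarrow> pcurve b (e j t) = \<phi> (b j t)"
  by (simp add: pcurve_def e_in loc_e)

lemma pcurve_self: "p \<in> params d \<Longrightarrow> pcurve a p = curve d p"
  by (cases "p \<in> J") (auto simp: pcurve_def elim!: J_E simp: loc_e curve_e)

definition arc_heights :: "(nat \<Rightarrow> real \<Rightarrow> real) \<Rightarrow> (nat \<times> complex \<Rightarrow> real) \<Rightarrow> bool" where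
  "arc_heights \<gamma> h \<longleftrightarrow> continuous_on (params d) h \<and> (\<forall>p\<in>params d. 0 < h p \<and> h p < 1) \<and>
     (\<forall>j<k. \<forall>t\<in>{-1..1}. h (e j t) = \<gamma> j t)"

lemma pcurve_torus:
  assumes "\<And>j t. j < k \<Longrightarrow> t \<in> {-1..1} \<Longrightarrow> b j t \<in> square"
  shows "pcurve b ` params d \<subseteq> torus"
proof (rule image_subsetI)
  fix p assume p: "p \<in> params d"
  show "pcurve b p \<in> torus"
  proof (cases "p \<in> J")
    case True
    then obtain j t where "j < k" "t \<in> {-1..1}" "p = e j t" by (rule J_E)
    then show ?thesis using assms chart(3) by (auto simp: pcurve_e)
  next
    case False
    then show ?thesis using p pseudo_motifD(3)[OF motif] by (auto simp: pcurve_def)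
  qed
qed

lemma slide_first:
  assumes D: "continuous_on ({-1..1} \<times> {0..1}) (\<lambda>(y, z). D y z)" "\<And>y z. \<bar>y\<bar> = 1 \<Longrightarrow> z \<in> {0..1} \<Longrightarrow> D y z = 0"
    and b: "\<And>j t. j < k \<Longrightarrow> t \<in> {-1..1} \<Longrightarrow> b j t \<in> square"
    and h: "arc_heights \<gamma> h"
    and b': "\<And>j t. j < k \<Longrightarrow> t \<in> {-1..1} \<Longrightarrow> b' j t = (slide (D (snd (b j t)) (\<gamma> j t)) (fst (b j t)), snd (b j t))"
  shows "torus_isotopic (height_graph (params d) (pcurve b) h) (height_graph (params d) (pcurve b') h) \<and>
    (continuous_on (params d) (pcurve b) \<longrightarrow> continuous_on (params d) h \<longrightarrow> continuous_on (params d) (pcurve b'))"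
proof (rule slide_isotopic[OF chart D pcurve_torus])
  fix p assume p: "p \<in> params d"
  show "pcurve b p \<notin> \<phi> ` square \<and> pcurve b' p = pcurve b p \<or>
    (\<exists>x y. (x, y) \<in> square \<and> pcurve b p = \<phi> (x, y) \<and> pcurve b' p = \<phi> (slide (D y (h p)) x, y))"
  proof (cases "p \<in> J")
    case True
    then obtain j t where j: "j < k" "t \<in> {-1..1}" "p = e j t" by (rule J_E)
    have "h p = \<gamma> j t" using h j by (simp add: arc_heights_def)
    then show ?thesis
      using b[OF j(1,2)] b'[OF j(1,2)] j
      by (intro disjI2 exI[of _ "fst (b j t)"] exI[of _ "snd (b j t)"]) (simp add: pcurve_e)
  next
    case False
    then show ?thesis using J_iff[OF p] by (simp add: pcurve_def)
  qed
qed (use h b in \<open>auto simp: arc_heights_def\<close>)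

text \<open>Exchanging the coordinates of the chart turns a slide of the second coordinate into one
  of the first.\<close>

lemma slide_second:
  assumes D: "continuous_on ({-1..1} \<times> {0..1}) (\<lambda>(x, z). D x z)" "\<And>x z. \<bar>x\<bar> = 1 \<Longrightarrow> z \<in> {0..1} \<Longrightarrow> D x z = 0"
    and b: "\<And>j t. j < k \<Longrightarrow> t \<in> {-1..1} \<Longrightarrow> b j t \<in> square"
    and h: "arc_heights \<gamma> h"
    and b': "\<And>j t. j < k \<Longrightarrow> t \<in> {-1..1} \<Longrightarrow> b' j t = (fst (b j t), slide (D (fst (b j t)) (\<gamma> j t)) (snd (b j t)))"
  shows "torus_isotopic (height_graph (params d) (pcurve b) h) (height_graph (params d) (pcurve b') h) \<and>
    (continuous_on (params d) (pcurve b) \<longrightarrow> continuous_on (params d) h \<longrightarrow> continuous_on (params d) (pcurve b'))"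
proof -
  have sw: "prod.swap ` square = square" by (auto simp: square_def)
  have chart': "continuous_on square (\<phi> \<circ> prod.swap)" "inj_on (\<phi> \<circ> prod.swap) square" "(\<phi> \<circ> prod.swap) ` square \<subseteq> torus"
  proof -
    have "continuous_on square (prod.swap :: real \<times> real \<Rightarrow> _)"
      unfolding prod.swap_def by (intro continuous_intros)
    then show "continuous_on square (\<phi> \<circ> prod.swap)" by (rule continuous_on_compose) (simp add: sw chart(1))
    show "inj_on (\<phi> \<circ> prod.swap) square" by (rule comp_inj_on) (simp_all add: sw chart(2))
    show "(\<phi> \<circ> prod.swap) ` square \<subseteq> torus" unfolding image_comp[symmetric] sw by (rule chart(3))
  qed
  show ?thesis
  proof (rule slide_isotopic[OF chart' D pcurve_torus])
    fix p assume p: "p \<in> params d"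
    show "pcurve b p \<notin> (\<phi> \<circ> prod.swap) ` square \<and> pcurve b' p = pcurve b p \<or>
      (\<exists>x y. (x, y) \<in> square \<and> pcurve b p = (\<phi> \<circ> prod.swap) (x, y) \<and> pcurve b' p = (\<phi> \<circ> prod.swap) (slide (D y (h p)) x, y))"
    proof (cases "p \<in> J")
      case True
      then obtain j t where j: "j < k" "t \<in> {-1..1}" "p = e j t" by (rule J_E)
      have "h p = \<gamma> j t" using h j by (simp add: arc_heights_def)
      moreover have "(snd (b j t), fst (b j t)) \<in> square" using b[OF j(1,2)] by (auto simp: square_def mem_Times_iff)
      ultimately show ?thesis
        using b'[OF j(1,2)] j
        by (intro disjI2 exI[of _ "snd (b j t)"] exI[of _ "fst (b j t)"]) (simp add: pcurve_e)
    next
      case False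
      have "(\<phi> \<circ> prod.swap) ` square = \<phi> ` square" unfolding image_comp[symmetric] sw ..
      then show ?thesis using J_iff[OF p] False by (simp add: pcurve_def)
    qed
  qed (use h b in \<open>auto simp: arc_heights_def\<close>)
qed

end

definition agree_outside :: "motif \<Rightarrow> motif \<Rightarrow> (nat \<times> complex) set \<Rightarrow> bool" where
  "agree_outside d d' J \<longleftrightarrow> params d' = params d \<and>
     (\<forall>p\<in>params d - J. curve d' p = curve d p \<and> (p \<in> over d' \<longleftrightarrow> p \<in> over d))"

text \<open>Both motifs of a move share the chart and the parametrised arcs. The formulation is
  symmetric, so each result can be reused for the inverse move.\<close>

locale picture_pair = P: picture d k a Ov \<phi> e + P': picture d' k a' Ov' \<phi> e
  for d d' k a Ov a' Ov' \<phi> e +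
  assumes agree: "agree_outside d d' (strands_of k e)"
begin

lemma pair_sym: "picture_pair d' d k a' Ov' a Ov \<phi> e"
  by unfold_locales (use agree in \<open>auto simp: agree_outside_def\<close>)

abbreviation "J \<equiv> strands_of k e"

lemma params_eq: "params d' = params d" using agree by (simp add: agree_outside_def)

lemma partner_outside:
  assumes "p \<notin> J"
  shows "partner_strands d' p q \<longleftrightarrow> partner_strands d p q"
proof -
  have "partner_strands d' p q \<Longrightarrow> q \<notin> J" "partner_strands d p q \<Longrightarrow> q \<notin> J"
    using P.partner_J P'.partner_J assms by blast+
  then show ?thesis using assms agree unfolding agree_outside_def partner_strands_def by auto
qed

lemma over_outside: "p \<in> params d \<Longrightarrow> p \<notin> J \<Longrightarrow> p \<in> over d' \<longleftrightarrow> p \<in> over d"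
  using agree by (simp add: agree_outside_def)

lemma pre_outside:
  assumes "p \<notin> J"
  shows "p \<in> pre_strands d' \<longleftrightarrow> p \<in> pre_strands d"
proof -
  have "q \<notin> J \<and> q \<in> params d \<and> p \<in> params d" if "partner_strands d p q" for q
    using P.partner_J[OF that] assms partner_strands_params[OF that] by blast
  then show ?thesis
    unfolding pre_strands_def using partner_outside[OF assms] over_outside assms by blast
qed

lemma pcurve_other: "p \<in> params d \<Longrightarrow> P.pcurve a' p = curve d' p"
proof (cases "p \<in> J")
  case True
  then obtain j t where "j < k" "t \<in> {-1..1}" "p = e j t" by (rule P.J_E)
  then show ?thesis by (simp add: P.pcurve_e P'.curve_e)
qed (use agree in \<open>simp add: P.pcurve_def agree_outside_def\<close>)

lemma graph_d: "height_graph (params d) (P.pcurve a) h = diagram_graph d h"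
  unfolding diagram_graph_def height_graph_def by (rule image_cong) (simp_all add: P.pcurve_self)

lemma graph_d': "height_graph (params d) (P.pcurve a') h = diagram_graph d' h"
  unfolding diagram_graph_def height_graph_def params_eq by (rule image_cong) (simp_all add: pcurve_other)

lemma height_function_outside:
  assumes R: "resolution_choice d R" and R': "resolution_choice d' R'" "R' - J = R - J" and h: "height_function d R h"
    and \<gamma>: "\<And>j t. j < k \<Longrightarrow> t \<in> {-1..1} \<Longrightarrow> h (e j t) = \<gamma> j t"
    and ord': "\<And>j t i s. \<lbrakk>j < k; t \<in> {-1..1}; i < k; s \<in> {-1..1}; (j, t) \<noteq> (i, s); a' j t = a' i s; e j t \<in> R'; e i s \<notin> R'\<rbrakk>
      \<Longrightarrow> \<gamma> i s < \<gamma> j t"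
  shows "height_function d' R' h"
  unfolding height_function_def
proof (intro conjI allI impI)
  show "continuous_on (params d') h" "\<forall>p\<in>params d'. 0 < h p \<and> h p < 1"
    using h by (auto simp: height_function_def params_eq)
  fix p q assume pq: "partner_strands d' p q \<and> p \<in> R' \<and> q \<notin> R'"
  show "h q < h p"
  proof (cases "p \<in> J")
    case True
    then obtain j t where j: "j < k" "t \<in> {-1..1}" "p = e j t" by (rule P.J_E)
    obtain i s where i: "i < k" "s \<in> {-1..1}" "q = e i s" "(j, t) \<noteq> (i, s)" "a' j t = a' i s"
      using P'.partner_e_E[OF j(1,2), of q] pq j(3) by blast
    show ?thesis using ord'[OF j(1,2) i(1,2,4,5)] pq i j \<gamma> by simp
  next
    case False
    then have "partner_strands d p q" "q \<notin> J" using pq partner_outside P'.partner_J by blast+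
    moreover have "p \<in> R" "q \<notin> R" using R'(2) pq False \<open>q \<notin> J\<close> by blast+
    ultimately show ?thesis using h unfolding height_function_def by blast
  qed
qed

text \<open>A single height function serves both diagrams: outside the picture the crossings agree,
  and inside it the prescribed arc heights only have to respect the crossings of both
  pictures.\<close>

lemma matchedI:
  assumes R: "resolution_choice d R" and R': "resolution_choice d' R'" "R' - J = R - J"
    and \<gamma>: "\<And>j. j < k \<Longrightarrow> continuous_on {-1..1} (\<gamma> j)"
      "\<And>j t. j < k \<Longrightarrow> t \<in> {-1..1} \<Longrightarrow> 0 < \<gamma> j t \<and> \<gamma> j t < (1::real)"
    and ord: "\<And>j t i s. \<lbrakk>j < k; t \<in> {-1..1}; i < k; s \<in> {-1..1}; (j, t) \<noteq> (i, s); a j t = a i s; e j t \<in> R; e i s \<notin> R\<rbrakk>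
      \<Longrightarrow> \<gamma> i s < \<gamma> j t"
    and ord': "\<And>j t i s. \<lbrakk>j < k; t \<in> {-1..1}; i < k; s \<in> {-1..1}; (j, t) \<noteq> (i, s); a' j t = a' i s; e j t \<in> R'; e i s \<notin> R'\<rbrakk>
      \<Longrightarrow> \<gamma> i s < \<gamma> j t"
    and chain: "\<And>h. P.arc_heights \<gamma> h \<Longrightarrow>
      torus_isotopic\<^sup>*\<^sup>* (height_graph (params d) (P.pcurve a) h) (height_graph (params d) (P.pcurve a') h)"
  shows "choices_matched d R d' R'"
proof -
  have "\<exists>h. height_function d R h \<and> (\<forall>j<k. \<forall>t\<in>{-1..1}. h (e j t) = \<gamma> j t)"
    by (rule P.heights_exist[OF R]) (assumption | rule \<gamma> ord)+
  then obtain h where h: "height_function d R h" "\<And>j t. j < k \<Longrightarrow> t \<in> {-1..1} \<Longrightarrow> h (e j t) = \<gamma> j t"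
    by blast
  have "height_function d' R' h"
    by (rule height_function_outside[OF R R' h]) (use ord' in auto)
  moreover have "P.arc_heights \<gamma> h" using h by (simp add: P.arc_heights_def height_function_def)
  ultimately show ?thesis
    unfolding choices_matched_def using R'(1) h(1) chain[unfolded graph_d graph_d'] by blast
qed

end

section \<open>Transfer of resolution choices between two diagrams\<close>

lemma resolution_choice_not_pre:
  assumes "resolution_choice d R" "p \<notin> pre_strands d"
  shows "p \<in> R \<longleftrightarrow> p \<in> over d"
proof
  assume p: "p \<in> R"
  then obtain q where q: "partner_strands d p q" using assms(1) by (auto simp: resolution_choice_def double_strands_def)
  then have "q \<notin> R" using p resolution_choice_partner[OF assms(1)] by blast
  then have "q \<notin> over d" using assms(1) by (auto simp: resolution_choice_def)
  then show "p \<in> over d" using assms(2) q by (auto simp: pre_strands_def)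
qed (use assms in \<open>auto simp: resolution_choice_def\<close>)

text \<open>\<open>N\<close> matches strands of precrossings of the two diagrams.\<close>

lemma resolution_transfer:
  assumes d: "pseudo_motif d" and d': "pseudo_motif d'" and R: "resolution_choice d R"
    and total: "\<And>p'. p' \<in> pre_strands d' \<Longrightarrow> \<exists>p\<in>pre_strands d. N p p'"
    and partner: "\<And>p p' q'. \<lbrakk>N p p'; p \<in> pre_strands d; p' \<in> pre_strands d'; partner_strands d' p' q'\<rbrakk>
      \<Longrightarrow> \<exists>q\<in>pre_strands d. partner_strands d p q \<and> N q q'"
    and homol: "\<And>p p' q q'. \<lbrakk>N p p'; N q q'; p \<in> pre_strands d; q \<in> pre_strands d; (p', q') \<in> homol d'\<rbrakk>
      \<Longrightarrow> (p, q) \<in> homol d"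
  obtains R' where "resolution_choice d' R'"
    "\<And>p p'. N p p' \<Longrightarrow> p \<in> pre_strands d \<Longrightarrow> p' \<in> pre_strands d' \<Longrightarrow> p' \<in> R' \<longleftrightarrow> p \<in> R"
proof
  note D' = pseudo_motifD[OF d'] and m' = valid_markingD[OF pseudo_motifD(8)[OF d']]
  \<comment> \<open>Classical crossings are forced; a precrossing strand copies the choice of a
    strand matched to it.\<close>
  define R' where "R' = over d' \<union> {p'\<in>pre_strands d'. \<exists>p\<in>pre_strands d. N p p' \<and> p \<in> R}"
  have homR: "p \<in> R \<longleftrightarrow> q \<in> R" if "(p, q) \<in> homol d" for p q
    using R that by (auto simp: resolution_choice_def)
  have mem: "p' \<in> R' \<longleftrightarrow> p \<in> R" if "N p p'" "p \<in> pre_strands d" "p' \<in> pre_strands d'" for p p'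
  proof -
    have "p' \<notin> over d'" using that(3) by (simp add: pre_strands_def)
    \<comment> \<open>Different strands matched to \<open>p'\<close> are homologous in
      \<open>d\<close>, so the copied choice does not depend on the match.\<close>
    moreover have "q \<in> R \<longleftrightarrow> p \<in> R" if "N q p'" "q \<in> pre_strands d" for q
      using homR[OF homol[OF that(1) \<open>N p p'\<close> that(2) \<open>p \<in> pre_strands d\<close> m'(2)[OF \<open>p' \<in> pre_strands d'\<close>]]] .
    ultimately show ?thesis using that unfolding R'_def by blast
  qed
  show "resolution_choice d' R'"
    unfolding resolution_choice_def
  proof (intro conjI allI impI)
    show "over d' \<subseteq> R'" by (simp add: R'_def)
    show "R' \<subseteq> double_strands d'" using D'(6) by (auto simp: R'_def pre_strands_def double_strands_def)
    fix p' q' assume part: "partner_strands d' p' q'"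
    show "(p' \<in> R') = (q' \<notin> R')"
    proof (cases "p' \<in> over d' \<or> q' \<in> over d'")
      case True
      have "p' \<notin> pre_strands d'" "q' \<notin> pre_strands d'"
        using True D'(5)[OF part] D'(5)[of q' p'] part partner_strands_sym[of d' p' q']
        unfolding pre_strands_def by blast+
      then show ?thesis using True D'(7)[OF part] unfolding R'_def by blast
    next
      case False
      then have pre: "p' \<in> pre_strands d'" "q' \<in> pre_strands d'"
        using part partner_strands_sym[of d' p' q'] unfolding pre_strands_def by blast+
      obtain p where p: "p \<in> pre_strands d" "N p p'" using total[OF pre(1)] by blast
      obtain q where q: "q \<in> pre_strands d" "partner_strands d p q" "N q q'" using partner[OF p(2,1) pre(1) part] by blast
      show ?thesis
        using mem[OF p(2,1) pre(1)] mem[OF q(3,1) pre(2)] resolution_choice_partner[OF R q(2)] by simp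
    qed
  next
    show "\<forall>(p', q')\<in>homol d'. (p' \<in> R') = (q' \<in> R')"
    proof (intro ballI, clarify)
      fix p' q' assume h: "(p', q') \<in> homol d'"
      then have pre: "p' \<in> pre_strands d'" "q' \<in> pre_strands d'" using m'(1) by blast+
      obtain p q where pq: "p \<in> pre_strands d" "N p p'" "q \<in> pre_strands d" "N q q'" using total pre by meson
      show "(p' \<in> R') = (q' \<in> R')"
        using mem[OF pq(2,1) pre(1)] mem[OF pq(4,3) pre(2)] homR[OF homol[OF pq(2,4,1,3) h]] by simp
    qed
  qed
  show "\<And>p p'. N p p' \<Longrightarrow> p \<in> pre_strands d \<Longrightarrow> p' \<in> pre_strands d' \<Longrightarrow> p' \<in> R' \<longleftrightarrow> p \<in> R" by (rule mem)
qed

context picture_pair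
begin

text \<open>Strands outside the picture that belong to no precrossing are decided by
  \<open>over\<close>, equally in both diagrams; so agreement at the precrossings suffices.\<close>

lemma transfer_outside:
  assumes R: "resolution_choice d R" and R': "resolution_choice d' R'"
    and mem: "\<And>p. \<lbrakk>p \<notin> J; p \<in> pre_strands d\<rbrakk> \<Longrightarrow> p \<in> R' \<longleftrightarrow> p \<in> R"
  shows "R' - J = R - J"
proof -
  have "p \<in> R' \<longleftrightarrow> p \<in> R" if "p \<notin> J" for p
  proof (cases "p \<in> pre_strands d")
    case False
    then have "p \<in> R \<longleftrightarrow> p \<in> over d" "p \<in> R' \<longleftrightarrow> p \<in> over d'"
      using resolution_choice_not_pre[OF R] resolution_choice_not_pre[OF R'] pre_outside[OF that] by blast+
    moreover have "p \<in> over d \<longleftrightarrow> p \<in> over d'"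
      using over_outside[OF _ that] motif_strands_params(1)[OF P.motif] motif_strands_params(1)[OF P'.motif] params_eq by blast
    ultimately show ?thesis by simp
  qed (use mem that in blast)
  then show ?thesis by blast
qed

lemma transfer_id:
  assumes R: "resolution_choice d R" and sub: "pre_strands d' \<subseteq> pre_strands d"
    and hom: "homol d' \<subseteq> homol d"
    and part: "\<And>p q. p \<in> J \<Longrightarrow> p \<in> pre_strands d' \<Longrightarrow> partner_strands d' p q \<Longrightarrow> partner_strands d p q"
  obtains R' where "resolution_choice d' R'" "R' - J = R - J" "\<And>p. p \<in> pre_strands d' \<Longrightarrow> p \<in> R' \<longleftrightarrow> p \<in> R"
proof -
  obtain R' where R': "resolution_choice d' R'"
    "\<And>p p'. p = p' \<Longrightarrow> p \<in> pre_strands d \<Longrightarrow> p' \<in> pre_strands d' \<Longrightarrow> p' \<in> R' \<longleftrightarrow> p \<in> R"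
  proof (rule resolution_transfer[OF P.motif P'.motif R, of "\<lambda>p p'. p = p'"])
    fix p p' q' assume "p = p'" "p \<in> pre_strands d" "p' \<in> pre_strands d'" "partner_strands d' p' q'"
    moreover from this have "partner_strands d p q'" using part partner_outside by blast
    moreover have "q' \<in> pre_strands d'"
      using \<open>p' \<in> pre_strands d'\<close> \<open>partner_strands d' p' q'\<close> pseudo_motifD(5)[OF P'.motif] partner_strands_sym[of d' p' q']
      unfolding pre_strands_def by blast
    ultimately show "\<exists>q\<in>pre_strands d. partner_strands d p q \<and> q = q'" using sub by blast
  qed (use sub hom in auto)
  show thesis
  proof (rule that[OF R'(1)])
    show "R' - J = R - J" by (rule transfer_outside[OF R R'(1)]) (use R'(2) pre_outside in blast)
    show "p \<in> R' \<longleftrightarrow> p \<in> R" if "p \<in> pre_strands d'" for p using R'(2) that sub by blast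
  qed
qed

end

section \<open>The local pictures of the moves\<close>

definition kink_x :: "real \<Rightarrow> real" where
  "kink_x t = (4 * t ^ 3 - t) / 3"

lemma kink_x_minus: "kink_x (- t) = - kink_x t"
  by (simp add: kink_x_def power3_eq_cube field_simps)

lemma sq_le_one: "-1 \<le> t \<Longrightarrow> t \<le> 1 \<Longrightarrow> t\<^sup>2 \<le> (1::real)"
  by (simp add: abs_square_le_1 abs_le_iff)

text \<open>The room needed in \<open>kink_chain\<close>: a tent with top value
  \<open>(1 - t\<^sup>2) / 2\<close> and slope 3/2, centred at \<open>kink_x t\<close>, has died out
  at 1. The difference of the two sides is half of
  \<open>(1 - t) * (4 * t\<^sup>2 + 3 * t + 2)\<close>.\<close>

lemma kink_x_right:
  assumes "-1 \<le> t" "t \<le> 1"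
  shows "(1 - t\<^sup>2) / 2 \<le> 3/2 * (1 - kink_x t)"
proof -
  have "0 \<le> (2 * t + 3/4)\<^sup>2 + 23/16" by (intro add_nonneg_nonneg) auto
  also have "\<dots> = 4 * t\<^sup>2 + 3 * t + 2" by (simp add: power2_eq_square algebra_simps)
  finally have "0 \<le> (1 - t) * (4 * t\<^sup>2 + 3 * t + 2)" using assms by (intro mult_nonneg_nonneg) auto
  then show ?thesis by (simp add: kink_x_def power2_eq_square power3_eq_cube field_simps)
qed

lemma kink_x_left:
  assumes "-1 \<le> t" "t \<le> 1"
  shows "(1 - t\<^sup>2) / 2 \<le> 3/2 * (1 + kink_x t)"
  using kink_x_right[of "- t"] assms by (simp add: kink_x_minus)

lemma kink_x_bounds:
  assumes "-1 \<le> t" "t \<le> 1"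
  shows "-1 \<le> kink_x t" "kink_x t \<le> 1"
  using kink_x_right[OF assms] kink_x_left[OF assms] sq_le_one[OF assms] by auto

text \<open>The margins that \<open>slide_eq\<close> requires for moving \<open>kink_x t\<close> to
  \<open>t\<close>. Up to positive constants the differences are products of \<open>1 - t\<close> or
  \<open>1 + t\<close> with a quadratic that is positive on the interval.\<close>

lemma kink_x_slide_bounds:
  assumes "-1 \<le> t" "t \<le> 1"
  shows "t \<le> kink_x t / 5 + 4 / 5" "t \<le> 5 * kink_x t + 4"
proof -
  have "0 \<le> (1 - t) * (3 - t - t\<^sup>2)" using assms sq_le_one[OF assms] by (intro mult_nonneg_nonneg) auto
  then show "t \<le> kink_x t / 5 + 4 / 5" by (simp add: kink_x_def power2_eq_square power3_eq_cube field_simps)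
  have "0 \<le> 5 * (t - 1/2)\<^sup>2 + 7/4" by (intro add_nonneg_nonneg) auto
  also have "\<dots> = 5 * t\<^sup>2 - 5 * t + 3" by (simp add: power2_eq_square algebra_simps)
  finally have "0 \<le> (1 + t) * (5 * t\<^sup>2 - 5 * t + 3)" using assms by (intro mult_nonneg_nonneg) auto
  then show "t \<le> 5 * kink_x t + 4" by (simp add: kink_x_def power2_eq_square power3_eq_cube field_simps)
qed

lemma slide_kink_x:
  assumes "-1 \<le> t" "t \<le> 1"
  shows "slide (t - kink_x t) (kink_x t) = t"
  using slide_eq[of "kink_x t" "t - kink_x t"] kink_x_slide_bounds[OF assms] kink_x_slide_bounds[of "- t"] assms
  by (simp add: kink_x_minus)

lemma slide_kink_y:
  assumes "-1 \<le> t" "t \<le> 1"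
  shows "slide (- ((1 - t\<^sup>2) / 2)) ((1 - t\<^sup>2) / 2) = 0"
  using slide_eq[of "(1 - t\<^sup>2) / 2" "- ((1 - t\<^sup>2) / 2)"] sq_le_one[OF assms] zero_le_power2[of t] by (simp add: field_simps)

text \<open>Equal second coordinates leave only \<open>s = - t\<close>. The first coordinate is odd,
  so it vanishes at \<open>t\<close>; its roots are 0, 1/2 and -1/2, and 0 is excluded by
  \<open>t \<noteq> s\<close>.\<close>

lemma kink_double:
  assumes "kink_pic j t = kink_pic i s" "t \<noteq> s"
  shows "t = 1/2 \<and> s = -1/2 \<or> t = -1/2 \<and> s = 1/2"
proof -
  have "t\<^sup>2 = s\<^sup>2" and x: "kink_x t = kink_x s" using assms(1) by (auto simp: kink_pic_def kink_x_def)
  then have s: "s = - t" using assms(2) by (auto simp: power2_eq_iff)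
  then have "kink_x t = 0" using x by (simp add: kink_x_minus)
  then have "t * ((2 * t - 1) * (2 * t + 1)) = 0" by (simp add: kink_x_def power3_eq_cube algebra_simps)
  moreover have "t \<noteq> 0" using assms(2) s by auto
  ultimately have "t = 1/2 \<or> t = -1/2" by auto
  then show ?thesis using s by auto
qed

lemma kink_cross: "kink_pic 0 (1/2) = kink_pic 0 (-1/2)"
  by (simp add: kink_pic_def power3_eq_cube power2_eq_square)

lemma clasp_double:
  assumes "clasp_pic j t = clasp_pic i s" "(j, t) \<noteq> (i, s)" "j < 2" "i < 2"
  shows "j \<noteq> i \<and> s = t \<and> (t = 1/2 \<or> t = -1/2)"
proof -
  have st: "s = t" using assms(1) by (auto simp: clasp_pic_def split: if_splits)
  then have ji: "j \<noteq> i" using assms(2) by auto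
  then have "t\<^sup>2 = (1/2)\<^sup>2" using assms st by (auto simp: clasp_pic_def power2_eq_square split: if_splits)
  then have "t = 1/2 \<or> t = -1/2" by (subst (asm) power2_eq_iff) auto
  then show ?thesis using st ji by auto
qed

lemma clasp_cross:
  assumes "r = 1/2 \<or> r = -1/2" "j < 2" "i < 2"
  shows "clasp_pic j r = clasp_pic i r"
proof -
  have "r\<^sup>2 = 1/4" using assms(1) by (elim disjE) (simp_all only:, simp_all add: power2_eq_square)
  then show ?thesis by (simp add: clasp_pic_def)
qed

lemma parallel_inj: "parallel_pic j t = parallel_pic i s \<Longrightarrow> j < 2 \<Longrightarrow> i < 2 \<Longrightarrow> (j, t) = (i, s)"
  by (auto simp: parallel_pic_def split: if_splits)

lemma triangle_arc_inj: "triangle_pic \<epsilon> j t = triangle_pic \<epsilon> j s \<Longrightarrow> t = s"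
  by (auto simp: triangle_pic_def split: if_splits)

lemma triangle_cross01:
  assumes "triangle_pic \<epsilon> j t = triangle_pic \<epsilon> i s" "j \<noteq> i" "j < 2" "i < 2"
  shows "t = 0 \<and> s = 0"
  using assms by (auto simp: triangle_pic_def split: if_splits)

lemma pictures_in_square:
  assumes "t \<in> {-1..1}"
  shows "kink_pic j t \<in> square" "straight_pic j t \<in> square" "clasp_pic j t \<in> square"
    "parallel_pic j t \<in> square" "\<epsilon> = 1 \<or> \<epsilon> = -1 \<Longrightarrow> triangle_pic \<epsilon> j t \<in> square"
proof -
  have t: "-1 \<le> t" "t \<le> 1" using assms by auto
  have t2: "t\<^sup>2 \<le> 1" "0 \<le> t\<^sup>2" using sq_le_one[OF t] by auto
  show "kink_pic j t \<in> square"
    using kink_x_bounds[OF t] t2(1) order_trans[OF _ t2(2), of "-1"] by (simp add: kink_pic_def kink_x_def square_def)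
  show "straight_pic j t \<in> square" "clasp_pic j t \<in> square" "parallel_pic j t \<in> square"
  proof -
    have "-1 \<le> t\<^sup>2 - 1/4" "t\<^sup>2 - 1/4 \<le> 1" using t2 by linarith+
    then show "straight_pic j t \<in> square" "clasp_pic j t \<in> square" "parallel_pic j t \<in> square"
      using t by (simp_all add: straight_pic_def clasp_pic_def parallel_pic_def square_def)
  qed
  show "\<epsilon> = 1 \<or> \<epsilon> = -1 \<Longrightarrow> triangle_pic \<epsilon> j t \<in> square"
    using t t2(1) order_trans[OF _ t2(2), of "-1"] by (auto simp: triangle_pic_def square_def)
qed

lemma std_move_square:
  assumes "std_move k a Ov a' Ov' \<tau>" "t \<in> {-1..1}"
  shows "a j t \<in> square" "a' j t \<in> square"
  using assms(1) by (cases rule: std_move.cases; simp add: pictures_in_square[OF assms(2)])+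

section \<open>Isotopies of the local pictures\<close>

text \<open>The heights are linear along the arc, so the height of a point determines its parameter
  and a slide may depend on the parameter. The loop is flattened onto the axis, where the arc runs
  back and forth at different heights, and is then stretched to the straight arc.\<close>

lemma kink_chain:
  assumes "picture d 1 a Ov \<phi> e" and \<sigma>: "\<sigma> = 1 \<or> \<sigma> = -1"
    and h: "picture.arc_heights d 1 e (\<lambda>j t. 1/2 + \<sigma> * t / 4) h"
  shows "torus_isotopic\<^sup>*\<^sup>* (height_graph (params d) (picture.pcurve d 1 \<phi> e kink_pic) h)
    (height_graph (params d) (picture.pcurve d 1 \<phi> e straight_pic) h)"
proof -
  interpret picture d 1 a Ov \<phi> e by fact
  define \<gamma> where "\<gamma> = (\<lambda>(j::nat) t. 1/2 + \<sigma> * t / 4)"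
  \<comment> \<open>Recovers the parameter from the height, clamped so that it is defined at all
    heights; \<open>\<sigma>\<close> is its own inverse.\<close>
  define T where "T z = max (-1) (min 1 (4 * \<sigma> * (z - 1/2)))" for z :: real
  have T: "-1 \<le> T z" "T z \<le> 1" for z by (auto simp: T_def)
  have T\<gamma>: "T (\<gamma> j t) = t" if "t \<in> {-1..1}" for j t
  proof -
    have "4 * \<sigma> * (\<gamma> j t - 1/2) = t" using \<sigma> by (auto simp: \<gamma>_def)
    then show ?thesis using that by (simp add: T_def)
  qed
  have cT: "continuous_on S (\<lambda>w. T (f w))" if "continuous_on S f" for S and f :: "real \<times> real \<Rightarrow> real"
    unfolding T_def by (intro continuous_intros that)
  define mid :: arcs where "mid j t = (kink_x t, 0)" for j t
  \<comment> \<open>At height \<open>z\<close> only the point with parameter \<open>T z\<close> has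
    to be pushed down to the axis. The tent around its position vanishes on the sides of the square
    because its slope is 3/2.\<close>
  define D1 where "D1 x z = - max 0 ((1 - (T z)\<^sup>2) / 2 - 3/2 * \<bar>x - kink_x (T z)\<bar>)" for x z
  \<comment> \<open>The flattened arc lies at \<open>y = 0\<close>, where the last factor is 1; on
    the border it is 0.\<close>
  define D2 where "D2 y z = (T z - kink_x (T z)) * (1 - \<bar>y\<bar>)" for y z
  have "torus_isotopic (height_graph (params d) (pcurve kink_pic) h) (height_graph (params d) (pcurve mid) h) \<and>
    (continuous_on (params d) (pcurve kink_pic) \<longrightarrow> continuous_on (params d) h \<longrightarrow> continuous_on (params d) (pcurve mid))"
  proof (rule slide_second[where D = D1 and \<gamma> = \<gamma>])
    show "continuous_on ({-1..1} \<times> {0..1}) (\<lambda>(x, z). D1 x z)"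
      unfolding D1_def kink_x_def case_prod_unfold by (intro continuous_intros cT) auto
    show "D1 x z = 0" if x: "\<bar>x\<bar> = 1" for x z
    proof -
      have b: "-1 \<le> kink_x (T z)" "kink_x (T z) \<le> 1" by (rule kink_x_bounds[OF T])+
      have "(1 - (T z)\<^sup>2) / 2 \<le> 3/2 * \<bar>x - kink_x (T z)\<bar>"
        using x kink_x_right[OF T, of z] kink_x_left[OF T, of z] b by (auto simp: abs_if split: if_splits)
      then show ?thesis by (simp add: D1_def)
    qed
    show "arc_heights \<gamma> h" using h by (simp add: \<gamma>_def)
    fix j t assume t: "t \<in> {-1..1::real}"
    show "kink_pic j t \<in> square" by (rule pictures_in_square[OF t])
    have t': "-1 \<le> t" "t \<le> 1" using t by auto
    have "D1 (kink_x t) (\<gamma> j t) = - ((1 - t\<^sup>2) / 2)"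
      using T\<gamma>[OF t] sq_le_one[OF t'] by (simp add: D1_def)
    then show "mid j t = (fst (kink_pic j t), slide (D1 (fst (kink_pic j t)) (\<gamma> j t)) (snd (kink_pic j t)))"
      using slide_kink_y[OF t'] by (simp add: mid_def kink_pic_def kink_x_def)
  qed
  moreover have "torus_isotopic (height_graph (params d) (pcurve mid) h) (height_graph (params d) (pcurve straight_pic) h) \<and>
    (continuous_on (params d) (pcurve mid) \<longrightarrow> continuous_on (params d) h \<longrightarrow> continuous_on (params d) (pcurve straight_pic))"
  proof (rule slide_first[where D = D2 and \<gamma> = \<gamma>])
    show "continuous_on ({-1..1} \<times> {0..1}) (\<lambda>(y, z). D2 y z)"
      unfolding D2_def kink_x_def case_prod_unfold by (intro continuous_intros cT) auto
    show "D2 y z = 0" if "\<bar>y\<bar> = 1" for y z using that by (simp add: D2_def)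
    show "arc_heights \<gamma> h" using h by (simp add: \<gamma>_def)
    fix j t assume t: "t \<in> {-1..1::real}"
    then have t': "-1 \<le> t" "t \<le> 1" by auto
    show "mid j t \<in> square" using kink_x_bounds[OF t'] by (simp add: mid_def square_def)
    show "straight_pic j t = (slide (D2 (snd (mid j t)) (\<gamma> j t)) (fst (mid j t)), snd (mid j t))"
      using T\<gamma>[OF t] slide_kink_x[OF t'] by (simp add: mid_def straight_pic_def D2_def)
  qed
  ultimately show ?thesis by (meson converse_rtranclp_into_rtranclp r_into_rtranclp)
qed

text \<open>The parabola is the displacement of the moving arc; the tent in the height has
  half-width 1/4, so arcs at levels at least 1/4 away stay in place.\<close>

definition bump :: "real \<Rightarrow> real \<Rightarrow> real \<Rightarrow> real" where
  "bump l w z = (1 - w\<^sup>2) * max 0 (1 - 4 * \<bar>z - l\<bar>)"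

lemma bump_simps:
  "\<bar>w\<bar> = 1 \<Longrightarrow> bump l w z = 0" "1/4 \<le> \<bar>z - l\<bar> \<Longrightarrow> bump l w z = 0" "bump l w l = 1 - w\<^sup>2"
proof -
  assume "\<bar>w\<bar> = 1"
  then have "w\<^sup>2 = 1" by (simp add: abs_square_eq_1)
  then show "bump l w z = 0" by (simp add: bump_def)
qed (auto simp: bump_def)

lemma continuous_on_bump: "continuous_on S (\<lambda>(w, z). bump l w z)"
  unfolding bump_def case_prod_unfold by (intro continuous_intros)

text \<open>Arc 1 is raised by 1 - t^2, from t^2 - 1/4 to 3/4, while arc 0 lies at a level where the
  bump vanishes.\<close>

lemma clasp_slide:
  assumes "picture d 2 a Ov \<phi> e" and l: "1/4 \<le> \<bar>l 0 - l 1\<bar>"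
    and h: "picture.arc_heights d 2 e (\<lambda>j t. l j) h"
  shows "torus_isotopic (height_graph (params d) (picture.pcurve d 2 \<phi> e clasp_pic) h)
      (height_graph (params d) (picture.pcurve d 2 \<phi> e parallel_pic) h) \<and>
    (continuous_on (params d) (picture.pcurve d 2 \<phi> e clasp_pic) \<longrightarrow> continuous_on (params d) h \<longrightarrow>
      continuous_on (params d) (picture.pcurve d 2 \<phi> e parallel_pic))"
proof -
  interpret picture d 2 a Ov \<phi> e by fact
  show ?thesis
  proof (rule slide_second[OF continuous_on_bump bump_simps(1) _ h])
    fix j t assume j: "j < (2::nat)" and t: "t \<in> {-1..1::real}"
    show "clasp_pic j t \<in> square" by (rule pictures_in_square[OF t])
    have t2: "t\<^sup>2 \<le> 1" "0 \<le> t\<^sup>2" using sq_le_one t by auto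
    have "slide (1 - t\<^sup>2) (t\<^sup>2 - 1/4) = 3/4"
      using slide_eq[of "t\<^sup>2 - 1/4" "1 - t\<^sup>2"] t2 by (simp add: field_simps)
    then show "parallel_pic j t = (fst (clasp_pic j t), slide (bump (l 1) (fst (clasp_pic j t)) (l j)) (snd (clasp_pic j t)))"
      using j l t by (cases "j = 0") (auto simp: parallel_pic_def clasp_pic_def bump_simps slide_0 less_Suc_eq numeral_2_eq_2)
  qed
qed

text \<open>Arc 2 is pushed sideways by 1 - t^2, from -(1 - t^2)/2 to (1 - t^2)/2, at a level where
  it meets neither of the other arcs.\<close>

lemma triangle_slide:
  assumes "picture d 3 a Ov \<phi> e" and l: "1/4 \<le> \<bar>l 0 - l 2\<bar>" "1/4 \<le> \<bar>l 1 - l 2\<bar>"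
    and h: "picture.arc_heights d 3 e (\<lambda>j t. l j) h"
  shows "torus_isotopic (height_graph (params d) (picture.pcurve d 3 \<phi> e (triangle_pic (-1))) h)
      (height_graph (params d) (picture.pcurve d 3 \<phi> e (triangle_pic 1)) h)"
proof -
  interpret picture d 3 a Ov \<phi> e by fact
  have "torus_isotopic (height_graph (params d) (pcurve (triangle_pic (-1))) h)
      (height_graph (params d) (pcurve (triangle_pic 1)) h) \<and>
    (continuous_on (params d) (pcurve (triangle_pic (-1))) \<longrightarrow> continuous_on (params d) h \<longrightarrow>
      continuous_on (params d) (pcurve (triangle_pic 1)))"
  proof (rule slide_first[OF continuous_on_bump bump_simps(1) _ h])
    fix j t assume j: "j < (3::nat)" and t: "t \<in> {-1..1::real}"
    show "triangle_pic (-1) j t \<in> square" by (rule pictures_in_square[OF t]) simp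
    have t2: "t\<^sup>2 \<le> 1" "0 \<le> t\<^sup>2" using sq_le_one t by auto
    have "slide (1 - t\<^sup>2) (- (1 - t\<^sup>2) / 2) = (1 - t\<^sup>2) / 2"
      using slide_eq[of "- (1 - t\<^sup>2) / 2" "1 - t\<^sup>2"] t2 by (simp add: field_simps)
    moreover have "j = 0 \<or> j = 1 \<or> j = 2" using j by auto
    ultimately show "triangle_pic 1 j t = (slide (bump (l 2) (snd (triangle_pic (-1) j t)) (l j)) (fst (triangle_pic (-1) j t)),
        snd (triangle_pic (-1) j t))"
      using l t by (auto simp: triangle_pic_def bump_simps slide_0)
  qed
  then show ?thesis by blast
qed

text \<open>Ranks the arcs by their level. Up to three arcs are placed among the heights 1/4, 1/2
  and 3/4, with exactly the gap that \<open>bump\<close> requires between different levels.\<close>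

definition level :: "nat \<Rightarrow> (nat \<Rightarrow> nat) \<Rightarrow> nat \<Rightarrow> real" where
  "level k l j = (1 + real (card {i. i < k \<and> l i < l j})) / 4"

lemma level_less:
  assumes "i < k" "l i < l j"
  shows "level k l i + 1/4 \<le> level k l j"
proof -
  have "{n. n < k \<and> l n < l i} \<subset> {n. n < k \<and> l n < l j}" using assms by auto
  then have "card {n. n < k \<and> l n < l i} < card {n. n < k \<and> l n < l j}" by (intro psubset_card_mono) auto
  then show ?thesis by (simp add: level_def field_simps)
qed

lemma level_bounds:
  assumes "j < k" "k \<le> 3"
  shows "0 < level k l j \<and> level k l j < 1"
proof -
  have "{i. i < k \<and> l i < l j} \<subseteq> {..<k} - {j}" by auto
  then have "card {i. i < k \<and> l i < l j} \<le> card ({..<k} - {j})" by (intro card_mono) auto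
  also have "\<dots> \<le> 2" using assms by simp
  finally show ?thesis by (simp add: level_def)
qed

lemma level_diff:
  assumes "inj_on l {..<k}" "i < k" "j < k" "i \<noteq> j"
  shows "1/4 \<le> \<bar>level k l i - level k l j\<bar>"
proof -
  have "l i \<noteq> l j" using assms by (auto dest: inj_onD)
  then consider "l i < l j" | "l j < l i" by linarith
  then show ?thesis using level_less[of i k l j] level_less[of j k l i] assms by cases auto
qed

lemma layeredI:
  "\<lbrakk>j < k; s \<in> {-1..1}; i < k; t \<in> {-1..1}; a i t = a j s; l i < l j\<rbrakk> \<Longrightarrow> (j, s) \<in> layered k a l"
  unfolding layered_def by blast

context picture
begin

text \<open>Were the other arc at the lower index of the claim the higher one, its strand would lie
  in \<open>over d\<close>, and both partners would be chosen.\<close>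

lemma layered_order:
  assumes Ov: "Ov = layered k a l" and R: "resolution_choice d R"
    and j: "j < k" "t \<in> {-1..1}" "i < k" "s \<in> {-1..1}" "(j, t) \<noteq> (i, s)" "a j t = a i s" "e j t \<in> R" "l i \<noteq> l j"
  shows "l i < l j"
proof (rule ccontr)
  assume "\<not> l i < l j"
  then have "(i, s) \<in> Ov" unfolding Ov using j by (intro layeredI[of i k s j t]) auto
  then have "e i s \<in> R" using over_e[of i s] j R by (auto simp: resolution_choice_def)
  moreover have "partner_strands d (e j t) (e i s)" using partner_e j by simp
  ultimately show False using resolution_choice_partner[OF R] j by blast
qed

lemma layered_pre:
  assumes Ov: "Ov = layered k a l" and arcs: "\<And>j t s. a j t = a j s \<Longrightarrow> t = s" and j: "j < k" "t \<in> {-1..1}"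
    and pre: "e j t \<in> pre_strands d"
  obtains i s where "i < k" "s \<in> {-1..1}" "i \<noteq> j" "l i = l j" "a j t = a i s"
proof -
  obtain i s where i: "i < k" "s \<in> {-1..1}" "(j, t) \<noteq> (i, s)" "a j t = a i s" "(i, s) \<notin> Ov" "(j, t) \<notin> Ov"
    using pre pre_e[OF j] by blast
  have "i \<noteq> j" using arcs i by auto
  moreover have "\<not> l i < l j" using layeredI[of j k t i s a l] i j unfolding Ov by auto
  moreover have "\<not> l j < l i" using layeredI[of i k s j t a l] i j unfolding Ov by auto
  ultimately show thesis using that[of i s] i by auto
qed

end

context picture_pair
begin

text \<open>Reduces a layered move to a comparison of levels: choices compatible with the levels are
  realised by constant heights on the arcs.\<close>

lemma layered_matched:
  assumes k: "k \<le> 3" and R: "resolution_choice d R" and R': "resolution_choice d' R'" "R' - J = R - J"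
    and ord: "\<And>j t i s. \<lbrakk>j < k; t \<in> {-1..1}; i < k; s \<in> {-1..1}; (j, t) \<noteq> (i, s); a j t = a i s; e j t \<in> R\<rbrakk>
      \<Longrightarrow> l i < l j"
    and ord': "\<And>j t i s. \<lbrakk>j < k; t \<in> {-1..1}; i < k; s \<in> {-1..1}; (j, t) \<noteq> (i, s); a' j t = a' i s; e j t \<in> R'\<rbrakk>
      \<Longrightarrow> l i < l j"
    and chain: "\<And>h. P.arc_heights (\<lambda>j t. level k l j) h \<Longrightarrow>
      torus_isotopic (height_graph (params d) (P.pcurve a) h) (height_graph (params d) (P.pcurve a') h)"
  shows "choices_matched d R d' R'"
proof (rule matchedI[OF R R', where \<gamma> = "\<lambda>j t. level k l j"])
  have less: "level k l i < level k l j" if "i < k" "l i < l j" for i j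
    using level_less[of i k l j] that by auto
  show "level k l i < level k l j"
    if "j < k" "t \<in> {-1..1}" "i < k" "s \<in> {-1..1}" "(j, t) \<noteq> (i, s)" "a j t = a i s" "e j t \<in> R" for i j t s
    using less ord that by blast
  show "level k l i < level k l j"
    if "j < k" "t \<in> {-1..1}" "i < k" "s \<in> {-1..1}" "(j, t) \<noteq> (i, s)" "a' j t = a' i s" "e j t \<in> R'" for i j t s
    using less ord' that by blast
qed (use chain level_bounds[OF _ k] in auto)

text \<open>Both resolutions of the kink are undone alike: \<open>\<sigma>\<close> lets the heights
  rise or fall along the arc according to which strand of the double point is on top.\<close>

lemma kink_matched:
  assumes k: "k = 1" "a = kink_pic" "a' = straight_pic"
    and R: "resolution_choice d R" and R': "resolution_choice d' R'" "R' - J = R - J"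
  shows "choices_matched d R d' R'"
proof -
  define \<sigma> :: real where "\<sigma> = (if e 0 (1/2) \<in> R then 1 else -1)"
  have \<sigma>: "\<sigma> = 1 \<or> \<sigma> = -1" by (simp add: \<sigma>_def)
  show ?thesis
  proof (rule matchedI[OF R R', where \<gamma> = "\<lambda>j t. 1/2 + \<sigma> * t / 4"])
    show "continuous_on {-1..1} (\<lambda>t. 1/2 + \<sigma> * t / 4)" by (intro continuous_intros) auto
    show "0 < 1/2 + \<sigma> * t / 4 \<and> 1/2 + \<sigma> * t / 4 < 1" if "t \<in> {-1..1}" for t :: real
      using \<sigma> that by auto
    fix j i :: nat and t s :: real assume *: "j < k" "t \<in> {-1..1}" "i < k" "s \<in> {-1..1}" "(j, t) \<noteq> (i, s)"
    have z: "j = 0" "i = 0" "t \<noteq> s" using * k by auto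
    { assume c: "a j t = a i s" "e j t \<in> R" "e i s \<notin> R"
      have "t = 1/2 \<and> s = -1/2 \<or> t = -1/2 \<and> s = 1/2" using kink_double[of j t i s] c(1) z k by simp
      then show "1/2 + \<sigma> * s / 4 < 1/2 + \<sigma> * t / 4"
      proof (elim disjE conjE)
        assume ts: "t = 1/2" "s = -1/2"
        show ?thesis using c(2,3) unfolding z ts by (simp add: \<sigma>_def)
      next
        assume ts: "t = -1/2" "s = 1/2"
        show ?thesis using c(2,3) unfolding z ts by (simp add: \<sigma>_def)
      qed }
    { assume "a' j t = a' i s"
      then show "1/2 + \<sigma> * s / 4 < 1/2 + \<sigma> * t / 4" using z k by (simp add: straight_pic_def) }
  next
    fix h assume "P.arc_heights (\<lambda>j t. 1/2 + \<sigma> * t / 4) h"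
    then show "torus_isotopic\<^sup>*\<^sup>* (height_graph (params d) (P.pcurve a) h) (height_graph (params d) (P.pcurve a') h)"
      using kink_chain[of d a Ov \<phi> e \<sigma> h] \<sigma> P.picture_axioms unfolding k by blast
  qed
qed

section \<open>Invariance under the local moves\<close>

text \<open>For moves that match precrossing strands with themselves. Choices transfer both ways,
  and the isotopy found in one direction serves the other by symmetry of
  \<open>choices_matched\<close>.\<close>

lemma identity_related:
  assumes pre: "pre_strands d' = pre_strands d" and hom: "homol d' = homol d"
    and part: "\<And>p q. p \<in> J \<Longrightarrow> p \<in> pre_strands d \<Longrightarrow> partner_strands d' p q \<longleftrightarrow> partner_strands d p q"
    and match: "\<And>R R'. \<lbrakk>resolution_choice d R; resolution_choice d' R'; R' - J = R - J;
        \<And>p. p \<in> pre_strands d \<Longrightarrow> p \<in> R' \<longleftrightarrow> p \<in> R\<rbrakk> \<Longrightarrow> choices_matched d R d' R'"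
  shows "motif_related d d'"
proof (rule motif_relatedI[OF P.motif P'.motif])
  fix R assume R: "resolution_choice d R"
  obtain R' where "resolution_choice d' R'" "R' - J = R - J" "\<And>p. p \<in> pre_strands d' \<Longrightarrow> p \<in> R' \<longleftrightarrow> p \<in> R"
    by (rule transfer_id[OF R]) (use pre hom part in auto)
  then show "\<exists>R'. choices_matched d R d' R'" using match[OF R] pre by blast
next
  interpret S: picture_pair d' d k a' Ov' a Ov \<phi> e by (rule pair_sym)
  fix R' assume R': "resolution_choice d' R'"
  obtain R where R: "resolution_choice d R" "R - J = R' - J" "\<And>p. p \<in> pre_strands d \<Longrightarrow> p \<in> R \<longleftrightarrow> p \<in> R'"
    by (rule S.transfer_id[OF R']) (use pre hom part in auto)
  then have "choices_matched d R d' R'" using match[OF R(1) R'] by auto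
  then show "\<exists>R. choices_matched d' R' d R" using choices_matched_sym[OF _ P.motif R(1)] by blast
qed

lemma classical_related:
  assumes pre: "\<And>p. p \<in> J \<Longrightarrow> p \<notin> pre_strands d \<and> p \<notin> pre_strands d'"
    and hom: "\<And>p q. \<lbrakk>p \<notin> J; q \<notin> J; p \<in> pre_strands d; q \<in> pre_strands d\<rbrakk> \<Longrightarrow> (p, q) \<in> homol d \<longleftrightarrow> (p, q) \<in> homol d'"
    and match: "\<And>R R'. \<lbrakk>resolution_choice d R; resolution_choice d' R'; R' - J = R - J\<rbrakk> \<Longrightarrow> choices_matched d R d' R'"
  shows "motif_related d d'"
proof (rule identity_related)
  show eq: "pre_strands d' = pre_strands d" using pre pre_outside by blast
  have "(p, q) \<in> homol d' \<longleftrightarrow> (p, q) \<in> homol d" for p q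
    using hom[of p q] pre eq valid_markingD(1)[OF pseudo_motifD(8)[OF P.motif]] valid_markingD(1)[OF pseudo_motifD(8)[OF P'.motif]]
    by blast
  then show "homol d' = homol d" by auto
qed (use pre match in blast)+

text \<open>Removing the kink just forgets its choice. Creating it requires one: dictated if the new
  precrossing is homologous to one outside the picture, free otherwise.\<close>

lemma PR1_related:
  assumes k: "k = 1" "a = kink_pic" "a' = straight_pic" "Ov = {}"
    and hom: "\<And>p q. \<lbrakk>p \<notin> J; q \<notin> J; p \<in> pre_strands d; q \<in> pre_strands d\<rbrakk> \<Longrightarrow> (p, q) \<in> homol d \<longleftrightarrow> (p, q) \<in> homol d'"
  shows "motif_related d d'"
proof (rule motif_relatedI[OF P.motif P'.motif])
  note m = valid_markingD[OF pseudo_motifD(8)[OF P.motif]] and m' = valid_markingD[OF pseudo_motifD(8)[OF P'.motif]]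
  define x where "x = e 0 (1/2)"
  define y where "y = e 0 (-1/2)"
  have half: "(1/2::real) \<in> {-1..1}" "(-1/2::real) \<in> {-1..1}" "(0::nat) < k" using k by auto
  have xJ: "x \<in> J" "y \<in> J" using P.e_in half by (auto simp: x_def y_def)
  have xy: "partner_strands d x y"
    using P.partner_e[of 0 "1/2" 0 "-1/2"] half kink_cross k by (simp add: x_def y_def)
  have J_partner: "p = x \<and> q = y \<or> p = y \<and> q = x" if pJ: "p \<in> J" "partner_strands d p q" for p q
  proof -
    obtain j t where j: "j < k" "t \<in> {-1..1}" "p = e j t" using pJ(1) by (rule P.J_E)
    obtain i s where i: "i < k" "s \<in> {-1..1}" "q = e i s" "(j, t) \<noteq> (i, s)" "a j t = a i s"
      using P.partner_e_E[OF j(1,2)] pJ(2) j(3) by blast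
    then have "j = 0" "i = 0" "t \<noteq> s" using k j by auto
    then have "t = 1/2 \<and> s = -1/2 \<or> t = -1/2 \<and> s = 1/2" using kink_double[of j t i s] i k by simp
    then show ?thesis unfolding x_def y_def i(3) j(3) \<open>j = 0\<close> \<open>i = 0\<close> by (elim disjE conjE) (simp_all only:, simp_all)
  qed
  have J_double': "\<not> partner_strands d' p q" if pJ: "p \<in> J" for p q
  proof
    assume part: "partner_strands d' p q"
    obtain j t where j: "j < k" "t \<in> {-1..1}" "p = e j t" using pJ by (rule P.J_E)
    obtain i s where "i < k" "(j, t) \<noteq> (i, s)" "a' j t = a' i s"
      using P'.partner_e_E[OF j(1,2)] part j(3) by blast
    then show False using k j by (simp add: straight_pic_def)
  qed
  have over_J: "p \<notin> over d" if "p \<in> J" for p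
  proof -
    obtain j t where "j < k" "t \<in> {-1..1}" "p = e j t" using \<open>p \<in> J\<close> by (rule P.J_E)
    then show ?thesis using P.over_e k(4) by simp
  qed
  have pre_xy: "x \<in> pre_strands d" "y \<in> pre_strands d"
    using xy over_J xJ partner_strands_sym[of d x y] unfolding pre_strands_def by blast+
  have pre_J: "p = x \<or> p = y" if p: "p \<in> J" "p \<in> pre_strands d" for p
  proof -
    obtain q where "partner_strands d p q" using p(2) by (auto simp: pre_strands_def)
    then show ?thesis using J_partner[OF p(1)] by blast
  qed
  have pre_J': "p \<notin> J" if p: "p \<in> pre_strands d'" for p
  proof -
    obtain q where "partner_strands d' p q" using p by (auto simp: pre_strands_def)
    then show ?thesis using J_double'[of p q] by blast
  qed
  { fix R assume R: "resolution_choice d R"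
    obtain R' where "resolution_choice d' R'" "R' - J = R - J"
    proof (rule transfer_id[OF R])
      show sub: "pre_strands d' \<subseteq> pre_strands d" using pre_J' pre_outside by blast
      show "homol d' \<subseteq> homol d"
      proof (rule subrelI)
        fix p q assume pq: "(p, q) \<in> homol d'"
        have "p \<in> pre_strands d'" "q \<in> pre_strands d'" using subsetD[OF m'(1) pq] by auto
        then show "(p, q) \<in> homol d" using pq hom[of p q] pre_J'[of p] pre_J'[of q] sub by blast
      qed
      fix p q assume "p \<in> J" "partner_strands d' p q"
      then show "partner_strands d p q" using J_double'[of p q] by blast
    qed
    then show "\<exists>R'. choices_matched d R d' R'" using kink_matched[OF k(1-3) R] by blast }
  fix R' assume R': "resolution_choice d' R'"
  interpret S: picture_pair d' d k a' Ov' a Ov \<phi> e by (rule pair_sym)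
  have "\<exists>R. resolution_choice d R \<and> R - J = R' - J"
  proof (cases "\<exists>p. p \<notin> J \<and> (p, x) \<in> homol d")
    case True
    then obtain p0 where p0: "p0 \<notin> J" "(p0, x) \<in> homol d" by blast
    obtain R where R: "resolution_choice d R"
      "\<And>p' p. p' \<notin> J \<and> (p', p) \<in> homol d \<Longrightarrow> p' \<in> pre_strands d' \<Longrightarrow> p \<in> pre_strands d \<Longrightarrow> p \<in> R \<longleftrightarrow> p' \<in> R'"
    \<comment> \<open>Every strand of \<open>d\<close> copies a homologous strand outside the
      picture; for the two strands of the kink such strands exist by the case assumption.\<close>
    proof (rule resolution_transfer[OF P'.motif P.motif R', of "\<lambda>p' p. p' \<notin> J \<and> (p', p) \<in> homol d"])
      fix p assume p: "p \<in> pre_strands d"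
      have pre': "p' \<in> pre_strands d'" if "p' \<notin> J" "(p', q) \<in> homol d" for p' q
        using that m(1) pre_outside by blast
      show "\<exists>p'\<in>pre_strands d'. p' \<notin> J \<and> (p', p) \<in> homol d"
      proof (cases "p \<in> J")
        case False
        then show ?thesis using m(2)[OF p] pre' by blast
      next
        case True
        then consider "p = x" | "p = y" using pre_J p by blast
        then show ?thesis
        proof cases
          case 1
          then show ?thesis using p0 pre' by blast
        next
          case 2
          \<comment> \<open>The marking respects partners, so the partner of \<open>p0\<close> is
            homologous to the partner \<open>y\<close> of \<open>x\<close>.\<close>
          obtain q0 where q0: "partner_strands d p0 q0" using m(1) p0(2) by (auto simp: pre_strands_def)
          then have "(q0, y) \<in> homol d" "q0 \<notin> J" using m(5)[OF p0(2) q0 xy] P.partner_J[OF q0] p0(1) by auto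
          then show ?thesis using pre' 2 by blast
        qed
      qed
    next
      fix p' p q assume a: "p' \<notin> J \<and> (p', p) \<in> homol d" "p' \<in> pre_strands d'" "p \<in> pre_strands d" "partner_strands d p q"
      then obtain q' where q': "partner_strands d' p' q'" by (auto simp: pre_strands_def)
      have q'J: "q' \<notin> J" using P'.partner_J[OF q'] a(1) by blast
      have part: "partner_strands d p' q'" using q' a(1) partner_outside by blast
      then have h: "(q', q) \<in> homol d" using m(5) a by blast
      then have "q' \<in> pre_strands d'" using m(1) q'J pre_outside by blast
      then show "\<exists>q'\<in>pre_strands d'. partner_strands d' p' q' \<and> q' \<notin> J \<and> (q', q) \<in> homol d" using q' q'J h by blast
    next
      fix p' p q' q assume a: "p' \<notin> J \<and> (p', p) \<in> homol d" "q' \<notin> J \<and> (q', q) \<in> homol d" "(p, q) \<in> homol d"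
      then have "(p', q') \<in> homol d" using m(3,4) by blast
      then show "(p', q') \<in> homol d'" using hom a m(1) by blast
    qed (rule that, assumption, blast)
    have "R - J = R' - J"
      by (rule S.transfer_outside[OF R' R(1)]) (use R(2) m(2) pre_outside in blast)
    then show ?thesis using R(1) by blast
  next
    case False
    \<comment> \<open>No precrossing outside constrains the kink, and \<open>x\<close> is put on
      top.\<close>
    define R where "R = insert x R'"
    have R'J: "p \<notin> J" if "p \<in> R'" for p
      using that R' J_double' unfolding resolution_choice_def double_strands_def by blast
    have "y \<noteq> x" using xy unfolding partner_strands_def by blast
    moreover have "y \<notin> R'" using R'J[of y] xJ(2) by blast
    ultimately have y: "y \<notin> R" by (simp add: R_def)
    have notx: "\<not> (p \<notin> J \<and> (p, y) \<in> homol d)" for p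
    proof
      assume p: "p \<notin> J \<and> (p, y) \<in> homol d"
      then obtain q where q: "partner_strands d p q" using m(1) by (auto simp: pre_strands_def)
      have "(q, x) \<in> homol d" using m(5)[of p y q x] p q xy partner_strands_sym[of d x y] by blast
      moreover have "q \<notin> J" using P.partner_J[OF q] p by blast
      ultimately show False using False by blast
    qed
    have "resolution_choice d R"
      unfolding resolution_choice_def
    proof (intro conjI allI impI)
      show "over d \<subseteq> R"
      proof
        fix p assume p: "p \<in> over d"
        then have "p \<notin> J" "p \<in> params d" using over_J motif_strands_params(1)[OF P.motif] by blast+
        then have "p \<in> over d'" using p over_outside by blast
        then show "p \<in> R" using R' by (auto simp: R_def resolution_choice_def)
      qed
      show "R \<subseteq> double_strands d"
        using xy R' R'J partner_outside unfolding R_def resolution_choice_def double_strands_def by blast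
      fix p q assume part: "partner_strands d p q"
      show "(p \<in> R) = (q \<notin> R)"
      proof (cases "p \<in> J")
        case True
        then show ?thesis using J_partner[OF True part] y by (auto simp: R_def)
      next
        case False
        then have "partner_strands d' p q" "q \<notin> J" using part partner_outside P.partner_J by blast+
        then have "p \<in> R' \<longleftrightarrow> q \<notin> R'" "p \<noteq> x" "q \<noteq> x" using resolution_choice_partner[OF R'] xJ False by auto
        then show ?thesis by (simp add: R_def)
      qed
    next
      \<comment> \<open>Homology classes that meet the picture stay inside it: for \<open>x\<close>
        by the case assumption, and for \<open>y\<close> because partners would lead back to
        \<open>x\<close>.\<close>
      have closed: "w \<in> J" if w: "(w, z) \<in> homol d" "z \<in> J" for w z
      proof -
        have "z = x \<or> z = y" using pre_J[of z] w m(1) by blast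
        then show ?thesis using w(1) False notx[of w] by blast
      qed
      have *: "p \<in> R \<longleftrightarrow> q \<in> R" if h: "(p, q) \<in> homol d" for p q
      proof -
        have pre: "p \<in> pre_strands d" "q \<in> pre_strands d" using m(1) h by blast+
        show ?thesis
        proof (cases "p \<in> J \<or> q \<in> J")
          case True
          then have "p \<in> J" "q \<in> J" using closed[OF h] closed[OF m(3)[OF h]] by blast+
          then have "p = x \<or> p = y" "q = x \<or> q = y" using pre_J pre by blast+
          \<comment> \<open>Validity of the marking enters here: were \<open>x\<close> and
            \<open>y\<close> homologous, no choice at the kink would be possible.\<close>
          moreover have "(x, y) \<notin> homol d" using m(6)[OF xy] .
          ultimately show ?thesis using h m(3)[OF h] by auto
        next
          case F: False
          then have "(p, q) \<in> homol d'" using hom pre h by blast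
          then have "p \<in> R' \<longleftrightarrow> q \<in> R'" using R' by (auto simp: resolution_choice_def)
          moreover have "p \<noteq> x" "q \<noteq> x" using F xJ by auto
          ultimately show ?thesis by (simp add: R_def)
        qed
      qed
      show "\<forall>(p, q)\<in>homol d. (p \<in> R) = (q \<in> R)"
        by (intro ballI) (clarify, rule *)
    qed
    moreover have "R - J = R' - J" using xJ by (auto simp: R_def)
    ultimately show ?thesis by blast
  qed
  then obtain R where R: "resolution_choice d R" "R - J = R' - J" by blast
  have "choices_matched d R d' R'" by (rule kink_matched[OF k(1-3) R(1) R' R(2)[symmetric]])
  then show "\<exists>R. choices_matched d' R' d R" using choices_matched_sym[OF _ P.motif R(1)] by blast
qed

text \<open>The picture \<open>b\<close> is free of crossings, so all double points lie outside the
  chart, where the two choices agree. In PR2 this lets the two parallel arcs exchange their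
  levels.\<close>

lemma pcurve_vertical:
  assumes b: "\<And>j t. j < k \<Longrightarrow> t \<in> {-1..1} \<Longrightarrow> b j t \<in> square"
    "\<And>j t i s. \<lbrakk>j < k; t \<in> {-1..1}; i < k; s \<in> {-1..1}; b j t = b i s\<rbrakk> \<Longrightarrow> (j, t) = (i, s)"
    and cont: "continuous_on (params d) (P.pcurve b)"
    and R: "resolution_choice d R" and R': "R' - J = R - J"
    and h: "height_function d R h" and h': "height_function d' R' h'"
  shows "torus_isotopic (height_graph (params d) (P.pcurve b) h) (height_graph (params d) (P.pcurve b) h')"
proof -
  have part: "p \<notin> J \<and> q \<notin> J \<and> partner_strands d p q"
    if pq: "p \<in> params d" "q \<in> params d" "p \<noteq> q" "P.pcurve b p = P.pcurve b q" for p q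
  proof -
    have inJ: "P.pcurve b r \<in> \<phi> ` square \<longleftrightarrow> r \<in> J" if "r \<in> params d" for r
    proof (cases "r \<in> J")
      case True
      then obtain j t where "j < k" "t \<in> {-1..1}" "r = e j t" by (rule P.J_E)
      then show ?thesis using True b(1) by (simp add: P.pcurve_e)
    next
      case False
      then show ?thesis using P.J_iff[OF that] by (simp add: P.pcurve_def)
    qed
    show ?thesis
    proof (cases "p \<in> J")
      case True
      then have "q \<in> J" using inJ pq by metis
      obtain j t where j: "j < k" "t \<in> {-1..1}" "p = e j t" using True by (rule P.J_E)
      obtain i s where i: "i < k" "s \<in> {-1..1}" "q = e i s" using \<open>q \<in> J\<close> by (rule P.J_E)
      have "b j t = b i s"
        using pq(4) j i b(1) inj_onD[OF P.chart(2), of "b j t" "b i s"] by (simp add: P.pcurve_e)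
      then show ?thesis using b(2)[OF j(1,2) i(1,2)] pq(3) i j by auto
    next
      case False
      then have "q \<notin> J" using inJ pq by metis
      then show ?thesis using False pq by (simp add: P.pcurve_def partner_strands_def)
    qed
  qed
  show ?thesis
  proof (rule strand_vertical_isotopic[OF pseudo_motifD(1)[OF P.motif] cont P.pcurve_torus[OF b(1)]])
    show "finite {p \<in> params d. \<exists>q\<in>params d. q \<noteq> p \<and> P.pcurve b q = P.pcurve b p}"
    proof (rule finite_subset[OF _ pseudo_motifD(4)[OF P.motif]])
      show "{p \<in> params d. \<exists>q\<in>params d. q \<noteq> p \<and> P.pcurve b q = P.pcurve b p} \<subseteq> double_strands d"
      proof
        fix p assume "p \<in> {p \<in> params d. \<exists>q\<in>params d. q \<noteq> p \<and> P.pcurve b q = P.pcurve b p}"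
        then obtain q where "p \<in> params d" "q \<in> params d" "p \<noteq> q" "P.pcurve b p = P.pcurve b q" by auto
        from part[OF this] show "p \<in> double_strands d" unfolding double_strands_def by blast
      qed
    qed
    fix p q assume pq: "p \<in> params d" "q \<in> params d" "P.pcurve b p = P.pcurve b q"
    { fix r assume "r \<in> params d" "P.pcurve b p = P.pcurve b r" "p \<noteq> q" "p \<noteq> r"
      then show "q = r" using part[of p q] part[of p r] pq pseudo_motifD(5)[OF P.motif] by blast }
    assume "p \<noteq> q"
    then have *: "p \<notin> J" "q \<notin> J" "partner_strands d p q" using part pq by blast+
    then have **: "partner_strands d' p q" "partner_strands d q p" "partner_strands d' q p"
      using partner_outside[of p q] partner_strands_sym[of d p q] partner_strands_sym[of d' p q] by auto
    have RR: "p \<in> R' \<longleftrightarrow> p \<in> R" "q \<in> R' \<longleftrightarrow> q \<in> R" using R' * by blast+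
    have "p \<in> R \<longleftrightarrow> q \<notin> R" by (rule resolution_choice_partner[OF R *(3)])
    then show "h p < h q \<and> h' p < h' q \<or> h q < h p \<and> h' q < h' p"
      using h h' * ** RR unfolding height_function_def by blast
  qed (use h h' params_eq in \<open>auto simp: height_function_def\<close>)
qed

text \<open>The move has \<open>r = 1/2\<close>. The converse relation is obtained by exchanging
  \<open>i\<close> with \<open>j\<close> and negating \<open>r\<close>, so one proof covers both
  directions.\<close>

definition clasp_transfer :: "nat \<Rightarrow> nat \<Rightarrow> real \<Rightarrow> nat \<times> complex \<Rightarrow> nat \<times> complex \<Rightarrow> bool" where
  "clasp_transfer i j r p p' \<longleftrightarrow> p \<notin> J \<and> p' = p \<or> p = e i r \<and> p' = e j (- r) \<or> p = e j r \<and> p' = e i (- r)"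

text \<open>If the upper strand of the precrossing lies on the arc that is on top at the classical crossing, the clasp
  can be undone, the two parallel arcs exchange their levels, and the clasp is redone. Otherwise the
  two resolved diagrams are the same.\<close>

lemma PR2_forward:
  assumes k: "k = 2" "a = clasp_pic" "a' = clasp_pic" "Ov = {(i, - r)}" "Ov' = {(j, r)}"
    and ij: "i = 0 \<and> j = 1 \<or> i = 1 \<and> j = 0" and r: "r = 1/2 \<or> r = -1/2"
    and hom: "\<And>p q p' q'. \<lbrakk>clasp_transfer i j r p p'; clasp_transfer i j r q q'; p \<in> pre_strands d; q \<in> pre_strands d;
      p' \<in> pre_strands d'; q' \<in> pre_strands d'\<rbrakk> \<Longrightarrow> (p, q) \<in> homol d \<longleftrightarrow> (p', q') \<in> homol d'"
    and R: "resolution_choice d R"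
  shows "\<exists>R'. choices_matched d R d' R'"
proof -
  let ?N = "clasp_transfer i j r"
  have m': "homol d' \<subseteq> pre_strands d' \<times> pre_strands d'" using valid_markingD(1)[OF pseudo_motifD(8)[OF P'.motif]] .
  have rr: "r \<in> {-1..1}" "- r \<in> {-1..1}" "- r \<noteq> r" "- r = 1/2 \<or> - r = -1/2" using r by auto
  have lt: "i < k" "j < k" "i \<noteq> j" using ij k by auto
  have two: "m = i \<or> m = j" if "m < k" for m using that ij k by auto
  have double: "m' \<noteq> m \<and> s = t \<and> (t = r \<or> t = - r)"
    if "m < k" "m' < k" "(m, t) \<noteq> (m', s)" "clasp_pic m t = clasp_pic m' s" for m m' t s
    using clasp_double[OF that(4,3)] that k r by auto
  have part: "partner_strands d (e i s) (e j s)" "partner_strands d (e j s) (e i s)"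
    "partner_strands d' (e i s) (e j s)" "partner_strands d' (e j s) (e i s)" if "s = r \<or> s = - r" for s
    using that P.partner_e[of _ s _ s] P'.partner_e[of _ s _ s] lt rr k clasp_cross[of s i j] r by auto
  have partE: "(p = e i s \<longrightarrow> q = e j s) \<and> (p = e j s \<longrightarrow> q = e i s)"
    if "partner_strands d' p q" "s = r \<or> s = - r" for p q s
    using that part[OF that(2)] pseudo_motifD(5)[OF P'.motif] by blast
  have over: "e i (- r) \<in> over d" "e j r \<in> over d'" "e j (- r) \<notin> over d" "e i r \<notin> over d'" "e i r \<notin> over d"
    "e j r \<notin> over d" "e i (- r) \<notin> over d'" "e j (- r) \<notin> over d'"
    using P.over_e P'.over_e lt rr k by auto
  have pre: "e i r \<in> pre_strands d" "e j r \<in> pre_strands d" "e i (- r) \<in> pre_strands d'" "e j (- r) \<in> pre_strands d'"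
    using part[of r] part[of "- r"] over unfolding pre_strands_def by blast+
  have pre_J': "p = e i (- r) \<or> p = e j (- r)" if p: "p \<in> J" "p \<in> pre_strands d'" for p
  proof -
    obtain m t where m: "m < k" "t \<in> {-1..1}" "p = e m t" using p(1) by (rule P.J_E)
    obtain m' s where s: "m' < k" "(m, t) \<noteq> (m', s)" "clasp_pic m t = clasp_pic m' s" "(m, t) \<notin> Ov'" "(m', s) \<notin> Ov'"
      using P'.pre_e[OF m(1,2)] p(2) m(3) k by blast
    have "m' \<noteq> m" "s = t" "t = r \<or> t = - r" using double[OF m(1) s(1-3)] by auto
    moreover have "t \<noteq> r"
    proof
      assume "t = r"
      then have "m \<noteq> j" "m' \<noteq> j" using s(4,5) \<open>s = t\<close> k by auto
      then show False using two[OF m(1)] two[OF s(1)] \<open>m' \<noteq> m\<close> by auto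
    qed
    ultimately show ?thesis using two[OF m(1)] m(3) by auto
  qed
  have N: "?N (e i r) (e j (- r))" "?N (e j r) (e i (- r))" "\<And>p. p \<notin> J \<Longrightarrow> ?N p p"
    by (auto simp: clasp_transfer_def)
  obtain R' where R': "resolution_choice d' R'"
    "\<And>p p'. ?N p p' \<Longrightarrow> p \<in> pre_strands d \<Longrightarrow> p' \<in> pre_strands d' \<Longrightarrow> p' \<in> R' \<longleftrightarrow> p \<in> R"
  proof (rule resolution_transfer[OF P.motif P'.motif R, of ?N])
    fix p' assume p': "p' \<in> pre_strands d'"
    show "\<exists>p\<in>pre_strands d. ?N p p'"
    proof (cases "p' \<in> J")
      case True
      then show ?thesis using pre_J' p' pre N by blast
    next
      case False
      then show ?thesis using p' pre_outside N by blast
    qed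
  next
    fix p p' q' assume a: "?N p p'" "p \<in> pre_strands d" "p' \<in> pre_strands d'" "partner_strands d' p' q'"
    consider "p \<notin> J" "p' = p" | "p = e i r" "p' = e j (- r)" | "p = e j r" "p' = e i (- r)"
      using a(1) unfolding clasp_transfer_def by blast
    then show "\<exists>q\<in>pre_strands d. partner_strands d p q \<and> ?N q q'"
    proof cases
      case 1
      then have "partner_strands d p q'" "q' \<notin> J" using a(4) partner_outside P'.partner_J by blast+
      moreover have "q' \<in> pre_strands d"
        using a(2) \<open>partner_strands d p q'\<close> pseudo_motifD(5)[OF P.motif] partner_strands_sym[of d p q']
        unfolding pre_strands_def by blast
      ultimately show ?thesis using N by blast
    next
      case 2
      then have "q' = e i (- r)" using partE[OF a(4), of "- r"] by blast
      then show ?thesis using 2 part[of r] pre N by blast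
    next
      case 3
      then have "q' = e j (- r)" using partE[OF a(4), of "- r"] by blast
      then show ?thesis using 3 part[of r] pre N by blast
    qed
  next
    fix p p' q q' assume "?N p p'" "?N q q'" "p \<in> pre_strands d" "q \<in> pre_strands d" "(p', q') \<in> homol d'"
    then show "(p, q) \<in> homol d" using hom m' by blast
  qed (rule that, assumption, blast)
  have out: "R' - J = R - J"
    by (rule transfer_outside[OF R R'(1)]) (use R'(2) N pre_outside in blast)
  have overR: "over d \<subseteq> R" "over d' \<subseteq> R'" using R R' by (auto simp: resolution_choice_def)
  have mem: "e i (- r) \<in> R" "e j (- r) \<notin> R" "e j r \<in> R'" "e i r \<notin> R'"
    "e j (- r) \<in> R' \<longleftrightarrow> e i r \<in> R" "e i (- r) \<in> R' \<longleftrightarrow> e i r \<notin> R" "e j r \<in> R \<longleftrightarrow> e i r \<notin> R"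
  proof -
    show 1: "e i (- r) \<in> R" "e j r \<in> R'" using over overR by blast+
    show "e j (- r) \<notin> R" using resolution_choice_partner[OF R part(1)[of "- r"]] 1 by simp
    show "e i r \<notin> R'" using resolution_choice_partner[OF R'(1) part(4)[of r]] 1 by simp
    show 2: "e j (- r) \<in> R' \<longleftrightarrow> e i r \<in> R" using R'(2)[OF N(1)] pre by blast
    then show "e i (- r) \<in> R' \<longleftrightarrow> e i r \<notin> R" using resolution_choice_partner[OF R'(1) part(3)[of "- r"]] by simp
    show "e j r \<in> R \<longleftrightarrow> e i r \<notin> R" using resolution_choice_partner[OF R part(1)[of r]] by auto
  qed
  show ?thesis
  proof (cases "e i r \<in> R")
    case False
    \<comment> \<open>Arc \<open>i\<close> is on top at \<open>- r\<close> and arc \<open>j\<close>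
      at \<open>r\<close>, both before and after the move. The heights are linear with opposite
      slopes and change their order at the parameter 0.\<close>
    define \<gamma> where "\<gamma> m t = 1/2 + (if m = i then - (t * r / 2) else t * r / 2)" for m t
    have lt1: "\<gamma> m' s < \<gamma> m t" if "m < k" "m' < k" "(m, t) \<noteq> (m', s)" "clasp_pic m t = clasp_pic m' s"
      "m = i \<and> t = - r \<or> m = j \<and> t = r" for m m' t s
      using double[OF that(1-4)] that(5) lt r two[OF that(1)] two[OF that(2)] by (auto simp: \<gamma>_def)
    have "choices_matched d R d' R'"
    proof (rule matchedI[OF R R'(1) out, where \<gamma> = \<gamma>])
      show "continuous_on {-1..1} (\<gamma> m)" for m
        unfolding \<gamma>_def by (cases "m = i") (auto intro!: continuous_intros)
      show "0 < \<gamma> m t \<and> \<gamma> m t < 1" if t: "t \<in> {-1..1}" for m t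
      proof -
        have r': "\<bar>r\<bar> = 1/2" using r by (auto simp: abs_if)
        have "\<bar>t * r\<bar> = \<bar>t\<bar> * (1/2)" unfolding abs_mult r' ..
        also have "\<dots> \<le> 1/2" using t by (auto simp: abs_if)
        finally have "t * r \<le> 1/2" "- (t * r) \<le> 1/2" by linarith+
        then show ?thesis unfolding \<gamma>_def by (cases "m = i") auto
      qed
      fix m m' :: nat and t s :: real
      assume *: "m < k" "t \<in> {-1..1}" "m' < k" "s \<in> {-1..1}" "(m, t) \<noteq> (m', s)"
      { assume c: "a m t = a m' s" "e m t \<in> R" "e m' s \<notin> R"
        then have "m = i \<and> t = - r \<or> m = j \<and> t = r"
          using double[OF *(1,3,5)] two[OF *(1)] mem False k by auto
        then show "\<gamma> m' s < \<gamma> m t" using lt1[OF *(1,3,5)] c k by simp }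
      { assume c: "a' m t = a' m' s" "e m t \<in> R'" "e m' s \<notin> R'"
        then have "m = i \<and> t = - r \<or> m = j \<and> t = r"
          using double[OF *(1,3,5)] two[OF *(1)] mem False k by auto
        then show "\<gamma> m' s < \<gamma> m t" using lt1[OF *(1,3,5)] c k by simp }
    qed (simp add: k)
    then show ?thesis by blast
  next
    case True
    \<comment> \<open>Arc \<open>i\<close> is above at both crossings of \<open>d\<close>, and arc
      \<open>j\<close> at both crossings of \<open>d'\<close>; so constant levels suffice to undo
      either clasp.\<close>
    define l where "l m = (if m = i then 3/4 else 1/4 :: real)" for m
    define l' where "l' m = (if m = j then 3/4 else 1/4 :: real)" for m
    have l: "1/4 \<le> \<bar>l 0 - l 1\<bar>" "1/4 \<le> \<bar>l' 0 - l' 1\<bar>" using ij by (auto simp: l_def l'_def)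
    have "\<exists>h. height_function d R h \<and> (\<forall>m<k. \<forall>t\<in>{-1..1}. h (e m t) = l m)"
    proof (rule P.heights_exist[OF R])
      fix m t m' s assume *: "m < k" "t \<in> {-1..1}" "m' < k" "s \<in> {-1..1}" "(m, t) \<noteq> (m', s)" "a m t = a m' s"
        "e m t \<in> R" "e m' s \<notin> R"
      have "m = i" using double[OF *(1,3,5)] * two[OF *(1)] mem True k by auto
      then show "l m' < l m" using double[OF *(1,3,5)] * k by (auto simp: l_def)
    qed (auto simp: l_def)
    then obtain h where h: "height_function d R h" "\<forall>m<k. \<forall>t\<in>{-1..1}. h (e m t) = l m" by blast
    have "\<exists>h'. height_function d' R' h' \<and> (\<forall>m<k. \<forall>t\<in>{-1..1}. h' (e m t) = l' m)"
    proof (rule P'.heights_exist[OF R'(1)])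
      fix m t m' s assume *: "m < k" "t \<in> {-1..1}" "m' < k" "s \<in> {-1..1}" "(m, t) \<noteq> (m', s)" "a' m t = a' m' s"
        "e m t \<in> R'" "e m' s \<notin> R'"
      have "m = j" using double[OF *(1,3,5)] * two[OF *(1)] mem True k by auto
      then show "l' m' < l' m" using double[OF *(1,3,5)] * k by (auto simp: l'_def)
    qed (auto simp: l'_def)
    then obtain h' where h': "height_function d' R' h'" "\<forall>m<k. \<forall>t\<in>{-1..1}. h' (e m t) = l' m" by blast
    have ah: "P.arc_heights (\<lambda>m t. l m) h" "P.arc_heights (\<lambda>m t. l' m) h'"
      using h h' by (auto simp: P.arc_heights_def height_function_def params_eq)
    have pic: "picture d 2 a Ov \<phi> e" using P.picture_axioms k by simp
    note s1 = clasp_slide[OF pic l(1) ah(1)[unfolded k(1)]] and s2 = clasp_slide[OF pic l(2) ah(2)[unfolded k(1)]]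
    have cc: "continuous_on (params d) (P.pcurve clasp_pic)"
      by (rule continuous_on_eq[OF pseudo_motifD(2)[OF P.motif]]) (rule P.pcurve_self[unfolded k(2), symmetric])
    have ch: "continuous_on (params d) h" using h by (simp add: height_function_def)
    have cp: "continuous_on (params d) (P.pcurve parallel_pic)" using s1 cc ch k(1) by simp
    have t1: "torus_isotopic (diagram_graph d h) (height_graph (params d) (P.pcurve parallel_pic) h)"
      using s1 graph_d[of h] k by simp
    have t2: "torus_isotopic (height_graph (params d) (P.pcurve parallel_pic) h) (height_graph (params d) (P.pcurve parallel_pic) h')"
      by (rule pcurve_vertical[OF _ _ cp R out h(1) h'(1)]) (use k pictures_in_square parallel_inj in auto)
    have "torus_isotopic (diagram_graph d' h') (height_graph (params d) (P.pcurve parallel_pic) h')"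
      using s2 graph_d'[of h'] k by simp
    then have t3: "torus_isotopic (height_graph (params d) (P.pcurve parallel_pic) h') (diagram_graph d' h')"
      by (rule torus_isotopic_sym[OF _ diagram_graph_subset[OF P'.motif h'(1)]])
    have "torus_isotopic\<^sup>*\<^sup>* (diagram_graph d h) (diagram_graph d' h')"
      using t1 t2 t3 by (meson converse_rtranclp_into_rtranclp r_into_rtranclp)
    then show ?thesis using R'(1) h(1) h'(1) unfolding choices_matched_def by blast
  qed
qed

end

section \<open>The moves of triangles, and the remaining classical moves\<close>

context picture
begin

text \<open>Arc 2 has a level of its own and avoids the origin, so the crossing of arcs 0 and 1 at
  the origin is the only precrossing of the picture.\<close>

lemma triangle_pre:
  assumes k: "k = 3" "a = triangle_pic \<epsilon>" "Ov = layered 3 (triangle_pic \<epsilon>) l" and \<epsilon>: "\<epsilon> = 1 \<or> \<epsilon> = -1"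
    and l: "l 0 = l 1" "l 2 \<noteq> l 0" and j: "j < k" "t \<in> {-1..1}"
  shows "e j t \<in> pre_strands d \<longleftrightarrow> j < 2 \<and> t = 0"
proof
  assume pre: "e j t \<in> pre_strands d"
  obtain i s where i: "i < k" "s \<in> {-1..1}" "i \<noteq> j" "l i = l j" "a j t = a i s"
    by (rule layered_pre[of l j t]) (use pre j k triangle_arc_inj in auto)
  have "j < 2 \<and> i < 2" using i(1,3,4) j(1) l k by (auto simp: less_Suc_eq numeral_3_eq_3 numeral_2_eq_2)
  then show "j < 2 \<and> t = 0" using triangle_cross01[of \<epsilon> j t i s] i k by auto
next
  assume jt: "j < 2 \<and> t = 0"
  have lj: "l m = l 0" if "m < 2" for m using that l by (auto simp: less_2_cases_iff)
  have origin: "m < 2" if "m < 3" "triangle_pic \<epsilon> m s = triangle_pic \<epsilon> n 0" "n < 2" for m n s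
  proof (rule ccontr)
    assume "\<not> m < 2"
    then have "m = 2" using that by auto
    then show False using that \<epsilon> by (auto simp: triangle_pic_def split: if_splits)
  qed
  have notin: "(m, 0) \<notin> Ov" if m: "m < 2" for m
  proof
    assume "(m, 0) \<in> Ov"
    then obtain i s where i: "i < 3" "triangle_pic \<epsilon> i s = triangle_pic \<epsilon> m 0" "l i < l m"
      unfolding k layered_def by blast
    then show False using lj[OF origin[OF i(1,2) m]] lj[OF m] by simp
  qed
  have "1 - j < 2" "(j, t) \<noteq> (1 - j, 0)" "a j t = a (1 - j) 0"
    using jt k by (auto simp: triangle_pic_def less_2_cases_iff)
  moreover have "(j, t) \<notin> Ov" "(1 - j, 0) \<notin> Ov" "1 - j < k" "(0::real) \<in> {-1..1}"
    using notin[of j] notin[of "1 - j"] jt k by auto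
  ultimately show "e j t \<in> pre_strands d" unfolding pre_e[OF j] by blast
qed

end

lemma triangle_origin:
  assumes "\<epsilon> = 1 \<or> \<epsilon> = -1" "j < 2" "i < 3"
  shows "triangle_pic \<epsilon> j 0 = triangle_pic \<epsilon> i s \<longleftrightarrow> i < 2 \<and> s = 0"
proof -
  have "i < 2 \<or> i = 2" using assms by auto
  then show ?thesis using assms by (auto simp: triangle_pic_def)
qed

context picture_pair
begin

text \<open>Resolving the precrossing puts arcs 0 and 1 at different levels on the same side of arc
  2; what remains is a layered triangle move. Arc 2 may lie above or below, which covers PR3 and
  PR3' together.\<close>

lemma PR3_related:
  assumes k: "k = 3" "a = triangle_pic (-1)" "a' = triangle_pic 1"
    and Ov: "Ov = layered 3 (triangle_pic (-1)) l" "Ov' = layered 3 (triangle_pic 1) l"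
    and l: "l 0 = l 1" "l 2 \<noteq> l 0"
    and hom: "\<And>p q. \<lbrakk>p \<in> pre_strands d; q \<in> pre_strands d; p \<in> pre_strands d'; q \<in> pre_strands d'\<rbrakk>
      \<Longrightarrow> (p, q) \<in> homol d \<longleftrightarrow> (p, q) \<in> homol d'"
  shows "motif_related d d'"
proof (rule identity_related)
  have preJ: "e j t \<in> pre_strands d \<longleftrightarrow> j < 2 \<and> t = 0" "e j t \<in> pre_strands d' \<longleftrightarrow> j < 2 \<and> t = 0"
    if "j < k" "t \<in> {-1..1}" for j t
    using P.triangle_pre[OF k(1,2) Ov(1) _ l that] P'.triangle_pre[OF k(1,3) Ov(2) _ l that] by auto
  have "p \<in> pre_strands d' \<longleftrightarrow> p \<in> pre_strands d" for p
  proof (cases "p \<in> J")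
    case True
    then obtain j t where "j < k" "t \<in> {-1..1}" "p = e j t" by (rule P.J_E)
    then show ?thesis using preJ by simp
  qed (rule pre_outside)
  then show pre: "pre_strands d' = pre_strands d" by blast
  have "(p, q) \<in> homol d' \<longleftrightarrow> (p, q) \<in> homol d" for p q
    using hom[of p q] pre valid_markingD(1)[OF pseudo_motifD(8)[OF P.motif]] valid_markingD(1)[OF pseudo_motifD(8)[OF P'.motif]]
    by blast
  then show "homol d' = homol d" by auto
  show "partner_strands d' p q \<longleftrightarrow> partner_strands d p q" if pJ: "p \<in> J" "p \<in> pre_strands d" for p q
  proof (cases "q \<in> J")
    case True
    obtain j t where j: "j < k" "t \<in> {-1..1}" "p = e j t" using pJ(1) by (rule P.J_E)
    obtain i s where i: "i < k" "s \<in> {-1..1}" "q = e i s" using True by (rule P.J_E)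
    have "j < 2" "t = 0" using preJ(1)[OF j(1,2)] pJ(2) j(3) by auto
    then have "a j t = a i s \<longleftrightarrow> a' j t = a' i s"
      using triangle_origin[of 1 j i s] triangle_origin[of "-1" j i s] i(1) k by simp
    then show ?thesis using P.partner_e[OF j(1,2) i(1,2)] P'.partner_e[OF j(1,2) i(1,2)] j(3) i(3) by simp
  next
    case False
    then show ?thesis using P.partner_J P'.partner_J pJ(1) by blast
  qed
  fix R R' assume R: "resolution_choice d R" and R': "resolution_choice d' R'" and out: "R' - J = R - J"
    and mem: "\<And>p. p \<in> pre_strands d \<Longrightarrow> p \<in> R' \<longleftrightarrow> p \<in> R"
  have zero: "(0::real) \<in> {-1..1}" by simp
  have part: "partner_strands d (e 0 0) (e 1 0)"
    using P.partner_e[of 0 0 1 0] k by (simp add: triangle_pic_def)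
  have one: "e 0 0 \<in> R \<longleftrightarrow> e 1 0 \<notin> R" by (rule resolution_choice_partner[OF R part])
  \<comment> \<open>Doubling the levels makes room to separate arcs 0 and 1 according to
    \<open>R\<close> without changing their position relative to arc 2.\<close>
  define l' where "l' m = 2 * l m + (if m < 2 \<and> e m 0 \<in> R then 1 else 0 :: nat)" for m
  have l'_less: "l' i < l' j" if "l i < l j" for i j using that by (auto simp: l'_def)
  have l'_eq: "l' i < l' j" if "i < 2" "j < 2" "i \<noteq> j" "e j 0 \<in> R" for i j
    using that one l by (auto simp: l'_def less_2_cases_iff)
  have inj: "inj_on l' {..<3}"
  proof (rule inj_onI, rule ccontr)
    fix i j assume ij: "i \<in> {..<3}" "j \<in> {..<3::nat}" "l' i = l' j" "i \<noteq> j"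
    then have "l i = l j" using l'_less[of i j] l'_less[of j i] by linarith
    then have "i < 2" "j < 2" using ij l by (auto simp: less_Suc_eq numeral_3_eq_3 numeral_2_eq_2)
    then have "e i 0 \<in> R \<or> e j 0 \<in> R" using one ij(4) by (auto simp: less_2_cases_iff)
    then show False using l'_eq[of i j] l'_eq[of j i] ij \<open>i < 2\<close> \<open>j < 2\<close> by auto
  qed
  have same: "j < 2 \<and> i < 2" if "i < k" "j < k" "i \<noteq> j" "l i = l j" for i j
    using that l k by (auto simp: less_Suc_eq numeral_3_eq_3 numeral_2_eq_2)
  show "choices_matched d R d' R'"
  proof (rule layered_matched[OF _ R R' out, where l = l'])
    fix j i :: nat and t s :: real
    assume *: "j < k" "t \<in> {-1..1}" "i < k" "s \<in> {-1..1}" "(j, t) \<noteq> (i, s)"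
    { assume c: "a j t = a i s" "e j t \<in> R"
      have "i \<noteq> j" using * c k triangle_arc_inj by auto
      show "l' i < l' j"
      proof (cases "l i = l j")
        case True
        then have "j < 2" "i < 2" using same * \<open>i \<noteq> j\<close> by auto
        then show ?thesis using l'_eq[of i j] triangle_cross01[of "-1" j t i s] c k \<open>i \<noteq> j\<close> by auto
      next
        case False
        then show ?thesis using P.layered_order[of l R j t i s] Ov k R * c l'_less by auto
      qed }
    { assume c: "a' j t = a' i s" "e j t \<in> R'"
      have "i \<noteq> j" using * c k triangle_arc_inj by auto
      show "l' i < l' j"
      proof (cases "l i = l j")
        case True
        then have ji: "j < 2" "i < 2" using same * \<open>i \<noteq> j\<close> by auto
        then have "t = 0" using triangle_cross01[of 1 j t i s] c k \<open>i \<noteq> j\<close> by auto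
        then have "e j 0 \<in> R" using mem[of "e j t"] preJ[OF *(1,2)] ji c by auto
        then show ?thesis using l'_eq[of i j] ji \<open>i \<noteq> j\<close> by auto
      next
        case False
        then show ?thesis using P'.layered_order[of l R' j t i s] Ov k R' * c l'_less by auto
      qed }
  next
    fix h assume h: "P.arc_heights (\<lambda>j t. level k l' j) h"
    show "torus_isotopic (height_graph (params d) (P.pcurve a) h) (height_graph (params d) (P.pcurve a') h)"
      using triangle_slide[of d a Ov \<phi> e "level k l'" h] h P.picture_axioms level_diff[OF inj] unfolding k by simp
  qed (simp add: k)
qed

lemma R3_related:
  assumes k: "k = 3" "a = triangle_pic (-1)" "a' = triangle_pic 1"
    and Ov: "Ov = layered 3 (triangle_pic (-1)) l" "Ov' = layered 3 (triangle_pic 1) l" and inj: "inj_on l {..<3}"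
    and hom: "\<And>p q. \<lbrakk>p \<notin> J; q \<notin> J; p \<in> pre_strands d; q \<in> pre_strands d\<rbrakk> \<Longrightarrow> (p, q) \<in> homol d \<longleftrightarrow> (p, q) \<in> homol d'"
  shows "motif_related d d'"
proof (rule classical_related[OF _ hom])
  have ne: "l i \<noteq> l j" if "i < k" "j < k" "i \<noteq> j" for i j using inj_onD[OF inj, of i j] that k by auto
  show "p \<notin> pre_strands d \<and> p \<notin> pre_strands d'" if pJ: "p \<in> J" for p
  proof -
    obtain j t where j: "j < k" "t \<in> {-1..1}" "p = e j t" using pJ by (rule P.J_E)
    have "e j t \<notin> pre_strands d"
      using P.layered_pre[of l j t] Ov k j ne triangle_arc_inj by metis
    moreover have "e j t \<notin> pre_strands d'"
      using P'.layered_pre[of l j t] Ov k j ne triangle_arc_inj by metis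
    ultimately show ?thesis using j by simp
  qed
  fix R R' assume R: "resolution_choice d R" and R': "resolution_choice d' R'" and out: "R' - J = R - J"
  show "choices_matched d R d' R'"
  proof (rule layered_matched[OF _ R R' out, where l = l])
    fix j i :: nat and t s :: real
    assume *: "j < k" "t \<in> {-1..1}" "i < k" "s \<in> {-1..1}" "(j, t) \<noteq> (i, s)"
    { assume c: "a j t = a i s" "e j t \<in> R"
      have "i \<noteq> j" using * c k triangle_arc_inj by auto
      then show "l i < l j" using P.layered_order[of l R j t i s] Ov k R * c ne by auto }
    { assume c: "a' j t = a' i s" "e j t \<in> R'"
      have "i \<noteq> j" using * c k triangle_arc_inj by auto
      then show "l i < l j" using P'.layered_order[of l R' j t i s] Ov k R' * c ne by auto }
  next
    fix h assume h: "P.arc_heights (\<lambda>j t. level k l j) h"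
    show "torus_isotopic (height_graph (params d) (P.pcurve a) h) (height_graph (params d) (P.pcurve a') h)"
      using triangle_slide[of d a Ov \<phi> e "level k l" h] h P.picture_axioms level_diff[OF inj] unfolding k by simp
  qed (simp add: k)
qed

lemma R2_related:
  assumes k: "k = 2" "a = clasp_pic" "a' = parallel_pic" and Ov: "Ov = layered 2 clasp_pic l" and l: "l 0 \<noteq> l 1"
    and hom: "\<And>p q. \<lbrakk>p \<notin> J; q \<notin> J; p \<in> pre_strands d; q \<in> pre_strands d\<rbrakk> \<Longrightarrow> (p, q) \<in> homol d \<longleftrightarrow> (p, q) \<in> homol d'"
  shows "motif_related d d'"
proof (rule classical_related[OF _ hom])
  have inj: "inj_on l {..<2}" using l by (auto simp: inj_on_def less_2_cases_iff)
  have ne: "l i \<noteq> l j" if "i < k" "j < k" "i \<noteq> j" for i j using inj_onD[OF inj, of i j] that k by auto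
  have arcs: "clasp_pic j t = clasp_pic j s \<Longrightarrow> t = s" for j t s by (auto simp: clasp_pic_def split: if_splits)
  have par: "(j, t) = (i, s)" if "j < k" "i < k" "a' j t = a' i s" for j t i s
    using parallel_inj[of j t i s] that k by simp
  show "p \<notin> pre_strands d \<and> p \<notin> pre_strands d'" if pJ: "p \<in> J" for p
  proof -
    obtain j t where j: "j < k" "t \<in> {-1..1}" "p = e j t" using pJ by (rule P.J_E)
    have "e j t \<notin> pre_strands d"
      using P.layered_pre[of l j t] Ov k j ne arcs by metis
    moreover have "e j t \<notin> pre_strands d'"
      using P'.pre_e[OF j(1,2)] par j(1) by blast
    ultimately show ?thesis using j by simp
  qed
  fix R R' assume R: "resolution_choice d R" and R': "resolution_choice d' R'" and out: "R' - J = R - J"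
  show "choices_matched d R d' R'"
  proof (rule layered_matched[OF _ R R' out, where l = l])
    fix j i :: nat and t s :: real
    assume *: "j < k" "t \<in> {-1..1}" "i < k" "s \<in> {-1..1}" "(j, t) \<noteq> (i, s)"
    { assume c: "a j t = a i s" "e j t \<in> R"
      have "i \<noteq> j" using * c k arcs by auto
      then show "l i < l j" using P.layered_order[of l R j t i s] Ov k R * c ne by auto }
    { assume c: "a' j t = a' i s"
      then show "l i < l j" using par * by blast }
  next
    fix h assume h: "P.arc_heights (\<lambda>j t. level k l j) h"
    show "torus_isotopic (height_graph (params d) (P.pcurve a) h) (height_graph (params d) (P.pcurve a') h)"
      using clasp_slide[of d a Ov \<phi> e "level k l" h] h P.picture_axioms level_diff[OF inj] unfolding k by simp
  qed (simp add: k)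
qed

lemma R1_related:
  assumes k: "k = 1" "a = kink_pic" "a' = straight_pic" and Ov: "Ov = {(0, s)}" and s: "s = 1/2 \<or> s = -1/2"
    and hom: "\<And>p q. \<lbrakk>p \<notin> J; q \<notin> J; p \<in> pre_strands d; q \<in> pre_strands d\<rbrakk> \<Longrightarrow> (p, q) \<in> homol d \<longleftrightarrow> (p, q) \<in> homol d'"
  shows "motif_related d d'"
proof (rule classical_related[OF _ hom])
  show "p \<notin> pre_strands d \<and> p \<notin> pre_strands d'" if pJ: "p \<in> J" for p
  proof -
    obtain j t where j: "j < k" "t \<in> {-1..1}" "p = e j t" using pJ by (rule P.J_E)
    have "e j t \<notin> pre_strands d"
    proof
      assume "e j t \<in> pre_strands d"
      then obtain i r where i: "i < k" "(j, t) \<noteq> (i, r)" "a j t = a i r" "(j, t) \<notin> Ov" "(i, r) \<notin> Ov"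
        using P.pre_e[OF j(1,2)] by blast
      then have "t \<noteq> s" "r \<noteq> s" "t \<noteq> r" using j k Ov by auto
      then show False using kink_double[of j t i r] i k s by auto
    qed
    moreover have "e j t \<notin> pre_strands d'"
      using P'.pre_e[OF j(1,2)] j(1) k by (auto simp: straight_pic_def)
    ultimately show ?thesis using j by simp
  qed
  fix R R' assume "resolution_choice d R" "resolution_choice d' R'" "R' - J = R - J"
  then show "choices_matched d R d' R'" by (rule kink_matched[OF k])
qed

lemma PR2_related:
  assumes k: "k = 2" "a = clasp_pic" "a' = clasp_pic" "Ov = {(i, - 1/2)}" "Ov' = {(j, 1/2)}"
    and ij: "i = 0 \<and> j = 1 \<or> i = 1 \<and> j = 0"
    and hom: "\<And>p q p' q'. \<lbrakk>clasp_transfer i j (1/2) p p'; clasp_transfer i j (1/2) q q'; p \<in> pre_strands d; q \<in> pre_strands d;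
      p' \<in> pre_strands d'; q' \<in> pre_strands d'\<rbrakk> \<Longrightarrow> (p, q) \<in> homol d \<longleftrightarrow> (p', q') \<in> homol d'"
  shows "motif_related d d'"
proof (rule motif_relatedI[OF P.motif P'.motif])
  show "\<exists>R'. choices_matched d R d' R'" if "resolution_choice d R" for R
    by (rule PR2_forward[of i "1/2" j]) (use k ij hom that in auto)
  interpret S: picture_pair d' d k a' Ov' a Ov \<phi> e by (rule pair_sym)
  have tr: "S.clasp_transfer j i (- (1/2)) p p' \<longleftrightarrow> clasp_transfer i j (1/2) p' p" for p p'
    unfolding S.clasp_transfer_def clasp_transfer_def by auto
  show "\<exists>R. choices_matched d' R' d R" if "resolution_choice d' R'" for R'
    by (rule S.PR2_forward[of j "- (1/2)" i]) (use k ij hom that tr in auto)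
qed

end

text \<open>Translates the definition of the move into the locale. The relation \<open>M\<close> is
  the identity outside the picture and is given by \<open>\<tau>\<close> inside, which is
  \<open>Id\<close> for PR3 and PR3' and becomes \<open>clasp_transfer\<close> for PR2.\<close>

lemma local_move_related:
  assumes d: "pseudo_motif d" "pseudo_motif d'" and lm: "local_move d d'"
  shows "motif_related d d'"
proof -
  obtain k a Ov a' Ov' \<tau> \<phi> e where sm: "std_move k a Ov a' Ov' \<tau>"
    and chart: "continuous_on square \<phi>" "inj_on \<phi> square" "\<phi> ` square \<subseteq> torus"
    and arcs: "\<forall>j<k. continuous_on {-1..1} (e j)" "inj_on (\<lambda>(j, t). e j t) ({..<k} \<times> {-1..1})"
    and body: "let J = (\<lambda>(j, t). e j t) ` ({..<k} \<times> {-1..1});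
             M = {(p, p) | p. p \<in> params d - J} \<union>
                 {(e j t, e j' t') | j t j' t'. j < k \<and> j' < k \<and> t \<in> {-1..1} \<and> t' \<in> {-1..1} \<and>
                    ((j, t), (j', t')) \<in> \<tau>}
         in {p \<in> params d. curve d p \<in> \<phi> ` square} = J \<and>
            params d' = params d \<and>
            (\<forall>p \<in> params d - J. curve d' p = curve d p \<and> (p \<in> over d' \<longleftrightarrow> p \<in> over d)) \<and>
            (\<forall>j<k. \<forall>t\<in>{-1..1}.
               curve d (e j t) = \<phi> (a j t) \<and> curve d' (e j t) = \<phi> (a' j t) \<and>
               (e j t \<in> over d \<longleftrightarrow> (j, t) \<in> Ov) \<and> (e j t \<in> over d' \<longleftrightarrow> (j, t) \<in> Ov')) \<and>
            (\<forall>p q p' q'. (p, p') \<in> M \<and> (q, q') \<in> M \<and>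
               p \<in> pre_strands d \<and> q \<in> pre_strands d \<and>
               p' \<in> pre_strands d' \<and> q' \<in> pre_strands d' \<longrightarrow>
               ((p, q) \<in> homol d \<longleftrightarrow> (p', q') \<in> homol d'))"
    using lm unfolding local_move_def by (elim exE conjE)
  define J where "J = strands_of k e"
  define M where "M = {(p, p) | p. p \<in> params d - J} \<union>
    {(e j t, e j' t') | j t j' t'. j < k \<and> j' < k \<and> t \<in> {-1..1} \<and> t' \<in> {-1..1} \<and> ((j, t), (j', t')) \<in> \<tau>}"
  have inside: "{p \<in> params d. curve d p \<in> \<phi> ` square} = J" and params: "params d' = params d"
    and out: "\<forall>p \<in> params d - J. curve d' p = curve d p \<and> (p \<in> over d' \<longleftrightarrow> p \<in> over d)"
    and pic: "\<forall>j<k. \<forall>t\<in>{-1..1}. curve d (e j t) = \<phi> (a j t) \<and> curve d' (e j t) = \<phi> (a' j t) \<and>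
      (e j t \<in> over d \<longleftrightarrow> (j, t) \<in> Ov) \<and> (e j t \<in> over d' \<longleftrightarrow> (j, t) \<in> Ov')"
    and hom: "\<forall>p q p' q'. (p, p') \<in> M \<and> (q, q') \<in> M \<and> p \<in> pre_strands d \<and> q \<in> pre_strands d \<and>
      p' \<in> pre_strands d' \<and> q' \<in> pre_strands d' \<longrightarrow> ((p, q) \<in> homol d \<longleftrightarrow> (p', q') \<in> homol d')"
  proof -
    note c = body[unfolded Let_def strands_of_def[symmetric] J_def[symmetric] M_def[symmetric]]
    note c2 = conjunct2[OF c] and c3 = conjunct2[OF conjunct2[OF c]]
    note c4 = conjunct2[OF c3]
    show "{p \<in> params d. curve d p \<in> \<phi> ` square} = J" by (rule conjunct1[OF c])
    show "params d' = params d" by (rule conjunct1[OF c2])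
    show "\<forall>p \<in> params d - J. curve d' p = curve d p \<and> (p \<in> over d' \<longleftrightarrow> p \<in> over d)" by (rule conjunct1[OF c3])
    show "\<forall>j<k. \<forall>t\<in>{-1..1}. curve d (e j t) = \<phi> (a j t) \<and> curve d' (e j t) = \<phi> (a' j t) \<and>
      (e j t \<in> over d \<longleftrightarrow> (j, t) \<in> Ov) \<and> (e j t \<in> over d' \<longleftrightarrow> (j, t) \<in> Ov')" by (rule conjunct1[OF c4])
    show "\<forall>p q p' q'. (p, p') \<in> M \<and> (q, q') \<in> M \<and> p \<in> pre_strands d \<and> q \<in> pre_strands d \<and>
      p' \<in> pre_strands d' \<and> q' \<in> pre_strands d' \<longrightarrow> ((p, q) \<in> homol d \<longleftrightarrow> (p', q') \<in> homol d')"
      by (rule conjunct2[OF c4])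
  qed
  have sq: "a j t \<in> square" "a' j t \<in> square" if "t \<in> {-1..1}" for j t
    using std_move_square[OF sm that] by auto
  have P: "picture d k a Ov \<phi> e"
    by unfold_locales (use d chart arcs inside sq pic in \<open>auto simp: J_def\<close>)
  \<comment> \<open>The chart meets the same strands after the move, since both pictures lie in the
    square.\<close>
  have inside': "{p \<in> params d'. curve d' p \<in> \<phi> ` square} = J"
  proof -
    have "curve d' p \<in> \<phi> ` square \<longleftrightarrow> curve d p \<in> \<phi> ` square" if "p \<in> params d" for p
    proof (cases "p \<in> J")
      case True
      then obtain j t where j: "j < k" "t \<in> {-1..1}" "p = e j t" unfolding J_def strands_of_def by auto
      then show ?thesis using pic sq[OF j(2)] by auto
    next
      case False
      then show ?thesis using out that by simp
    qed
    then show ?thesis using inside params by blast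
  qed
  have P': "picture d' k a' Ov' \<phi> e"
    by unfold_locales (use d chart arcs inside' sq pic in \<open>auto simp: J_def\<close>)
  have agree: "agree_outside d d' (strands_of k e)"
    using params out by (simp add: agree_outside_def J_def)
  interpret picture_pair d d' k a Ov a' Ov' \<phi> e
    using P P' agree by (simp add: picture_pair_def picture_pair_axioms_def)
  have M_out: "(p, p) \<in> M" if "p \<notin> strands_of k e" "p \<in> pre_strands d" for p
    using that pre_strands_params[of d] unfolding M_def J_def by blast
  have hom_out: "(p, q) \<in> homol d \<longleftrightarrow> (p, q) \<in> homol d'"
    if "p \<notin> strands_of k e" "q \<notin> strands_of k e" "p \<in> pre_strands d" "q \<in> pre_strands d" for p q
    using hom M_out that pre_outside by blast
  have hom_id: "(p, q) \<in> homol d \<longleftrightarrow> (p, q) \<in> homol d'"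
    if "\<tau> = Id" "p \<in> pre_strands d" "q \<in> pre_strands d" "p \<in> pre_strands d'" "q \<in> pre_strands d'" for p q
  proof -
    have "(p, p) \<in> M" if "p \<in> pre_strands d" for p
    proof (cases "p \<in> J")
      case True
      then obtain j t where "j < k" "t \<in> {-1..1}" "p = e j t" unfolding J_def by (rule P.J_E)
      then show ?thesis unfolding M_def \<open>\<tau> = Id\<close> by blast
    qed (use M_out that J_def in blast)
    then show ?thesis using hom that by blast
  qed
  from sm show ?thesis
  proof cases
    case (R1 s)
    then show ?thesis using R1_related[of s] hom_out by blast
  next
    case (R2 l)
    then show ?thesis using R2_related[of l] hom_out by blast
  next
    case (R3 l)
    then show ?thesis using R3_related[of l] hom_out by blast
  next
    case PR1
    then show ?thesis using PR1_related hom_out by blast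
  next
    case (PR2 i j)
    have lt: "i < k" "j < k" using PR2 by auto
    have M2: "(p, p') \<in> M" if "clasp_transfer i j (1/2) p p'" "p \<in> pre_strands d" for p p'
    proof -
      consider "p \<notin> strands_of k e" "p' = p" | "p = e i (1/2)" "p' = e j (-1/2)" | "p = e j (1/2)" "p' = e i (-1/2)"
        using \<open>clasp_transfer i j (1/2) p p'\<close> unfolding clasp_transfer_def by auto
      then show ?thesis
      proof cases
        case 1
        then show ?thesis using M_out \<open>p \<in> pre_strands d\<close> by simp
      next
        case 2
        have "((i, 1/2), (j, -1/2)) \<in> \<tau>" using PR2 by simp
        then show ?thesis unfolding M_def 2 using lt by force
      next
        case 3
        have "((j, 1/2), (i, -1/2)) \<in> \<tau>" using PR2 by simp
        then show ?thesis unfolding M_def 3 using lt by force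
      qed
    qed
    show ?thesis
      by (rule PR2_related[of i j]) (use PR2 hom M2 in blast)+
  next
    case (PR3 l)
    then show ?thesis using PR3_related[of l] hom_id by auto
  next
    case (PR3' l)
    then show ?thesis using PR3_related[of l] hom_id by auto
  qed
qed

section \<open>Pseudo DP equivalence\<close>

lemma motif_step_related:
  assumes "motif_step (u, v, d) (u', v', d')"
  shows "isotopy_related (resolution_set u v (diagram_lift u v d)) (resolution_set u' v' (diagram_lift u' v' d'))"
  using assms
proof cases
  case reidemeister
  then show ?thesis
    using motif_related_resolution_sets surface_isotopy_related local_move_related
    unfolding pseudo_reidemeister_step_def by blast
next
  case (shift \<alpha> \<beta>)
  then show ?thesis
    using motif_related_resolution_sets surface_isotopy_related shift_surface_isotopy by blast
next
  case (rescale A)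
  then show ?thesis using rescale_related by blast
next
  case dehn_longitude
  then show ?thesis using dehn_longitude_related by blast
next
  case dehn_meridian
  then show ?thesis using dehn_meridian_related by blast
next
  \<comment> \<open>Both motifs are compared with the common motif over the larger lattice.\<close>
  case (cover u\<^sub>0 v\<^sub>0 d\<^sub>0)
  then show ?thesis
    using isotopy_related_trans[OF cover_related[of u v u\<^sub>0 v\<^sub>0 d d\<^sub>0] isotopy_related_sym[OF cover_related[of u' v' u\<^sub>0 v\<^sub>0 d' d\<^sub>0]]]
    by blast
qed

definition step_resolutions :: "plane \<times> plane \<times> motif \<Rightarrow> slab_pt set set" where
  "step_resolutions x = (case x of (u, v, d) \<Rightarrow> resolution_set u v (diagram_lift u v d))"

lemma pseudo_DP_equivalent_related:
  assumes "pseudo_DP_equivalent x y"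
  shows "isotopy_related (step_resolutions x) (step_resolutions y)"
  using assms unfolding pseudo_DP_equivalent_def
proof (induction rule: equivclp_induct)
  case base
  show ?case by (rule isotopy_related_refl)
next
  case (step y z)
  have "isotopy_related (step_resolutions a) (step_resolutions b)" if "motif_step a b" for a b
    using that motif_step_related by (cases a; cases b) (auto simp: step_resolutions_def)
  then show ?case using step isotopy_related_trans isotopy_related_sym by blast
qed

theorem theorem4p2:
  fixes u v u' v' :: plane
    and d d' :: motif
    and D D' :: "(plane \<times> nat \<times> complex, plane) pseudo_diagram"
  assumes "plane_basis u v" and "pseudo_motif d" and "D = diagram_lift u v d"
    and "plane_basis u' v'" and "pseudo_motif d'" and "D' = diagram_lift u' v' d'"
    and "pseudo_DP_equivalent (u, v, d) (u', v', d')"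
  shows "DP_isotopy_class ` resolution_set u v D = DP_isotopy_class ` resolution_set u' v' D' \<and>
         (\<forall>f :: slab_pt set \<Rightarrow> 'z. DP_isotopy_invariant f \<longrightarrow>
            f ` resolution_set u v D = f ` resolution_set u' v' D')"
proof -
  have rel: "isotopy_related (resolution_set u v D) (resolution_set u' v' D')"
    using pseudo_DP_equivalent_related[OF assms(7)] assms(3,6) by (simp add: step_resolutions_def)
  have classical: "classical_DP_tangle t" if "t \<in> resolution_set u v D \<or> t \<in> resolution_set u' v' D'" for t
    using that by (auto simp: resolution_set_def classical_DP_tangle_def)
  \<comment> \<open>The isotopy class and an invariant \<open>f\<close> are both constant on
    isotopic tangles, so both claims are instances of this one.\<close>
  have image_eq: "g ` resolution_set u v D = g ` resolution_set u' v' D'"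
    if g: "\<And>t t'. \<lbrakk>classical_DP_tangle t; classical_DP_tangle t'; DP_isotopic t t'\<rbrakk> \<Longrightarrow> g t = g t'" for g :: "slab_pt set \<Rightarrow> 'b"
  proof (intro equalityI subsetI)
    fix y assume "y \<in> g ` resolution_set u v D"
    then obtain t where t: "t \<in> resolution_set u v D" "y = g t" by blast
    then obtain t' where "t' \<in> resolution_set u' v' D'" "DP_isotopic t t'" using rel unfolding isotopy_related_def by blast
    then show "y \<in> g ` resolution_set u' v' D'" using t classical g by blast
  next
    fix y assume "y \<in> g ` resolution_set u' v' D'"
    then obtain t where t: "t \<in> resolution_set u' v' D'" "y = g t" by blast
    then obtain t' where "t' \<in> resolution_set u v D" "DP_isotopic t t'" using rel unfolding isotopy_related_def by blast
    then show "y \<in> g ` resolution_set u v D" using t classical g by blast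
  qed
  have "DP_isotopy_class t = DP_isotopy_class t'" if "DP_isotopic t t'" for t t'
    unfolding DP_isotopy_class_def using that DP_isotopic_sym DP_isotopic_trans by blast
  then have "DP_isotopy_class ` resolution_set u v D = DP_isotopy_class ` resolution_set u' v' D'"
    by (intro image_eq) blast
  moreover have "f ` resolution_set u v D = f ` resolution_set u' v' D'" if "DP_isotopy_invariant f" for f :: "slab_pt set \<Rightarrow> 'z"
    using that by (intro image_eq) (auto simp: DP_isotopy_invariant_def)
  ultimately show ?thesis by blast
qed

end
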